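(* (1) The theory of switchboards (in the language $L^-$) has a model companion $T^-$. (2) $T^-$ is $\aleph_0$-categorical and has the SOP. (3) If $M\models T^-$ and $\phi(x,y)$ is an $L^-(M)$-formula with $|y|=1$, then $\phi$ is NSOP.
   Context: For a set $M$, $[M]^2$ denotes the set of 2-element subsets of $M$ ("edges"). A switchboard is a set $M$ with a strict partial order $<$ on $[M]^2$ such that for any distinct $x,y,z\in M$, the edges $\{x,y\}$ and $\{x,z\}$ are incomparable (Switchboard Axiom). Switchboards are regarded as structures in the language $L^-$ with a single 4-ary relation symbol $<(x,y,z,w)$ interpreted as $x\ne y\wedge z\ne w\wedge \{x,y\}<\{z,w\}$. A partitioned formula $\phi(x;y)$ has the strict order property (SOP) (in a theory) if in some model $N$ there are $b_0,b_1,\ldots\in N^{y}$ with $\phi(N,b_0)\subsetneq\phi(N,b_1)\subsetneq\cdots$; a theory has the SOP if some formula of its language does; NSOP means not SOP. $|y|$ is the length of the tuple $y$. *)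

theory Defs
  imports "HOL-Library.Countable_Set"
begin

section \<open>Switchboards\<close>

definition edges :: "'u set \<Rightarrow> 'u set set" where
  "edges M = {e. e \<subseteq> M \<and> card e = 2}"

definition switchboard :: "'u set \<Rightarrow> ('u set \<Rightarrow> 'u set \<Rightarrow> bool) \<Rightarrow> bool" where
  "switchboard M lt \<longleftrightarrow>
     irreflp_on (edges M) lt \<and> transp_on (edges M) lt \<and>
     (\<forall>x\<in>M. \<forall>y\<in>M. \<forall>z\<in>M. x \<noteq> y \<and> x \<noteq> z \<and> y \<noteq> z \<longrightarrow>
        \<not> lt {x, y} {x, z} \<and> \<not> lt {x, z} {x, y})"

section \<open>First-order logic with one 4-ary relation symbol\<close>

text \<open>
  A language is given by a set \<open>C\<close> of constant symbols: it has equality, the 4-ary relation symbol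
  \<open>Less\<close>, and the constants in \<open>C\<close>. So \<open>L\<^sup>-\<close> is the case \<open>C = {}\<close>, and \<open>L\<^sup>-(M)\<close> is the case where
  \<open>C\<close> is the carrier of \<open>M\<close>.
\<close>

datatype (tm_consts: 'c) tm = Var nat | Cst 'c

datatype (fm_consts: 'c) fm =
    Eq "'c tm" "'c tm"
  | Less "'c tm" "'c tm" "'c tm" "'c tm"
  | Neg "'c fm"
  | And "'c fm" "'c fm"
  | Ex nat "'c fm"

abbreviation Imp :: "'c fm \<Rightarrow> 'c fm \<Rightarrow> 'c fm" where
  "Imp \<phi> \<psi> \<equiv> Neg (And \<phi> (Neg \<psi>))"

abbreviation All :: "nat \<Rightarrow> 'c fm \<Rightarrow> 'c fm" where
  "All v \<phi> \<equiv> Neg (Ex v (Neg \<phi>))"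

abbreviation Alls :: "nat list \<Rightarrow> 'c fm \<Rightarrow> 'c fm" where
  "Alls vs \<phi> \<equiv> foldr All vs \<phi>"

fun tm_vars :: "'c tm \<Rightarrow> nat set" where
  "tm_vars (Var v) = {v}"
| "tm_vars (Cst c) = {}"

primrec fv :: "'c fm \<Rightarrow> nat set" where
  "fv (Eq s t) = tm_vars s \<union> tm_vars t"
| "fv (Less s t u v) = tm_vars s \<union> tm_vars t \<union> tm_vars u \<union> tm_vars v"
| "fv (Neg \<phi>) = fv \<phi>"
| "fv (And \<phi> \<psi>) = fv \<phi> \<union> fv \<psi>"
| "fv (Ex v \<phi>) = fv \<phi> - {v}"

definition formulas :: "'c set \<Rightarrow> 'c fm set" where
  "formulas C = {\<phi>. fm_consts \<phi> \<subseteq> C}"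

definition sentences :: "'c set \<Rightarrow> 'c fm set" where
  "sentences C = {\<phi> \<in> formulas C. fv \<phi> = {}}"

text \<open>
  The values of \<open>less_rel\<close> outside the carrier, and of \<open>const_val\<close> outside \<open>C\<close>, carry no meaning.
\<close>

record ('c, 'u) struct =
  carrier :: "'u set"
  less_rel :: "'u \<Rightarrow> 'u \<Rightarrow> 'u \<Rightarrow> 'u \<Rightarrow> bool"
  const_val :: "'c \<Rightarrow> 'u"

definition is_struct :: "'c set \<Rightarrow> ('c, 'u) struct \<Rightarrow> bool" where
  "is_struct C M \<longleftrightarrow> carrier M \<noteq> {} \<and> const_val M ` C \<subseteq> carrier M"

fun tm_val :: "('c, 'u) struct \<Rightarrow> (nat \<Rightarrow> 'u) \<Rightarrow> 'c tm \<Rightarrow> 'u" where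
  "tm_val M e (Var v) = e v"
| "tm_val M e (Cst c) = const_val M c"

primrec sat :: "('c, 'u) struct \<Rightarrow> (nat \<Rightarrow> 'u) \<Rightarrow> 'c fm \<Rightarrow> bool" where
  "sat M e (Eq s t) \<longleftrightarrow> tm_val M e s = tm_val M e t"
| "sat M e (Less s t u v) \<longleftrightarrow>
     less_rel M (tm_val M e s) (tm_val M e t) (tm_val M e u) (tm_val M e v)"
| "sat M e (Neg \<phi>) \<longleftrightarrow> \<not> sat M e \<phi>"
| "sat M e (And \<phi> \<psi>) \<longleftrightarrow> sat M e \<phi> \<and> sat M e \<psi>"
| "sat M e (Ex v \<phi>) \<longleftrightarrow> (\<exists>a\<in>carrier M. sat M (e(v := a)) \<phi>)"

definition is_model :: "'c set \<Rightarrow> 'c fm set \<Rightarrow> ('c, 'u) struct \<Rightarrow> bool" where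
  "is_model C T M \<longleftrightarrow>
     is_struct C M \<and> (\<forall>\<phi>\<in>T. \<forall>e. range e \<subseteq> carrier M \<longrightarrow> sat M e \<phi>)"

definition is_embedding ::
  "'c set \<Rightarrow> ('c, 'u) struct \<Rightarrow> ('c, 'v) struct \<Rightarrow> ('u \<Rightarrow> 'v) \<Rightarrow> bool" where
  "is_embedding C M N f \<longleftrightarrow>
     f ` carrier M \<subseteq> carrier N \<and> inj_on f (carrier M) \<and>
     (\<forall>x\<in>carrier M. \<forall>y\<in>carrier M. \<forall>z\<in>carrier M. \<forall>w\<in>carrier M.
        less_rel N (f x) (f y) (f z) (f w) \<longleftrightarrow> less_rel M x y z w) \<and>
     (\<forall>c\<in>C. f (const_val M c) = const_val N c)"

definition is_elementary ::
  "'c set \<Rightarrow> ('c, 'u) struct \<Rightarrow> ('c, 'v) struct \<Rightarrow> ('u \<Rightarrow> 'v) \<Rightarrow> bool" where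
  "is_elementary C M N f \<longleftrightarrow>
     f ` carrier M \<subseteq> carrier N \<and>
     (\<forall>\<phi>\<in>formulas C. \<forall>e. range e \<subseteq> carrier M \<longrightarrow> (sat N (f \<circ> e) \<phi> \<longleftrightarrow> sat M e \<phi>))"

definition is_isomorphism ::
  "'c set \<Rightarrow> ('c, 'u) struct \<Rightarrow> ('c, 'v) struct \<Rightarrow> ('u \<Rightarrow> 'v) \<Rightarrow> bool" where
  "is_isomorphism C M N f \<longleftrightarrow> is_embedding C M N f \<and> f ` carrier M = carrier N"

section \<open>Model-theoretic notions\<close>

text \<open>
  HOL cannot quantify over all types inside a formula, so "for all models" and "for some model"
  below range over the models whose carrier is a subset of a type \<open>'u\<close>, passed as an argument of
  type \<open>'u itself\<close>. The type \<open>'u\<close> is an arbitrary infinite universe. To make a theory independent of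
  the universe, characterise it over \<open>nat\<close> and then state its properties over \<open>'u\<close>.
\<close>

definition model_complete :: "'u itself \<Rightarrow> 'c set \<Rightarrow> 'c fm set \<Rightarrow> bool" where
  "model_complete U C T \<longleftrightarrow>
     (\<forall>(M :: ('c, 'u) struct) (N :: ('c, 'u) struct) f.
        is_model C T M \<and> is_model C T N \<and> is_embedding C M N f \<longrightarrow> is_elementary C M N f)"

definition model_companion :: "'u itself \<Rightarrow> 'c set \<Rightarrow> 'c fm set \<Rightarrow> 'c fm set \<Rightarrow> bool" where
  "model_companion U C T T' \<longleftrightarrow>
     T' \<subseteq> sentences C \<and>
     model_complete U C T' \<and>
     (\<forall>M :: ('c, 'u) struct. is_model C T M \<longrightarrow>
        (\<exists>(N :: ('c, 'u) struct) f. is_model C T' N \<and> is_embedding C M N f)) \<and>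
     (\<forall>M :: ('c, 'u) struct. is_model C T' M \<longrightarrow>
        (\<exists>(N :: ('c, 'u) struct) f. is_model C T N \<and> is_embedding C M N f))"

definition aleph0_categorical :: "'u itself \<Rightarrow> 'c set \<Rightarrow> 'c fm set \<Rightarrow> bool" where
  "aleph0_categorical U C T \<longleftrightarrow>
     (\<exists>M :: ('c, 'u) struct. is_model C T M \<and> countable (carrier M) \<and> infinite (carrier M)) \<and>
     (\<forall>(M :: ('c, 'u) struct) (N :: ('c, 'u) struct).
        is_model C T M \<and> countable (carrier M) \<and> infinite (carrier M) \<and>
        is_model C T N \<and> countable (carrier N) \<and> infinite (carrier N) \<longrightarrow>
        (\<exists>f. is_isomorphism C M N f))"

text \<open>A partitioned formula \<open>\<phi>(x; y)\<close>, with \<open>x\<close> and \<open>y\<close> disjoint finite tuples of variables.\<close>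

definition partitioned :: "'c set \<Rightarrow> 'c fm \<Rightarrow> nat list \<Rightarrow> nat list \<Rightarrow> bool" where
  "partitioned C \<phi> xs ys \<longleftrightarrow>
     \<phi> \<in> formulas C \<and> distinct (xs @ ys) \<and> fv \<phi> \<subseteq> set (xs @ ys)"

definition tuples :: "('c, 'u) struct \<Rightarrow> nat list \<Rightarrow> 'u list set" where
  "tuples N vs = {a. length a = length vs \<and> set a \<subseteq> carrier N}"

text \<open>The set \<open>\<phi>(N, b)\<close>. The value of \<open>the None\<close> at variables outside \<open>xs @ ys\<close> is irrelevant.\<close>

definition solutions ::
  "('c, 'u) struct \<Rightarrow> 'c fm \<Rightarrow> nat list \<Rightarrow> nat list \<Rightarrow> 'u list \<Rightarrow> 'u list set" where
  "solutions N \<phi> xs ys b =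
     {a \<in> tuples N xs. sat N (\<lambda>v. the (map_of (zip (xs @ ys) (a @ b)) v)) \<phi>}"

definition formula_SOP ::
  "'u itself \<Rightarrow> 'c set \<Rightarrow> 'c fm set \<Rightarrow> 'c fm \<Rightarrow> nat list \<Rightarrow> nat list \<Rightarrow> bool" where
  "formula_SOP U C T \<phi> xs ys \<longleftrightarrow>
     (\<exists>(N :: ('c, 'u) struct) b. is_model C T N \<and>
        (\<forall>i::nat. b i \<in> tuples N ys) \<and>
        (\<forall>i. solutions N \<phi> xs ys (b i) \<subset> solutions N \<phi> xs ys (b (Suc i))))"

definition theory_SOP :: "'u itself \<Rightarrow> 'c set \<Rightarrow> 'c fm set \<Rightarrow> bool" where
  "theory_SOP U C T \<longleftrightarrow> (\<exists>\<phi> xs ys. partitioned C \<phi> xs ys \<and> formula_SOP U C T \<phi> xs ys)"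

text \<open>
  \<open>name_elements M\<close> is the expansion of \<open>M\<close> in which every element names itself, and
  \<open>elementary_diagram M\<close> its complete theory, in the language with constant set \<open>carrier M\<close>.
\<close>

definition name_elements :: "('c, 'u) struct \<Rightarrow> ('u, 'u) struct" where
  "name_elements M = \<lparr>carrier = carrier M, less_rel = less_rel M, const_val = (\<lambda>a. a)\<rparr>"

definition elementary_diagram :: "('c, 'u) struct \<Rightarrow> 'u fm set" where
  "elementary_diagram M =
     {\<phi> \<in> sentences (carrier M). \<forall>e. range e \<subseteq> carrier M \<longrightarrow> sat (name_elements M) e \<phi>}"

section \<open>The theory of switchboards\<close>

text \<open>
  \<open>L\<^sup>-\<close> has no constant symbols; \<open>unit\<close> only fills the type parameter for constants.
\<close>

definition switchboard_theory :: "unit fm set" where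
  "switchboard_theory =
    {Alls [0,1,2,3]
       (Imp (Less (Var 0) (Var 1) (Var 2) (Var 3))
            (And (Neg (Eq (Var 0) (Var 1))) (Neg (Eq (Var 2) (Var 3))))),
     Alls [0,1,2,3]
       (Imp (Less (Var 0) (Var 1) (Var 2) (Var 3))
            (And (Less (Var 1) (Var 0) (Var 2) (Var 3)) (Less (Var 0) (Var 1) (Var 3) (Var 2)))),
     Alls [0,1] (Neg (Less (Var 0) (Var 1) (Var 0) (Var 1))),
     Alls [0,1,2,3,4,5]
       (Imp (And (Less (Var 0) (Var 1) (Var 2) (Var 3)) (Less (Var 2) (Var 3) (Var 4) (Var 5)))
            (Less (Var 0) (Var 1) (Var 4) (Var 5))),
     Alls [0,1,2]
       (Imp (And (Neg (Eq (Var 0) (Var 1))) (And (Neg (Eq (Var 0) (Var 2))) (Neg (Eq (Var 1) (Var 2)))))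
            (Neg (Less (Var 0) (Var 1) (Var 0) (Var 2))))}"

definition switchboard_struct :: "(unit, 'u) struct \<Rightarrow> bool" where
  "switchboard_struct M \<longleftrightarrow>
     (\<exists>lt. switchboard (carrier M) lt \<and>
        (\<forall>x\<in>carrier M. \<forall>y\<in>carrier M. \<forall>z\<in>carrier M. \<forall>w\<in>carrier M.
           less_rel M x y z w \<longleftrightarrow> x \<noteq> y \<and> z \<noteq> w \<and> lt {x, y} {z, w}))"

lemma doubleton_in_edges: "{x, y} \<in> edges M \<longleftrightarrow> x \<in> M \<and> y \<in> M \<and> x \<noteq> y"
  by (auto simp: edges_def card_2_iff doubleton_eq_iff)

lemma edgesE:
  assumes "e \<in> edges M"
  obtains x y where "e = {x, y}" "x \<in> M" "y \<in> M" "x \<noteq> y"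
  using assms by (auto simp: edges_def card_2_iff)

lemma sat_sb_axioms:
  fixes M :: "(unit, 'u) struct"
  shows
  "sat M e (Alls [0,1,2,3]
       (Imp (Less (Var 0) (Var 1) (Var 2) (Var 3))
            (And (Neg (Eq (Var 0) (Var 1))) (Neg (Eq (Var 2) (Var 3)))))) \<longleftrightarrow>
   (\<forall>x\<in>carrier M. \<forall>y\<in>carrier M. \<forall>z\<in>carrier M. \<forall>w\<in>carrier M.
      less_rel M x y z w \<longrightarrow> x \<noteq> y \<and> z \<noteq> w)"
  "sat M e (Alls [0,1,2,3]
       (Imp (Less (Var 0) (Var 1) (Var 2) (Var 3))
            (And (Less (Var 1) (Var 0) (Var 2) (Var 3)) (Less (Var 0) (Var 1) (Var 3) (Var 2))))) \<longleftrightarrow>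
   (\<forall>x\<in>carrier M. \<forall>y\<in>carrier M. \<forall>z\<in>carrier M. \<forall>w\<in>carrier M.
      less_rel M x y z w \<longrightarrow> less_rel M y x z w \<and> less_rel M x y w z)"
  "sat M e (Alls [0,1] (Neg (Less (Var 0) (Var 1) (Var 0) (Var 1)))) \<longleftrightarrow>
   (\<forall>x\<in>carrier M. \<forall>y\<in>carrier M. \<not> less_rel M x y x y)"
  "sat M e (Alls [0,1,2,3,4,5]
       (Imp (And (Less (Var 0) (Var 1) (Var 2) (Var 3)) (Less (Var 2) (Var 3) (Var 4) (Var 5)))
            (Less (Var 0) (Var 1) (Var 4) (Var 5)))) \<longleftrightarrow>
   (\<forall>x\<in>carrier M. \<forall>y\<in>carrier M. \<forall>z\<in>carrier M. \<forall>w\<in>carrier M. \<forall>u\<in>carrier M. \<forall>v\<in>carrier M.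
      less_rel M x y z w \<and> less_rel M z w u v \<longrightarrow> less_rel M x y u v)"
  "sat M e (Alls [0,1,2]
       (Imp (And (Neg (Eq (Var 0) (Var 1))) (And (Neg (Eq (Var 0) (Var 2))) (Neg (Eq (Var 1) (Var 2)))))
            (Neg (Less (Var 0) (Var 1) (Var 0) (Var 2))))) \<longleftrightarrow>
   (\<forall>x\<in>carrier M. \<forall>y\<in>carrier M. \<forall>z\<in>carrier M.
      x \<noteq> y \<and> x \<noteq> z \<and> y \<noteq> z \<longrightarrow> \<not> less_rel M x y x z)"
  by (simp_all, blast+)

lemma is_model_sb_iff:
  "is_model {} switchboard_theory M \<longleftrightarrow> carrier M \<noteq> {} \<and>
    (\<forall>x\<in>carrier M. \<forall>y\<in>carrier M. \<forall>z\<in>carrier M. \<forall>w\<in>carrier M.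
       less_rel M x y z w \<longrightarrow> x \<noteq> y \<and> z \<noteq> w) \<and>
    (\<forall>x\<in>carrier M. \<forall>y\<in>carrier M. \<forall>z\<in>carrier M. \<forall>w\<in>carrier M.
       less_rel M x y z w \<longrightarrow> less_rel M y x z w \<and> less_rel M x y w z) \<and>
    (\<forall>x\<in>carrier M. \<forall>y\<in>carrier M. \<not> less_rel M x y x y) \<and>
    (\<forall>x\<in>carrier M. \<forall>y\<in>carrier M. \<forall>z\<in>carrier M. \<forall>w\<in>carrier M. \<forall>u\<in>carrier M. \<forall>v\<in>carrier M.
       less_rel M x y z w \<and> less_rel M z w u v \<longrightarrow> less_rel M x y u v) \<and>
    (\<forall>x\<in>carrier M. \<forall>y\<in>carrier M. \<forall>z\<in>carrier M.
       x \<noteq> y \<and> x \<noteq> z \<and> y \<noteq> z \<longrightarrow> \<not> less_rel M x y x z)"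
proof (cases "carrier M = {}")
  case True
  then show ?thesis by (simp add: is_model_def is_struct_def)
next
  case False
  then obtain a where "a \<in> carrier M" by blast
  then have "\<exists>e::nat \<Rightarrow> 'a. range e \<subseteq> carrier M"
    by (intro exI[of _ "\<lambda>_. a"]) auto
  then have *: "(\<forall>e::nat \<Rightarrow> 'a. range e \<subseteq> carrier M \<longrightarrow> P) \<longleftrightarrow> P" for P
    by blast
  show ?thesis
    unfolding is_model_def is_struct_def switchboard_theory_def ball_simps
    by (simp only: sat_sb_axioms *) (simp add: False)
qed

lemma models_of_switchboard_theory:
  "is_model {} switchboard_theory M \<longleftrightarrow> carrier M \<noteq> {} \<and> switchboard_struct M"
proof
  assume L: "is_model {} switchboard_theory M"
  let ?C = "carrier M" and ?R = "less_rel M"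
  have ne: "?C \<noteq> {}"
    using L unfolding is_model_sb_iff by (elim conjE)
  have neq: "\<forall>x\<in>?C. \<forall>y\<in>?C. \<forall>z\<in>?C. \<forall>w\<in>?C. ?R x y z w \<longrightarrow> x \<noteq> y \<and> z \<noteq> w"
    using L unfolding is_model_sb_iff by (elim conjE)
  have sym: "\<forall>x\<in>?C. \<forall>y\<in>?C. \<forall>z\<in>?C. \<forall>w\<in>?C. ?R x y z w \<longrightarrow> ?R y x z w \<and> ?R x y w z"
    using L unfolding is_model_sb_iff by (elim conjE)
  have irr: "\<forall>x\<in>?C. \<forall>y\<in>?C. \<not> ?R x y x y"
    using L unfolding is_model_sb_iff by (elim conjE)
  have tr: "\<forall>x\<in>?C. \<forall>y\<in>?C. \<forall>z\<in>?C. \<forall>w\<in>?C. \<forall>u\<in>?C. \<forall>v\<in>?C.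
      ?R x y z w \<and> ?R z w u v \<longrightarrow> ?R x y u v"
    using L unfolding is_model_sb_iff by (elim conjE)
  have sb: "\<forall>x\<in>?C. \<forall>y\<in>?C. \<forall>z\<in>?C. x \<noteq> y \<and> x \<noteq> z \<and> y \<noteq> z \<longrightarrow> \<not> ?R x y x z"
    using L unfolding is_model_sb_iff by (elim conjE)
  define lt where "lt e f \<longleftrightarrow>
      (\<exists>x\<in>?C. \<exists>y\<in>?C. \<exists>z\<in>?C. \<exists>w\<in>?C. e = {x, y} \<and> f = {z, w} \<and> ?R x y z w)" for e f
  have lt: "lt {x, y} {z, w} \<longleftrightarrow> ?R x y z w"
    if "x \<in> ?C" "y \<in> ?C" "z \<in> ?C" "w \<in> ?C" for x y z w
  proof
    assume "lt {x, y} {z, w}"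
    then obtain x' y' z' w' where *: "x' \<in> ?C" "y' \<in> ?C" "z' \<in> ?C" "w' \<in> ?C"
      "{x, y} = {x', y'}" "{z, w} = {z', w'}" "?R x' y' z' w'"
      unfolding lt_def by blast
    have 1: "?R y' x' z' w'" and "?R x' y' w' z'"
      using sym[rule_format, OF *(1-4) *(7)] by simp_all
    moreover have "?R y' x' w' z'"
      using sym[rule_format, OF *(2,1,3,4) 1] by simp
    moreover note *
    ultimately show "?R x y z w"
      unfolding doubleton_eq_iff by (elim disjE conjE) simp_all
  next
    assume "?R x y z w"
    then show "lt {x, y} {z, w}"
      using that unfolding lt_def by blast
  qed
  have "switchboard ?C lt"
    unfolding switchboard_def
  proof (intro conjI ballI impI)
    show "irreflp_on (edges ?C) lt"
    proof (rule irreflp_onI)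
      fix e assume "e \<in> edges ?C"
      then obtain x y where "e = {x, y}" "x \<in> ?C" "y \<in> ?C"
        by (elim edgesE)
      then show "\<not> lt e e"
        using irr by (simp add: lt)
    qed
    show "transp_on (edges ?C) lt"
    proof (rule transp_onI)
      fix e f g
      assume E: "e \<in> edges ?C" "f \<in> edges ?C" "g \<in> edges ?C" and l: "lt e f" "lt f g"
      obtain x y where 1: "e = {x, y}" "x \<in> ?C" "y \<in> ?C"
        using E(1) by (rule edgesE)
      obtain z w where 2: "f = {z, w}" "z \<in> ?C" "w \<in> ?C"
        using E(2) by (rule edgesE)
      obtain u v where 3: "g = {u, v}" "u \<in> ?C" "v \<in> ?C"
        using E(3) by (rule edgesE)
      note e = 1(1) 2(1) 3(1) and m = 1(2,3) 2(2,3) 3(2,3)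
      have "?R x y z w" "?R z w u v"
        using l m by (simp_all add: e lt)
      then have "?R x y u v"
        using tr[rule_format, OF m] by simp
      then show "lt e g"
        using m by (simp add: e lt)
    qed
    fix x y z
    assume "x \<in> ?C" "y \<in> ?C" "z \<in> ?C" "x \<noteq> y \<and> x \<noteq> z \<and> y \<noteq> z"
    then show "\<not> lt {x, y} {x, z}" "\<not> lt {x, z} {x, y}"
      using sb by (auto simp: lt)
  qed
  moreover have "?R x y z w \<longleftrightarrow> x \<noteq> y \<and> z \<noteq> w \<and> lt {x, y} {z, w}"
    if "x \<in> ?C" "y \<in> ?C" "z \<in> ?C" "w \<in> ?C" for x y z w
    unfolding lt[OF that] using neq[rule_format, OF that] by blast
  ultimately show "?C \<noteq> {} \<and> switchboard_struct M"
    using ne unfolding switchboard_struct_def by blast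
next
  let ?C = "carrier M" and ?R = "less_rel M"
  assume R: "?C \<noteq> {} \<and> switchboard_struct M"
  then obtain lt where lt: "switchboard ?C lt" and
    lessC: "\<forall>x\<in>?C. \<forall>y\<in>?C. \<forall>z\<in>?C. \<forall>w\<in>?C.
      ?R x y z w \<longleftrightarrow> x \<noteq> y \<and> z \<noteq> w \<and> lt {x, y} {z, w}"
    unfolding switchboard_struct_def by (elim conjE exE)
  have less: "?R x y z w \<longleftrightarrow> x \<noteq> y \<and> z \<noteq> w \<and> lt {x, y} {z, w}"
    if "x \<in> ?C" "y \<in> ?C" "z \<in> ?C" "w \<in> ?C" for x y z w
    using lessC that by simp
  have irr: "irreflp_on (edges ?C) lt" and tr: "transp_on (edges ?C) lt" and
    sb: "\<And>x y z. x \<in> ?C \<Longrightarrow> y \<in> ?C \<Longrightarrow> z \<in> ?C \<Longrightarrow> x \<noteq> y \<Longrightarrow> x \<noteq> z \<Longrightarrow> y \<noteq> z \<Longrightarrow>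
      \<not> lt {x, y} {x, z}"
    using lt unfolding switchboard_def by simp_all
  show "is_model {} switchboard_theory M"
    unfolding is_model_sb_iff
  proof (intro conjI ballI impI)
    show "?C \<noteq> {}" using R by blast
  next
    fix x y z w
    assume m: "x \<in> ?C" "y \<in> ?C" "z \<in> ?C" "w \<in> ?C" and "?R x y z w"
    then have *: "x \<noteq> y" "z \<noteq> w" "lt {x, y} {z, w}"
      by (simp_all add: less)
    show "x \<noteq> y" "z \<noteq> w" by fact+
  next
    fix x y z w
    assume m: "x \<in> ?C" "y \<in> ?C" "z \<in> ?C" "w \<in> ?C" and "?R x y z w"
    then have *: "x \<noteq> y" "z \<noteq> w" "lt {x, y} {z, w}"
      by (simp_all add: less)
    show "?R y x z w" "?R x y w z"
      using * m by (simp_all add: less insert_commute)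
  next
    fix x y assume m: "x \<in> ?C" "y \<in> ?C"
    then show "\<not> ?R x y x y"
      using irreflp_onD[OF irr, of "{x, y}"] by (auto simp: less doubleton_in_edges)
  next
    fix x y z w u v
    assume m: "x \<in> ?C" "y \<in> ?C" "z \<in> ?C" "w \<in> ?C" "u \<in> ?C" "v \<in> ?C"
      and "?R x y z w \<and> ?R z w u v"
    then have "x \<noteq> y" "z \<noteq> w" "u \<noteq> v" "lt {x, y} {z, w}" "lt {z, w} {u, v}"
      by (simp_all add: less)
    then show "?R x y u v"
      using transp_onD[OF tr, of "{x, y}" "{z, w}" "{u, v}"] m
      by (simp add: less doubleton_in_edges)
  next
    fix x y z
    assume "x \<in> ?C" "y \<in> ?C" "z \<in> ?C" "x \<noteq> y \<and> x \<noteq> z \<and> y \<noteq> z"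
    then show "\<not> ?R x y x z"
      using sb by (simp add: less)
  qed
qed

lemma switchboard_theory_sentences: "switchboard_theory \<subseteq> sentences {}"
  by (auto simp: switchboard_theory_def sentences_def formulas_def)

end

theory Submission
  imports Defs "HOL-Library.Ramsey"
begin

text \<open>
  Switchboards fail to amalgamate because an edge \<open>e\<close> can lie below one edge through a vertex
  \<open>x\<close> and above another one, in different extensions. Deciding in advance on which side of \<open>e\<close> the
  edges through \<open>x\<close> may lie (the colour of \<open>x\<close> at \<open>e\<close>) repairs this: coloured switchboards amalgamate
  freely. The rich (homogeneous universal) ones are the models of the model companion, and in them
  both colours are existentially definable; back-and-forth gives model completeness and
  categoricity, and an increasing sequence of edges gives the SOP.

  A definable strict order on singletons over a finite set \<open>A\<close> would, by Ramsey's theorem, hold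
  between two points of the same type over \<open>A\<close>. Free composition of copies of that pair leads to a pair
  whose type over \<open>A\<close> is symmetric, contradicting asymmetry.
\<close>

section \<open>Coloured switchboards\<close>

text \<open>Single parameters are harmless because, in a free composition, asymmetry between the two
  ends is passed on only along comparisons of edges that join the path to the finite set
  \<open>A\<close>. These comparisons amount to two relations on \<open>A\<close>, irreflexive by
  the Switchboard Axiom and transitive by homogeneity, so their chains are bounded by
  \<open>card A\<close> and a long composition exhausts them. An edge as parameter escapes this
  bound, and the order on edges is itself the formula with the SOP. Symmetry is contradictory
  because a strict order is transitive: it passes to the composed pair, where equality of types
  turns it around. The universe of the models is fixed in advance, with two consequences. New points
  have to be coded inside the given type. And a companion given over \<open>nat\<close> is
  understood elsewhere only through its sentences: Loewenheim-Skolem brings these down to countable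
  structures, so the models of any companion are the rich structures in every universe.\<close>

lemma edges_mono: "X \<subseteq> Y \<Longrightarrow> edges X \<subseteq> edges Y"
  by (auto simp: edges_def)

lemma edges_subset: "e \<in> edges X \<Longrightarrow> e \<subseteq> X"
  by (simp add: edges_def)

lemma edges_Int: "edges (X \<inter> Y) = edges X \<inter> edges Y"
  by (auto simp: edges_def)

lemma finite_edges: "finite X \<Longrightarrow> finite (edges X)"
  by (rule finite_subset[of _ "Pow X"]) (auto simp: edges_def)

lemma finite_edge: "e \<in> edges X \<Longrightarrow> finite e"
  by (rule card_ge_0_finite) (simp add: edges_def)

lemma edges_image:
  assumes "inj_on h X" "e \<in> edges X"
  shows "h ` e \<in> edges (h ` X)"
  using assms by (auto simp: edges_def card_image inj_on_subset)

lemma edges_of_image: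
  assumes "inj_on h X"
  shows "edges (h ` X) = (`) h ` edges X"
proof
  show "edges (h ` X) \<subseteq> (`) h ` edges X"
  proof
    fix e assume e: "e \<in> edges (h ` X)"
    then obtain d where d: "d \<subseteq> X" "e = h ` d"
      using edges_subset[OF e] by (auto simp: subset_image_iff)
    then have "card d = 2"
      using e card_image[OF inj_on_subset[OF assms d(1)]] by (simp add: edges_def)
    with d show "e \<in> (`) h ` edges X"
      by (auto simp: edges_def)
  qed
  show "(`) h ` edges X \<subseteq> edges (h ` X)"
    using edges_image[OF assms] by (intro image_subsetI)
qed

record 'a csb =
  pts :: "'a set"
  lt :: "'a set \<Rightarrow> 'a set \<Rightarrow> bool"
  col :: "'a \<Rightarrow> 'a set \<Rightarrow> bool"

text \<open>With both relations false off the points, a structure is determined by its restriction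
  to its points. The antisymmetry behind Zorn's lemma and the counting of finite structures rest on
  this.\<close>

definition csb_typed :: "'a csb \<Rightarrow> bool" where
  "csb_typed S \<longleftrightarrow>
     (\<forall>e f. lt S e f \<longrightarrow> e \<in> edges (pts S) \<and> f \<in> edges (pts S)) \<and>
     (\<forall>x e. col S x e \<longrightarrow> x \<in> pts S \<and> e \<in> edges (pts S))"

text \<open>
  The colour of \<open>x\<close> at an edge \<open>e\<close> not through \<open>x\<close> says on which side of \<open>e\<close> edges through \<open>x\<close>
  may lie: above \<open>e\<close> is excluded if \<open>col S x e\<close>, and below \<open>e\<close> is excluded otherwise. The last
  clause entails irreflexivity and the Switchboard Axiom.
\<close>

definition is_csb :: "'a csb \<Rightarrow> bool" where
  "is_csb S \<longleftrightarrow> csb_typed S \<and>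
     (\<forall>e f g. lt S e f \<longrightarrow> lt S f g \<longrightarrow> lt S e g) \<and>
     (\<forall>x e. col S x e \<longrightarrow> x \<notin> e) \<and>
     (\<forall>x e f. lt S e f \<longrightarrow> x \<in> e \<or> col S x e \<longrightarrow> col S x f)"

lemma is_csbD:
  assumes "is_csb S"
  shows "lt S e f \<Longrightarrow> e \<in> edges (pts S)" "lt S e f \<Longrightarrow> f \<in> edges (pts S)"
    "col S x e \<Longrightarrow> x \<in> pts S" "col S x e \<Longrightarrow> e \<in> edges (pts S)"
    "lt S e f \<Longrightarrow> lt S f g \<Longrightarrow> lt S e g"
    "col S x e \<Longrightarrow> x \<notin> e"
    "lt S e f \<Longrightarrow> x \<in> e \<Longrightarrow> col S x f"
    "lt S e f \<Longrightarrow> col S x e \<Longrightarrow> col S x f"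
    "lt S e f \<Longrightarrow> x \<in> e \<Longrightarrow> x \<notin> f"
  using assms unfolding is_csb_def csb_typed_def by blast+

lemma trivial_csb: "is_csb \<lparr>pts = X, lt = \<lambda>_ _. False, col = \<lambda>_ _. False\<rparr>"
  by (simp add: is_csb_def csb_typed_def)

text \<open>The explicit domain lets one notion serve for the finite maps of back-and-forth and for
  full embeddings. Values of \<open>h\<close> off \<open>X\<close> are free, so a map is extended by
  a function update.\<close>

definition emb_on :: "'a set \<Rightarrow> 'a csb \<Rightarrow> 'b csb \<Rightarrow> ('a \<Rightarrow> 'b) \<Rightarrow> bool" where
  "emb_on X S S' h \<longleftrightarrow> inj_on h X \<and> h ` X \<subseteq> pts S' \<and>
     (\<forall>e\<in>edges X. \<forall>f\<in>edges X. lt S' (h ` e) (h ` f) \<longleftrightarrow> lt S e f) \<and>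
     (\<forall>x\<in>X. \<forall>e\<in>edges X. col S' (h x) (h ` e) \<longleftrightarrow> col S x e)"

lemma emb_onD:
  assumes "emb_on X S S' h"
  shows "inj_on h X" "x \<in> X \<Longrightarrow> h x \<in> pts S'"
    "e \<in> edges X \<Longrightarrow> f \<in> edges X \<Longrightarrow> lt S' (h ` e) (h ` f) \<longleftrightarrow> lt S e f"
    "x \<in> X \<Longrightarrow> e \<in> edges X \<Longrightarrow> col S' (h x) (h ` e) \<longleftrightarrow> col S x e"
  using assms unfolding emb_on_def by auto

lemma emb_on_subset: "emb_on X S S' h \<Longrightarrow> Y \<subseteq> X \<Longrightarrow> emb_on Y S S' h"
  using edges_mono[of Y X] unfolding emb_on_def
  by (meson image_mono inj_on_subset subsetD subset_trans)

lemma emb_on_cong: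
  assumes "\<And>x. x \<in> X \<Longrightarrow> h x = k x"
  shows "emb_on X S S' h \<longleftrightarrow> emb_on X S S' k"
proof -
  have "h ` e = k ` e" if "e \<in> edges X" for e
    using that assms edges_subset by (intro image_cong) auto
  then show ?thesis
    using assms unfolding emb_on_def by (simp cong: inj_on_cong image_cong)
qed

lemma emb_on_empty: "emb_on {} S S' h"
  by (simp add: emb_on_def edges_def)

lemma emb_on_id: "X \<subseteq> pts S \<Longrightarrow> emb_on X S S id"
  by (auto simp: emb_on_def)

lemma emb_on_comp:
  assumes h: "emb_on X S S' h" and k: "emb_on (h ` X) S' S'' k"
  shows "emb_on X S S'' (k \<circ> h)"
proof -
  have e: "h ` e \<in> edges (h ` X)" if "e \<in> edges X" for e
    using edges_image[OF emb_onD(1)[OF h] that] .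
  have kh: "(k \<circ> h) ` e = k ` h ` e" for e
    by (simp add: image_comp)
  show ?thesis
    unfolding emb_on_def kh
  proof (intro conjI ballI)
    show "inj_on (k \<circ> h) X"
      using emb_onD(1)[OF h] emb_onD(1)[OF k] by (rule comp_inj_on)
    show "k ` h ` X \<subseteq> pts S''"
      using k by (simp add: emb_on_def)
  qed (simp_all add: emb_onD(3,4)[OF h] emb_onD(3,4)[OF k] e)
qed

lemma emb_on_comp':
  assumes "emb_on X S S' h" "emb_on Y S' S'' k" "h ` X \<subseteq> Y"
  shows "emb_on X S S'' (k \<circ> h)"
  using emb_on_comp emb_on_subset assms by blast

lemma emb_on_inv:
  assumes h: "emb_on X S S' h" and X: "X \<subseteq> pts S"
  shows "emb_on (h ` X) S' S (inv_into X h)"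
proof -
  note inj = emb_onD(1)[OF h]
  have inv: "inv_into X h ` h ` e = e" if "e \<in> edges X" for e
    using edges_subset[OF that] inj by (simp add: inv_into_image_cancel)
  show ?thesis
    unfolding emb_on_def
  proof (intro conjI ballI)
    show "inj_on (inv_into X h) (h ` X)"
      by (simp add: inj_on_inv_into)
    show "inv_into X h ` h ` X \<subseteq> pts S"
      using X inj by simp
  next
    fix e f assume "e \<in> edges (h ` X)" "f \<in> edges (h ` X)"
    then obtain e' f' where "e = h ` e'" "f = h ` f'" "e' \<in> edges X" "f' \<in> edges X"
      unfolding edges_of_image[OF inj] by blast
    then show "lt S (inv_into X h ` e) (inv_into X h ` f) \<longleftrightarrow> lt S' e f"
      using emb_onD(3)[OF h] inv by simp
  next
    fix x e assume "x \<in> h ` X" "e \<in> edges (h ` X)"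
    then obtain x' e' where "e = h ` e'" "x = h x'" "e' \<in> edges X" "x' \<in> X"
      unfolding edges_of_image[OF inj] by blast
    then show "col S (inv_into X h x) (inv_into X h ` e) \<longleftrightarrow> col S' x e"
      using emb_onD(4)[OF h] inv inj by simp
  qed
qed

section \<open>Transport of structure and free amalgamation\<close>

text \<open>Amalgams are unions inside one type, so the intended overlap of the two parts has to be
  arranged first by renaming points.\<close>

definition pull :: "'a set \<Rightarrow> ('a \<Rightarrow> 'b) \<Rightarrow> 'b csb \<Rightarrow> 'a csb" where
  "pull Y g S = \<lparr>pts = Y,
     lt = \<lambda>e f. e \<in> edges Y \<and> f \<in> edges Y \<and> lt S (g ` e) (g ` f),
     col = \<lambda>x e. x \<in> Y \<and> e \<in> edges Y \<and> col S (g x) (g ` e)\<rparr>"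

lemma pts_pull [simp]: "pts (pull Y g S) = Y"
  by (simp add: pull_def)

lemma emb_on_pull:
  "inj_on g Y \<Longrightarrow> g ` Y \<subseteq> pts S \<Longrightarrow> emb_on Y (pull Y g S) S g"
  by (simp add: emb_on_def pull_def)

lemma csb_typed_pull: "csb_typed (pull Y g S)"
  by (simp add: csb_typed_def pull_def)

lemma is_csb_pull:
  assumes S: "is_csb S" and inj: "inj_on g Y" and "g ` Y \<subseteq> pts S"
  shows "is_csb (pull Y g S)"
  unfolding is_csb_def
proof (intro conjI allI impI)
  show "csb_typed (pull Y g S)"
    by (rule csb_typed_pull)
next
  fix e f h assume "lt (pull Y g S) e f" "lt (pull Y g S) f h"
  then show "lt (pull Y g S) e h"
    using is_csbD(5)[OF S] by (auto simp: pull_def)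
next
  fix x e assume "col (pull Y g S) x e"
  then show "x \<notin> e"
    using is_csbD(6)[OF S] by (auto simp: pull_def)
next
  fix x e f assume a: "lt (pull Y g S) e f" "x \<in> e \<or> col (pull Y g S) x e"
  then have "x \<in> Y"
    by (auto simp: pull_def dest: edges_subset)
  with a show "col (pull Y g S) x f"
    using is_csbD(7,8)[OF S, of "g ` e" "g ` f" "g x"] by (auto simp: pull_def)
qed

text \<open>Composites through one middle edge already form a transitive relation: \<open>g\<close>
  is an edge of both parts, so in an alternating chain of three comparisons the inner one joins
  common edges and can be read in either part. Colours are closed upwards in the same way.\<close>

definition amalg :: "'a csb \<Rightarrow> 'a csb \<Rightarrow> 'a csb" where
  "amalg A B = \<lparr>pts = pts A \<union> pts B,
     lt = \<lambda>e f. lt A e f \<or> lt B e f \<or> (\<exists>g. lt A e g \<and> lt B g f) \<or> (\<exists>g. lt B e g \<and> lt A g f),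
     col = \<lambda>x e. col A x e \<or> col B x e \<or> (\<exists>g. col A x g \<and> lt B g e) \<or> (\<exists>g. col B x g \<and> lt A g e)\<rparr>"

text \<open>Colours settle the case in which plain switchboards fail. If \<open>e\<close> is below
  \<open>g\<close> in \<open>A\<close>, \<open>g\<close> is below \<open>f\<close> in
  \<open>B\<close>, and \<open>x\<close> lies on both \<open>e\<close> and \<open>f\<close>, then
  \<open>x\<close> is a common point. It is coloured at \<open>g\<close> in \<open>A\<close>, hence
  in \<open>B\<close>, hence at \<open>f\<close> in \<open>B\<close>, although it lies on
  \<open>f\<close>.\<close>

lemma amalgamation:
  assumes A: "is_csb A" and B: "is_csb B" and agree: "emb_on (pts A \<inter> pts B) A B id"
  shows "is_csb (amalg A B)" "emb_on (pts A) A (amalg A B) id" "emb_on (pts B) B (amalg A B) id"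
proof -
  have ltAB: "lt A e f \<longleftrightarrow> lt B e f"
    if "e \<in> edges (pts A)" "f \<in> edges (pts A)" "e \<in> edges (pts B)" "f \<in> edges (pts B)" for e f
    using emb_onD(3)[OF agree, of e f] that by (simp add: edges_Int)
  have colAB: "col A x e \<longleftrightarrow> col B x e"
    if "x \<in> pts A" "e \<in> edges (pts A)" "x \<in> pts B" "e \<in> edges (pts B)" for x e
    using emb_onD(4)[OF agree, of x e] that by (simp add: edges_Int)
  note a = is_csbD[OF A] and b = is_csbD[OF B]
  have ltA: "lt A e f" if "lt B e f" "e \<in> edges (pts A)" "f \<in> edges (pts A)" for e f
    using that ltAB b(1,2) by blast
  have ltB: "lt B e f" if "lt A e f" "e \<in> edges (pts B)" "f \<in> edges (pts B)" for e f
    using that ltAB a(1,2) by blast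
  have colA: "col A x e" if "col B x e" "x \<in> pts A" "e \<in> edges (pts A)" for x e
    using that colAB b(3,4) by blast
  have colB: "col B x e" if "col A x e" "x \<in> pts B" "e \<in> edges (pts B)" for x e
    using that colAB a(3,4) by blast
  have lt_cases: "lt A e f \<or> lt B e f \<or> (\<exists>g. lt A e g \<and> lt B g f) \<or> (\<exists>g. lt B e g \<and> lt A g f)"
    if "lt (amalg A B) e f" for e f
    using that by (simp add: amalg_def)
  have col_cases: "col A x e \<or> col B x e \<or> (\<exists>g. col A x g \<and> lt B g e) \<or> (\<exists>g. col B x g \<and> lt A g e)"
    if "col (amalg A B) x e" for x e
    using that by (simp add: amalg_def)
  have ltI: "lt A e f \<Longrightarrow> lt (amalg A B) e f" "lt B e f \<Longrightarrow> lt (amalg A B) e f"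
    "lt A e g \<Longrightarrow> lt B g f \<Longrightarrow> lt (amalg A B) e f" "lt B e g \<Longrightarrow> lt A g f \<Longrightarrow> lt (amalg A B) e f"
    for e f g
    by (auto simp: amalg_def)
  have colI: "col A x e \<Longrightarrow> col (amalg A B) x e" "col B x e \<Longrightarrow> col (amalg A B) x e"
    "col A x g \<Longrightarrow> lt B g e \<Longrightarrow> col (amalg A B) x e" "col B x g \<Longrightarrow> lt A g e \<Longrightarrow> col (amalg A B) x e"
    for x e g
    by (auto simp: amalg_def)
  have "lt (amalg A B) e f \<longleftrightarrow> lt A e f" if "e \<in> edges (pts A)" "f \<in> edges (pts A)" for e f
    using lt_cases[of e f] that ltA a(1,2,5) ltI(1) by blast
  moreover have "lt (amalg A B) e f \<longleftrightarrow> lt B e f" if "e \<in> edges (pts B)" "f \<in> edges (pts B)" for e f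
    using lt_cases[of e f] that ltB b(1,2,5) ltI(2) by blast
  moreover have "col (amalg A B) x e \<longleftrightarrow> col A x e" if "x \<in> pts A" "e \<in> edges (pts A)" for x e
    using col_cases[of x e] that ltA colA a(1,2,4,8) colI(1) by blast
  moreover have "col (amalg A B) x e \<longleftrightarrow> col B x e" if "x \<in> pts B" "e \<in> edges (pts B)" for x e
    using col_cases[of x e] that ltB colB b(1,2,4,8) colI(2) by blast
  moreover have "pts A \<subseteq> pts (amalg A B)" "pts B \<subseteq> pts (amalg A B)"
    by (auto simp: amalg_def)
  ultimately show "emb_on (pts A) A (amalg A B) id" "emb_on (pts B) B (amalg A B) id"
    by (simp_all add: emb_on_def)
  have trans1: "lt (amalg A B) e f" if eg: "lt (amalg A B) e g" and gf: "lt A g f \<or> lt B g f" for e f g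
    using gf
  proof
    assume gf: "lt A g f"
    show ?thesis
      using lt_cases[OF eg]
    proof (elim disjE exE conjE)
      show ?thesis if "lt A e g" using ltI(1)[OF a(5)[OF that gf]] .
      show ?thesis if "lt B e g" using ltI(4)[OF that gf] .
      show ?thesis if "lt A e h" "lt B h g" for h
        using ltI(1)[OF a(5)[OF that(1) a(5)[OF ltA[OF that(2) a(2)[OF that(1)] a(1)[OF gf]] gf]]] .
      show ?thesis if "lt B e h" "lt A h g" for h
        using ltI(4)[OF that(1) a(5)[OF that(2) gf]] .
    qed
  next
    assume gf: "lt B g f"
    show ?thesis
      using lt_cases[OF eg]
    proof (elim disjE exE conjE)
      show ?thesis if "lt A e g" using ltI(3)[OF that gf] .
      show ?thesis if "lt B e g" using ltI(2)[OF b(5)[OF that gf]] .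
      show ?thesis if "lt A e h" "lt B h g" for h
        using ltI(3)[OF that(1) b(5)[OF that(2) gf]] .
      show ?thesis if "lt B e h" "lt A h g" for h
        using ltI(2)[OF b(5)[OF that(1) b(5)[OF ltB[OF that(2) b(2)[OF that(1)] b(1)[OF gf]] gf]]] .
    qed
  qed
  have col1: "col (amalg A B) x f"
    if xe: "x \<in> e \<or> col (amalg A B) x e" and ef: "lt A e f \<or> lt B e f" for x e f
    using xe
  proof
    assume "x \<in> e"
    then show ?thesis
      using ef a(7) b(7) colI(1,2) by blast
  next
    assume xe: "col (amalg A B) x e"
    from ef show ?thesis
    proof
      assume ef: "lt A e f"
      show ?thesis
        using col_cases[OF xe]
      proof (elim disjE exE conjE)
        show ?thesis if "col A x e" using colI(1)[OF a(8)[OF ef that]] .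
        show ?thesis if "col B x e" using colI(4)[OF that ef] .
        show ?thesis if "col A x g" "lt B g e" for g
          using colI(1)[OF a(8)[OF ef a(8)[OF ltA[OF that(2) a(4)[OF that(1)] a(1)[OF ef]] that(1)]]] .
        show ?thesis if "col B x g" "lt A g e" for g
          using colI(4)[OF that(1) a(5)[OF that(2) ef]] .
      qed
    next
      assume ef: "lt B e f"
      show ?thesis
        using col_cases[OF xe]
      proof (elim disjE exE conjE)
        show ?thesis if "col A x e" using colI(3)[OF that ef] .
        show ?thesis if "col B x e" using colI(2)[OF b(8)[OF ef that]] .
        show ?thesis if "col A x g" "lt B g e" for g
          using colI(3)[OF that(1) b(5)[OF that(2) ef]] .
        show ?thesis if "col B x g" "lt A g e" for g
          using colI(2)[OF b(8)[OF ef b(8)[OF ltB[OF that(2) b(4)[OF that(1)] b(1)[OF ef]] that(1)]]] .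
      qed
    qed
  qed
  \<comment> \<open>If \<open>x\<close> were on \<open>e\<close>, it would be a point of the part in
    which \<open>g\<close> is below \<open>e\<close>. Agreement then moves its colour at
    \<open>g\<close> into that part, where it would propagate to an edge through
    \<open>x\<close>.\<close>
  have colx: "x \<notin> e" if "col (amalg A B) x e" for x e
  proof -
    have 1: "x \<notin> e" if "col A x g" "lt B g e" for g
    proof
      assume "x \<in> e"
      then have "x \<in> pts B" using b(2)[OF that(2)] edges_subset by blast
      then have "col B x g" using colAB a(3,4)[OF that(1)] b(1)[OF that(2)] that(1) by blast
      then show False using b(6,8) that(2) \<open>x \<in> e\<close> by blast
    qed
    have 2: "x \<notin> e" if "col B x g" "lt A g e" for g
    proof
      assume "x \<in> e"
      then have "x \<in> pts A" using a(2)[OF that(2)] edges_subset by blast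
      then have "col A x g" using colAB b(3,4)[OF that(1)] a(1)[OF that(2)] that(1) by blast
      then show False using a(6,8) that(2) \<open>x \<in> e\<close> by blast
    qed
    show ?thesis
      using that 1 2 a(6) b(6) by (auto simp: amalg_def)
  qed
  show "is_csb (amalg A B)"
    unfolding is_csb_def
  proof (intro conjI allI impI)
    show "csb_typed (amalg A B)"
      using a(1-4) b(1-4) edges_mono[of "pts A" "pts A \<union> pts B"] edges_mono[of "pts B" "pts A \<union> pts B"]
      unfolding csb_typed_def amalg_def by simp blast
    show "lt (amalg A B) e g" if "lt (amalg A B) e f" "lt (amalg A B) f g" for e f g
      using lt_cases[OF that(2)] trans1 that(1) by blast
    show "col (amalg A B) x f" if "lt (amalg A B) e f" "x \<in> e \<or> col (amalg A B) x e" for x e f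
      using lt_cases[OF that(1)] col1 that(2) by blast
  qed (use colx in blast)
qed

section \<open>Rich coloured switchboards\<close>

text \<open>
  The one-point extensions are coded over initial segments of the natural numbers because HOL
  cannot quantify over the type of their points.
\<close>

definition rich :: "'a csb \<Rightarrow> bool" where
  "rich S \<longleftrightarrow> is_csb S \<and>
     (\<forall>n (T :: nat csb) a. is_csb T \<and> pts T = {..n} \<and> emb_on {..<n} T S a \<longrightarrow>
        (\<exists>b. emb_on {..n} T S (a(n := b))))"

lemma rich_csb: "rich S \<Longrightarrow> is_csb S"
  by (simp add: rich_def)

section \<open>Extending partial embeddings by a point\<close>

text \<open>This frees the extension property from its numbering: the points of \<open>A\<close>
  become the numbers below \<open>n\<close>, and \<open>z\<close> becomes the last point
  \<open>n\<close>.\<close>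

lemma rich_ext:
  assumes S: "rich S" and T: "is_csb T" and A: "finite A" "z \<notin> A" "insert z A \<subseteq> pts T"
    and a: "emb_on A T S a"
  obtains b where "emb_on (insert z A) T S (a(z := b))"
proof -
  obtain k n where k: "bij_betw k {..<n::nat} A"
    using ex_bij_betw_nat_finite[OF A(1)] by (auto simp: lessThan_atLeast0)
  define k' where "k' = k(n := z)"
  have k': "inj_on k' {..n}" "k' ` {..n} = insert z A"
    using k A(2) by (auto simp: k'_def bij_betw_def lessThan_Suc_atMost[symmetric] lessThan_Suc inj_on_def)
  have kk': "k' i = k i" if "i < n" for i
    using that by (simp add: k'_def)
  have kA: "k' ` {..<n} = A"
    using k kk' by (auto simp: bij_betw_def)
  let ?T = "pull {..n} k' T"
  have T': "is_csb ?T" "emb_on {..n} ?T T k'"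
    using is_csb_pull[OF T k'(1)] emb_on_pull[OF k'(1)] k'(2) A(3) by simp_all
  have "emb_on {..<n} ?T S (a \<circ> k')"
    by (rule emb_on_comp'[OF emb_on_subset[OF T'(2)] a]) (use kA in auto)
  then obtain b where b: "emb_on {..n} ?T S ((a \<circ> k')(n := b))"
    using S T'(1) unfolding rich_def by (metis pts_pull)
  have inv: "emb_on (insert z A) T ?T (inv_into {..n} k')"
    using emb_on_inv[OF T'(2)] k'(2) by simp
  have "emb_on (insert z A) T S ((a \<circ> k')(n := b) \<circ> inv_into {..n} k')"
    using emb_on_comp'[OF inv b] k'(2) by (metis inv_into_into image_subsetI)
  moreover have "((a \<circ> k')(n := b) \<circ> inv_into {..n} k') x = (a(z := b)) x" if x: "x \<in> insert z A" for x
  proof -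
    obtain i where i: "i \<le> n" "x = k' i"
      using x k'(2) by auto
    then have "inv_into {..n} k' x = i"
      using k'(1) by simp
    moreover have "i = n \<longleftrightarrow> x = z"
      using i A(2) kA by (auto simp: k'_def)
    ultimately show ?thesis
      using i by auto
  qed
  ultimately have "emb_on (insert z A) T S (a(z := b))"
    using emb_on_cong by blast
  then show thesis
    by (rule that)
qed

text \<open>The second conclusion makes the update harmless when \<open>d\<close> is already in the
  domain, so that later inductions need no case distinction.\<close>

lemma forth_point:
  assumes S': "rich S'" and S: "is_csb S" and Y: "finite Y" "Y \<subseteq> pts S" and h: "emb_on Y S S' h"
    and d: "d \<in> pts S"
  obtains d' where "emb_on (insert d Y) S S' (h(d := d'))" "d \<in> Y \<Longrightarrow> d' = h d"
proof (cases "d \<in> Y")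
  case True
  then show ?thesis
    using h that[of "h d"] by (simp add: insert_absorb)
next
  case False
  then show ?thesis
    using rich_ext[OF S' S Y(1) False _ h] d Y(2) that by auto
qed

lemma forth_finite:
  assumes S': "rich S'" and S: "is_csb S" and Y: "finite Y" "Y \<subseteq> pts S" and h: "emb_on Y S S' h"
    and Z: "finite Z" "Z \<subseteq> pts S"
  obtains h' where "emb_on (Y \<union> Z) S S' h'" "\<And>y. y \<in> Y \<Longrightarrow> h' y = h y"
proof -
  have "\<exists>h'. emb_on (Y \<union> Z) S S' h' \<and> (\<forall>y\<in>Y. h' y = h y)"
    using Z
  proof (induction Z rule: finite_induct)
    case empty
    then show ?case using h by auto
  next
    case (insert d Z)
    then obtain h' where h': "emb_on (Y \<union> Z) S S' h'" "\<forall>y\<in>Y. h' y = h y"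
      by auto
    obtain d' where d': "emb_on (insert d (Y \<union> Z)) S S' (h'(d := d'))" "d \<in> Y \<union> Z \<Longrightarrow> d' = h' d"
      using forth_point[OF S' S _ _ h'(1), of d] Y insert by auto
    have "\<forall>y\<in>Y. (h'(d := d')) y = h y"
      using d'(2) h'(2) by auto
    with d'(1) show ?case
      by (metis Un_insert_right)
  qed
  then show thesis using that by blast
qed

text \<open>Extend the inverse of \<open>h\<close> by one point and invert the result.\<close>

lemma back_point:
  assumes S: "rich S" and S': "is_csb S'" and Y: "finite Y" "Y \<subseteq> pts S" and h: "emb_on Y S S' h"
    and d': "d' \<in> pts S'"
  obtains d where "d \<in> pts S" "emb_on (insert d Y) S S' (h(d := d'))" "d \<in> Y \<Longrightarrow> d' = h d"
proof (cases "d' \<in> h ` Y")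
  case True
  then obtain d where "d \<in> Y" "d' = h d" by blast
  then show ?thesis
    using h Y(2) that[of d] by (auto simp: insert_absorb)
next
  case False
  let ?k = "inv_into Y h"
  note inj = emb_onD(1)[OF h]
  have hY: "h ` Y \<subseteq> pts S'"
    using h by (simp add: emb_on_def)
  obtain d where d: "emb_on (insert d' (h ` Y)) S' S (?k(d' := d))"
    using rich_ext[OF S S' _ False _ emb_on_inv[OF h Y(2)]] Y(1) d' hY by auto
  let ?k' = "?k(d' := d)"
  have dS: "d \<in> pts S"
    using emb_onD(2)[OF d, of d'] by simp
  have img: "?k' ` insert d' (h ` Y) = insert d Y"
  proof -
    have "?k' ` h ` Y = ?k ` h ` Y"
      using False by (intro image_cong) auto
    also have "\<dots> = Y"
      using inj by simp
    finally show ?thesis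
      by (simp only: image_insert fun_upd_same)
  qed
  have dY: "d \<notin> Y"
  proof
    assume "d \<in> Y"
    then have "?k' (h d) = ?k' d'"
      using inj False by auto
    then show False
      using emb_onD(1)[OF d] \<open>d \<in> Y\<close> False by (metis inj_on_def image_eqI insertCI)
  qed
  have "emb_on (insert d Y) S S' (inv_into (insert d' (h ` Y)) ?k')"
    using emb_on_inv[OF d] img d' hY by simp
  moreover have "inv_into (insert d' (h ` Y)) ?k' x = (h(d := d')) x" if "x \<in> insert d Y" for x
  proof (rule inv_into_f_eq[OF emb_onD(1)[OF d]])
    show "(h(d := d')) x \<in> insert d' (h ` Y)" using that by auto
    show "?k' ((h(d := d')) x) = x"
      using that dY False inj by (auto simp: image_iff)
  qed
  ultimately have "emb_on (insert d Y) S S' (h(d := d'))"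
    using emb_on_cong by blast
  with dS dY that show ?thesis by blast
qed

text \<open>
  The new point \<open>c\<close> is free from \<open>X\<close> over \<open>Y\<close>: relations between \<open>X\<close> and \<open>insert c Y\<close> are
  composites through edges of \<open>Y\<close>.
\<close>

lemma free_ext:
  assumes S: "rich S" and X: "finite X" "X \<subseteq> pts S" and Y: "Y \<subseteq> X"
    and h: "emb_on Y S S h" and d: "d \<in> pts S" "d \<notin> h ` Y"
  obtains c where "c \<in> pts S" "c \<notin> X" "emb_on (insert c Y) S S (h(c := d))"
    "\<And>e f. e \<in> edges (insert c X) \<Longrightarrow> f \<in> edges (insert c X) \<Longrightarrow> lt S e f \<Longrightarrow>
       e \<in> edges X \<and> f \<in> edges X \<or> e \<in> edges (insert c Y) \<and> f \<in> edges (insert c Y) \<or>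
       (\<exists>g\<in>edges Y. lt S e g \<and> lt S g f \<and>
          (e \<in> edges X \<and> f \<in> edges (insert c Y) \<or> e \<in> edges (insert c Y) \<and> f \<in> edges X))"
    "\<And>x e. x \<in> insert c X \<Longrightarrow> e \<in> edges (insert c X) \<Longrightarrow> col S x e \<Longrightarrow>
       x \<in> X \<and> e \<in> edges X \<or> x \<in> insert c Y \<and> e \<in> edges (insert c Y) \<or>
       (\<exists>g\<in>edges Y. col S x g \<and> lt S g e \<and>
          (x \<in> X \<and> e \<in> edges (insert c Y) \<or> x \<in> insert c Y \<and> e \<in> edges X))"
proof -
  note csb = rich_csb[OF S]
  \<comment> \<open>In the option type, \<open>None\<close> stands for the future \<open>c\<close>.
    The part \<open>A\<close> is a copy of \<open>X\<close>; the part \<open>B\<close> copies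
    \<open>d\<close> together with the image of \<open>Y\<close> under \<open>h\<close>, but with
    that image labelled by \<open>Y\<close>. So the two parts meet in \<open>Y\<close> only.\<close>
  let ?X = "Some ` X" and ?Y = "insert None (Some ` Y)"
  define k where "k z = (case z of None \<Rightarrow> d | Some y \<Rightarrow> h y)" for z
  have k_simps [simp]: "k None = d" "k (Some y) = h y" for y
    by (simp_all add: k_def)
  have hY: "inj_on h Y" "h ` Y \<subseteq> pts S"
    using h by (simp_all add: emb_on_def)
  have k: "inj_on k ?Y" "k ` ?Y \<subseteq> pts S"
    using hY d by (auto simp: inj_on_def k_def image_iff)
  have the: "inj_on the ?X" "the ` ?X \<subseteq> pts S"
    using X by (auto simp: inj_on_def)
  define A where "A = pull ?X the S"
  define B where "B = pull ?Y k S"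
  have A: "is_csb A" "pts A = ?X" "emb_on ?X A S the"
    unfolding A_def using is_csb_pull[OF csb the] emb_on_pull[OF the] by simp_all
  have B: "is_csb B" "pts B = ?Y" "emb_on ?Y B S k"
    unfolding B_def using is_csb_pull[OF csb k] emb_on_pull[OF k] by simp_all
  have int: "?X \<inter> ?Y = Some ` Y"
    using Y by auto
  have "emb_on (Some ` Y) A B id"
  proof -
    have "the ` e \<in> edges Y" "h ` the ` e = k ` e" "e \<in> edges ?X" "e \<in> edges ?Y"
      if e: "e \<in> edges (Some ` Y)" for e
    proof -
      obtain e' where "e = Some ` e'" "e' \<in> edges Y"
        using e edges_of_image[of Some Y] by auto
      then show "the ` e \<in> edges Y" "h ` the ` e = k ` e"
        by (simp_all add: image_comp comp_def)
      show "e \<in> edges ?X" "e \<in> edges ?Y"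
        using e edges_mono[of "Some ` Y"] Y by blast+
    qed
    note E = this
    have "lt B e f \<longleftrightarrow> lt A e f" if "e \<in> edges (Some ` Y)" "f \<in> edges (Some ` Y)" for e f
      using E[OF that(1)] E[OF that(2)] emb_onD(3)[OF h, of "the ` e" "the ` f"]
      by (simp add: A_def B_def pull_def)
    moreover have "col B x e \<longleftrightarrow> col A x e" if x: "x \<in> Some ` Y" and e: "e \<in> edges (Some ` Y)" for x e
    proof -
      obtain y where "x = Some y" "y \<in> Y" using x by blast
      then show ?thesis
        using E[OF e] emb_onD(4)[OF h, of y "the ` e"] Y
        by (auto simp: A_def B_def pull_def)
    qed
    ultimately show ?thesis
      by (auto simp: emb_on_def B(2))
  qed
  then have agree: "emb_on (pts A \<inter> pts B) A B id"
    by (simp add: A(2) B(2) int)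
  note am = amalgamation[OF A(1) B(1) agree]
  let ?C = "amalg A B"
  have ptsC: "pts ?C = insert None ?X"
    using Y by (auto simp: amalg_def A(2) B(2))
  have "emb_on ?X ?C S (the \<circ> inv_into ?X id)"
  proof (rule emb_on_comp'[OF _ A(3)])
    show "emb_on ?X ?C A (inv_into ?X id)"
      using emb_on_inv[OF am(2)] A(2) by simp
  qed (auto intro: inv_into_into)
  moreover have "(the \<circ> inv_into ?X id) x = the x" if "x \<in> ?X" for x
    using inv_into_f_f[OF inj_on_id that] by simp
  ultimately have "emb_on ?X ?C S the"
    using emb_on_cong by blast
  \<comment> \<open>The amalgam extends a copy of \<open>X\<close>, so richness realises its extra
    point in \<open>S\<close> with \<open>X\<close> held fixed.\<close>
  then obtain c where c: "emb_on (insert None ?X) ?C S (the(None := c))"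
    using rich_ext[OF S am(1), of ?X None the] X(1) ptsC by auto
  define m where "m = the(None := c)"
  have m_simps [simp]: "m None = c" "m (Some x) = x" for x
    by (simp_all add: m_def)
  note m = c[folded m_def]
  have cS: "c \<in> pts S"
    using emb_onD(2)[OF m, of None] by simp
  have cX: "c \<notin> X"
  proof
    assume "c \<in> X"
    then have "m (Some c) = m None" "Some c \<in> ?X" by simp_all
    then show False
      using emb_onD(1)[OF m] by (metis inj_on_def insertCI option.distinct(1))
  qed
  have mX: "m ` ?X = X" "m ` ?Y = insert c Y" "m ` insert None ?X = insert c X" "m ` Some ` Y = Y"
    by (simp_all add: image_comp comp_def)
  have inj: "inj_on m (insert None ?X)" "inj_on m ?X" "inj_on m ?Y" "inj_on m (Some ` Y)"
    using emb_onD(1)[OF m] Y by (auto intro: inj_on_subset)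
  have mB: "emb_on ?Y B S m"
    using emb_on_comp'[OF am(3)[unfolded B(2)] m] Y by (auto simp: comp_def id_def)
  have "emb_on (insert c Y) S S (k \<circ> inv_into ?Y m)"
    using emb_on_comp'[OF emb_on_inv[OF mB] B(3)] mX(2) B(2) by (metis image_subsetI inv_into_into subset_refl)
  moreover have "(k \<circ> inv_into ?Y m) y = (h(c := d)) y" if "y \<in> insert c Y" for y
  proof (cases "y = c")
    case True
    then have "inv_into ?Y m y = None"
      by (intro inv_into_f_eq[OF inj(3)]) auto
    with True show ?thesis by simp
  next
    case False
    then have "inv_into ?Y m y = Some y"
      using that by (intro inv_into_f_eq[OF inj(3)]) auto
    with False show ?thesis by simp
  qed
  ultimately have 1: "emb_on (insert c Y) S S (h(c := d))"
    using emb_on_cong by blast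
  have E: "\<exists>e'. e = m ` e' \<and> e' \<in> edges (insert None ?X)" if "e \<in> edges (insert c X)" for e
    using that edges_of_image[OF inj(1)] mX(3) by auto
  have EX: "m ` e' \<in> edges X" if "e' \<in> edges ?X" for e'
    using edges_image[OF inj(2) that] mX(1) by simp
  have EY: "m ` e' \<in> edges (insert c Y)" if "e' \<in> edges ?Y" for e'
    using edges_image[OF inj(3) that] mX(2) by simp
  have EXY: "m ` e' \<in> edges Y" if "e' \<in> edges ?X" "e' \<in> edges ?Y" for e'
  proof -
    have "e' \<in> edges (?X \<inter> ?Y)"
      unfolding edges_Int using that by simp
    then have "e' \<in> edges (Some ` Y)"
      unfolding int .
    from edges_image[OF inj(4) this] show ?thesis
      unfolding mX(4) .
  qed
  have lt_m: "lt S (m ` e) (m ` f)" if "lt A e f \<or> lt B e f" for e f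
  proof -
    have "lt ?C e f"
      using that by (auto simp: amalg_def)
    then show ?thesis
      using emb_onD(3)[OF m] is_csbD(1,2)[OF am(1)] ptsC by metis
  qed
  have col_m: "col S (m x) (m ` e)" if "col A x e \<or> col B x e" for x e
  proof -
    have "col ?C x e"
      using that by (auto simp: amalg_def)
    then show ?thesis
      using emb_onD(4)[OF m] is_csbD(3,4)[OF am(1)] ptsC by metis
  qed
  note ltA = lt_m[OF disjI1] is_csbD(1,2)[OF A(1), unfolded A(2)]
    and ltB = lt_m[OF disjI2] is_csbD(1,2)[OF B(1), unfolded B(2)]
    and colA = col_m[OF disjI1] is_csbD(3,4)[OF A(1), unfolded A(2)]
    and colB = col_m[OF disjI2] is_csbD(3,4)[OF B(1), unfolded B(2)]
  have 2: "e \<in> edges X \<and> f \<in> edges X \<or> e \<in> edges (insert c Y) \<and> f \<in> edges (insert c Y) \<or>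
       (\<exists>g\<in>edges Y. lt S e g \<and> lt S g f \<and>
          (e \<in> edges X \<and> f \<in> edges (insert c Y) \<or> e \<in> edges (insert c Y) \<and> f \<in> edges X))"
    if ef: "e \<in> edges (insert c X)" "f \<in> edges (insert c X)" "lt S e f" for e f
  proof -
    obtain e' f' where e': "e = m ` e'" "e' \<in> edges (insert None ?X)"
      and f': "f = m ` f'" "f' \<in> edges (insert None ?X)"
      using E[OF ef(1)] E[OF ef(2)] by blast
    then have "lt ?C e' f'"
      using emb_onD(3)[OF m] ef(3) by blast
    then consider "lt A e' f'" | "lt B e' f'" | g where "lt A e' g" "lt B g f'"
      | g where "lt B e' g" "lt A g f'"
      unfolding amalg_def by auto
    then show ?thesis
    proof cases
      case 1
      then show ?thesis using ltA[OF 1] EX e' f' by simp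
    next
      case 2
      then show ?thesis using ltB[OF 2] EY e' f' by simp
    next
      case (3 g)
      have "m ` g \<in> edges Y" using ltA(3)[OF 3(1)] ltB(2)[OF 3(2)] EXY by blast
      then show ?thesis using ltA(1,2)[OF 3(1)] ltB(1,3)[OF 3(2)] EX EY e' f' by blast
    next
      case (4 g)
      have "m ` g \<in> edges Y" using ltB(3)[OF 4(1)] ltA(2)[OF 4(2)] EXY by blast
      then show ?thesis using ltB(1,2)[OF 4(1)] ltA(1,3)[OF 4(2)] EX EY e' f' by blast
    qed
  qed
  have 3: "x \<in> X \<and> e \<in> edges X \<or> x \<in> insert c Y \<and> e \<in> edges (insert c Y) \<or>
       (\<exists>g\<in>edges Y. col S x g \<and> lt S g e \<and>
          (x \<in> X \<and> e \<in> edges (insert c Y) \<or> x \<in> insert c Y \<and> e \<in> edges X))"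
    if xe: "x \<in> insert c X" "e \<in> edges (insert c X)" "col S x e" for x e
  proof -
    obtain x' e' where x': "x = m x'" "x' \<in> insert None ?X"
      and e': "e = m ` e'" "e' \<in> edges (insert None ?X)"
      using E[OF xe(2)] xe(1) mX(3) by (metis imageE)
    then have "col ?C x' e'"
      using emb_onD(4)[OF m] xe(3) by blast
    then consider "col A x' e'" | "col B x' e'" | g where "col A x' g" "lt B g e'"
      | g where "col B x' g" "lt A g e'"
      unfolding amalg_def by auto
    then show ?thesis
    proof cases
      case 1
      then show ?thesis using colA[OF 1] EX e' x' mX by auto
    next
      case 2
      then show ?thesis using colB[OF 2] EY e' x' mX by auto
    next
      case (3 g)
      have "m ` g \<in> edges Y" using colA(3)[OF 3(1)] ltB(2)[OF 3(2)] EXY by blast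
      moreover have "x \<in> X" using colA(2)[OF 3(1)] x' by auto
      ultimately show ?thesis using colA(1)[OF 3(1)] ltB(1,3)[OF 3(2)] EY e' x' by blast
    next
      case (4 g)
      have "m ` g \<in> edges Y" using colB(3)[OF 4(1)] ltA(2)[OF 4(2)] EXY by blast
      moreover have "x \<in> insert c Y" using colB(2)[OF 4(1)] x' by auto
      ultimately show ?thesis using colB(1)[OF 4(1)] ltA(1,3)[OF 4(2)] EX e' x' by blast
    qed
  qed
  from cS cX 1 2 3 show thesis
    by (rule that)
qed

section \<open>Order duality and the realisation of colours by edges\<close>

text \<open>Reversing the order exchanges the two sides of an edge, so the colours are complemented
  wherever the point is off the edge.\<close>

definition dual :: "'a csb \<Rightarrow> 'a csb" where
  "dual S = \<lparr>pts = pts S, lt = \<lambda>e f. lt S f e,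
     col = \<lambda>x e. x \<in> pts S \<and> e \<in> edges (pts S) \<and> x \<notin> e \<and> \<not> col S x e\<rparr>"

lemma pts_dual [simp]: "pts (dual S) = pts S"
  by (simp add: dual_def)

lemma lt_dual [simp]: "lt (dual S) e f \<longleftrightarrow> lt S f e"
  by (simp add: dual_def)

lemma is_csb_dual:
  assumes "is_csb S"
  shows "is_csb (dual S)"
proof -
  note S = is_csbD[OF assms]
  show ?thesis
    unfolding is_csb_def
  proof (intro conjI allI impI)
    show "csb_typed (dual S)"
      using S(1,2) by (auto simp: csb_typed_def dual_def)
    show "lt (dual S) e g" if "lt (dual S) e f" "lt (dual S) f g" for e f g
      using that S(5)[of g f e] by simp
    show "x \<notin> e" if "col (dual S) x e" for x e
      using that by (simp add: dual_def)
    show "col (dual S) x f" if ef: "lt (dual S) e f" and x: "x \<in> e \<or> col (dual S) x e" for x e f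
    proof -
      have fe: "lt S f e"
        using ef by simp
      have "x \<in> pts S"
        using x S(2)[OF fe] edges_subset by (auto simp: dual_def)
      moreover have "x \<notin> f" "\<not> col S x f"
        using x S(7,8)[OF fe, of x] S(6)[of x e] by (auto simp: dual_def)
      ultimately show ?thesis
        using S(1)[OF fe] by (simp add: dual_def)
    qed
  qed
qed

lemma dual_dual:
  assumes "is_csb S"
  shows "dual (dual S) = S"
proof -
  have "col (dual (dual S)) x e \<longleftrightarrow> col S x e" for x e
    using is_csbD(3,4,6)[OF assms, of x e] by (auto simp: dual_def)
  then show ?thesis
    by (intro csb.equality ext) simp_all
qed

lemma emb_on_dual:
  assumes h: "emb_on X S S' h" and X: "X \<subseteq> pts S"
  shows "emb_on X (dual S) (dual S') h"
proof -
  note inj = emb_onD(1)[OF h]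
  have hX: "h ` X \<subseteq> pts S'"
    using h by (simp add: emb_on_def)
  have "col (dual S') (h x) (h ` e) \<longleftrightarrow> col (dual S) x e" if "x \<in> X" "e \<in> edges X" for x e
  proof -
    have "h ` e \<in> edges (pts S')" "e \<in> edges (pts S)"
      using edges_image[OF inj that(2)] edges_mono[OF hX] edges_mono[OF X] that(2) by blast+
    moreover have "h x \<in> h ` e \<longleftrightarrow> x \<in> e"
      using inj_on_image_mem_iff[OF inj that(1) edges_subset[OF that(2)]] .
    ultimately show ?thesis
      using that hX X emb_onD(4)[OF h] by (auto simp: dual_def)
  qed
  then show ?thesis
    using h by (auto simp: emb_on_def)
qed

lemma rich_dual:
  assumes S: "rich S"
  shows "rich (dual S)"
  unfolding rich_def
proof (intro conjI allI impI)
  show "is_csb (dual S)"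
    using is_csb_dual rich_csb[OF S] .
next
  fix n and T :: "nat csb" and a
  assume T: "is_csb T \<and> pts T = {..n} \<and> emb_on {..<n} T (dual S) a"
  then have "emb_on {..<n} (dual T) S a"
    using emb_on_dual[of "{..<n}" T "dual S" a] dual_dual[OF rich_csb[OF S]] by fastforce
  then obtain b where "emb_on {..n} (dual T) S (a(n := b))"
    using S T is_csb_dual unfolding rich_def by (metis pts_dual)
  then show "\<exists>b. emb_on {..n} T (dual S) (a(n := b))"
    using emb_on_dual[of "{..n}" "dual T" S] dual_dual T by (metis pts_dual subset_refl)
qed

text \<open>The witness is a new point \<open>None\<close> whose edge to \<open>x\<close> is put
  below exactly the edges of \<open>X\<close> at or above \<open>e\<close>. The colour of
  \<open>x\<close> at \<open>e\<close> persists at all of these, as \<open>is_csb\<close> demands of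
  a vertex of the lower edge, and the new point is coloured at them by definition.\<close>

lemma rich_edge_below:
  assumes S: "rich S" and x: "x \<in> pts S" and e: "e \<in> edges (pts S)" and col: "col S x e"
  obtains y where "y \<in> pts S" "y \<noteq> x" "lt S {x, y} e"
proof -
  note cS = is_csbD[OF rich_csb[OF S]]
  define X where "X = insert x e"
  have "finite e"
    using e unfolding edges_def by (auto intro: card_ge_0_finite)
  then have X: "finite X" "X \<subseteq> pts S" "x \<in> X"
    using x edges_subset[OF e] by (auto simp: X_def)
  have eX: "e \<in> edges X"
    using e by (auto simp: X_def edges_def)
  let ?Y = "insert None (Some ` X)" and ?n = "{Some x, None}"
  define up where "up f \<longleftrightarrow> f \<in> edges X \<and> (f = e \<or> lt S e f)" for f
  define T where "T = \<lparr>pts = ?Y,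
    lt = \<lambda>e' f'. \<exists>f. f' = Some ` f \<and>
      (up f \<and> e' = ?n \<or> (\<exists>g. e' = Some ` g \<and> g \<in> edges X \<and> f \<in> edges X \<and> lt S g f)),
    col = \<lambda>x' f'. \<exists>f. f' = Some ` f \<and>
      (up f \<and> x' = None \<or> (\<exists>z\<in>X. x' = Some z \<and> f \<in> edges X \<and> col S z f))\<rparr>"
  have Some_eq [simp]: "Some ` f = Some ` g \<longleftrightarrow> f = g" for f g :: "'a set"
    by (simp add: inj_image_eq_iff)
  have n_neq [simp]: "?n \<noteq> Some ` f" "Some ` f \<noteq> ?n" for f
    by auto
  have edge: "Some ` f \<in> edges ?Y" if "f \<in> edges X" for f
    using edges_image[OF _ that, of Some] edges_mono[of "Some ` X" ?Y] by auto
  have upE: "f \<in> edges X" "col S x f" if "up f" for f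
    using that col cS(8) by (auto simp: up_def)
  have up_lt: "up g" if "up f" "lt S f g" "g \<in> edges X" for f g
    using that cS(5) by (auto simp: up_def)
  have "is_csb T"
    unfolding is_csb_def
  proof (intro conjI allI impI)
    have "?n \<in> edges ?Y"
      using X(3) by (simp add: doubleton_in_edges)
    then show "csb_typed T"
      unfolding csb_typed_def T_def using edge upE(1) by auto
  next
    fix e' f' g' assume "lt T e' f'" "lt T f' g'"
    then show "lt T e' g'"
      using up_lt cS(5) by (auto simp: T_def)
  next
    fix x' e' assume "col T x' e'"
    then show "x' \<notin> e'"
      using cS(6) by (auto simp: T_def)
  next
    fix x' e' f' assume ef: "lt T e' f'" and x': "x' \<in> e' \<or> col T x' e'"
    from ef obtain f where f: "f' = Some ` f"
      and "up f \<and> e' = ?n \<or> (\<exists>g. e' = Some ` g \<and> g \<in> edges X \<and> f \<in> edges X \<and> lt S g f)"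
      unfolding T_def by auto
    then show "col T x' f'"
    proof (elim disjE conjE exE)
      assume "up f" "e' = ?n"
      then show ?thesis
        using x' X(3) upE[of f] f by (auto simp: T_def)
    next
      fix g assume g: "e' = Some ` g" "g \<in> edges X" "f \<in> edges X" "lt S g f"
      show ?thesis
        using x' g f up_lt[of g f] cS(7,8)[OF g(4)] edges_subset[OF g(2)] by (auto simp: T_def)
    qed
  qed
  moreover have "emb_on (Some ` X) T S the"
  proof -
    have "(the ` Some ` f) = f" for f :: "'a set"
      by (simp add: image_comp comp_def)
    then show ?thesis
      using X(2) unfolding emb_on_def edges_of_image[of Some X, OF inj_Some[THEN inj_on_subset, OF subset_UNIV]]
      by (auto simp: T_def inj_on_def)
  qed
  ultimately obtain b where b: "emb_on ?Y T S (the(None := b))"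
    using rich_ext[OF S, of T "Some ` X" None the] X(1) by (auto simp: T_def)
  let ?h = "the(None := b)"
  have "lt S (?h ` ?n) (?h ` Some ` e)"
    using emb_onD(3)[OF b, of ?n "Some ` e"] edge[OF eX] X(3) eX
    by (simp add: doubleton_in_edges T_def up_def)
  moreover have "?h ` ?n = {x, b}" "?h ` Some ` e = e"
    unfolding image_image by simp_all
  ultimately have lt: "lt S {x, b} e"
    by simp
  then have "b \<in> pts S" "b \<noteq> x"
    using cS(1)[OF lt] by (auto simp: doubleton_in_edges)
  with lt show thesis
    using that by blast
qed

lemma rich_edge_above:
  assumes S: "rich S" and x: "x \<in> pts S" and e: "e \<in> edges (pts S)" and col: "x \<notin> e" "\<not> col S x e"
  obtains y where "y \<in> pts S" "y \<noteq> x" "lt S e {x, y}"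
  using rich_edge_below[OF rich_dual[OF S], of x e] assms by (auto simp: dual_def)

text \<open>This is what makes colours first-order: a colour and its negation are both witnessed by
  an edge, so both are existential in the order alone.\<close>

definition determined :: "'u csb \<Rightarrow> bool" where
  "determined S \<longleftrightarrow> (\<forall>x\<in>pts S. \<forall>e\<in>edges (pts S). x \<notin> e \<longrightarrow>
     (\<exists>y\<in>pts S. if col S x e then lt S {x, y} e else lt S e {x, y}))"

lemma determinedD:
  assumes "determined S" "x \<in> pts S" "e \<in> edges (pts S)" "x \<notin> e"
  shows "col S x e \<Longrightarrow> \<exists>y\<in>pts S. lt S {x, y} e" "\<not> col S x e \<Longrightarrow> \<exists>y\<in>pts S. lt S e {x, y}"
proof -
  have "\<exists>y\<in>pts S. if col S x e then lt S {x, y} e else lt S e {x, y}"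
    using assms unfolding determined_def by blast
  then show "col S x e \<Longrightarrow> \<exists>y\<in>pts S. lt S {x, y} e" "\<not> col S x e \<Longrightarrow> \<exists>y\<in>pts S. lt S e {x, y}"
    by simp_all
qed

text \<open>The side on which a comparable edge through \<open>x\<close> lies forces the colour, so
  any comparable edge is a witness for the right alternative.\<close>

lemma determinedI:
  assumes S: "is_csb S"
    and "\<And>x e. x \<in> pts S \<Longrightarrow> e \<in> edges (pts S) \<Longrightarrow> x \<notin> e \<Longrightarrow>
      (\<exists>y\<in>pts S. lt S {x, y} e) \<or> (\<exists>y\<in>pts S. lt S e {x, y})"
  shows "determined S"
  unfolding determined_def
proof (intro ballI impI)
  fix x e assume x: "x \<in> pts S" "e \<in> edges (pts S)" "x \<notin> e"
  have "col S x e" if "lt S {x, y} e" for y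
    using is_csbD(7)[OF S that] by simp
  moreover have "\<not> col S x e" if "lt S e {x, y}" for y
    using is_csbD(8)[OF S that, of x] is_csbD(6)[OF S, of x "{x, y}"] by blast
  ultimately show "\<exists>y\<in>pts S. if col S x e then lt S {x, y} e else lt S e {x, y}"
    using assms(2)[OF x] by (elim disjE bexE) (simp_all, blast+)
qed

lemma rich_determined: "rich S \<Longrightarrow> determined S"
  unfolding determined_def using rich_edge_below rich_edge_above by (metis (full_types))

text \<open>A point without colour at \<open>e\<close> has only the upper side of \<open>e\<close>
  open to its edges, and richness then places one of them above \<open>e\<close>. Iterating gives
  the sequence.\<close>

lemma rich_increasing_edges:
  assumes S: "rich S"
  obtains g :: "nat \<Rightarrow> 'a set" where "\<And>i. g i \<in> edges (pts S)" "\<And>i. lt S (g i) (g (Suc i))"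
proof -
  have step: "\<exists>f. f \<in> edges (pts S) \<and> lt S e f" if e: "e \<in> edges (pts S)" for e
  proof -
    let ?Y = "insert None (Some ` e)"
    \<comment> \<open>The relation-free structure embeds on the part \<open>e\<close> because two
      points carry a single edge and hence no relation at all. What the extension provides is a
      third point that is not coloured at \<open>e\<close>.\<close>
    let ?T = "\<lparr>pts = ?Y, lt = \<lambda>_ _. False, col = \<lambda>_ _. False\<rparr> :: 'a option csb"
    note cS = is_csbD[OF rich_csb[OF S]]
    have "card e = 2"
      using e by (simp add: edges_def)
    then have fin: "finite e"
      by (intro card_ge_0_finite) simp
    have "f = e" if "f \<in> edges e" for f
      using that card_subset_eq[OF fin, of f] \<open>card e = 2\<close> by (simp add: edges_def)
    then have f: "the ` f = e" if "f \<in> edges (Some ` e)" for f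
      using that edges_of_image[of Some e] by (force simp: image_comp comp_def)
    have "emb_on (Some ` e) ?T S the"
      unfolding emb_on_def
      using f cS(6)[of _ e] cS(9)[of e e] e edges_subset[OF e]
      by (auto simp: inj_on_def edges_def card_2_iff)
    then obtain b where b: "emb_on ?Y ?T S (the(None := b))"
      using rich_ext[OF S trivial_csb[of ?Y], of "Some ` e" None the] fin by auto
    let ?h = "the(None := b)"
    have he: "?h ` Some ` e = e" and hN: "?h None = b"
      unfolding image_image by simp_all
    have eY: "Some ` e \<in> edges ?Y"
      using \<open>card e = 2\<close> by (auto simp: edges_def card_image)
    have "\<not> col S (?h None) (?h ` Some ` e)"
      using emb_onD(4)[OF b, of None "Some ` e"] eY by simp
    then have "\<not> col S b e"
      unfolding he hN .
    moreover have "b \<in> pts S"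
      using emb_onD(2)[OF b, of None] by simp
    moreover have "b \<notin> e"
    proof
      assume "b \<in> e"
      then have "?h (Some b) = ?h None" "Some b \<in> ?Y"
        by simp_all
      then show False
        using emb_onD(1)[OF b] by (metis inj_on_def insertI1 option.distinct(1))
    qed
    ultimately obtain y where "lt S e {b, y}"
      using rich_edge_above[OF S _ e] by blast
    then show ?thesis
      using cS(2) by blast
  qed
  let ?T = "\<lambda>n::nat. \<lparr>pts = {..n}, lt = \<lambda>_ _. False, col = \<lambda>_ _. False\<rparr>"
  have T: "is_csb (?T n)" "pts (?T n) = {..n}" for n
    by (simp_all add: trivial_csb)
  have "\<exists>b. emb_on {..0} (?T 0) S (undefined(0 := b))"
    using S T(1)[of 0] emb_on_empty unfolding rich_def by (metis T(2) lessThan_0)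
  then obtain a where "emb_on {..0} (?T 0) S a"
    by blast
  then have "emb_on {..<1} (?T 1) S a"
    by (simp add: emb_on_def lessThan_Suc_atMost)
  then obtain b where b: "emb_on {..1} (?T 1) S b"
    using S T unfolding rich_def by blast
  have "b ` {0, 1} \<in> edges (pts S)"
    using b edges_image[OF emb_onD(1)[OF b], of "{0, 1}"] edges_mono[of "b ` {..1}" "pts S"]
    by (auto simp: emb_on_def doubleton_in_edges)
  then have "\<exists>g. \<forall>n. g n \<in> edges (pts S) \<and> lt S (g n) (g (Suc n))"
    using dependent_nat_choice[of "\<lambda>_ e. e \<in> edges (pts S)" "\<lambda>_ e f. lt S e f"] step by blast
  with that show thesis by blast
qed

lemma rich_infinite:
  assumes S: "rich S"
  shows "infinite (pts S)"
proof
  assume fin: "finite (pts S)"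
  obtain g where g: "\<And>i. g i \<in> edges (pts S)" "\<And>i. lt S (g i) (g (Suc i))"
    using rich_increasing_edges[OF S] by blast
  note cS = is_csbD[OF rich_csb[OF S]]
  have less: "lt S (g i) (g j)" if "i < j" for i j
    using that by (rule less_Suc_induct) (use g(2) cS(5) in blast)+
  have "\<not> lt S (g i) (g i)" for i
    using cS(9)[of "g i" "g i"] g(1)[of i] by (auto simp: edges_def card_2_iff)
  then have "inj g"
    using less by (metis injI linorder_neqE_nat)
  then have "infinite (range g)"
    by (rule range_inj_infinite)
  moreover have "range g \<subseteq> edges (pts S)"
    using g(1) by blast
  ultimately show False
    using finite_edges[OF fin] finite_subset by blast
qed

lemma rich_pull:
  assumes S: "rich S" and g: "bij_betw g Y (pts S)"
  shows "rich (pull Y g S)"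
  unfolding rich_def
proof (intro conjI allI impI)
  have inj: "inj_on g Y" and img: "g ` Y = pts S"
    using g by (simp_all add: bij_betw_def)
  show "is_csb (pull Y g S)"
    using is_csb_pull[OF rich_csb[OF S] inj] img by simp
  have e: "emb_on Y (pull Y g S) S g"
    using emb_on_pull[OF inj] img by simp
  fix n and T :: "nat csb" and a
  assume T: "is_csb T \<and> pts T = {..n} \<and> emb_on {..<n} T (pull Y g S) a"
  then have a: "a ` {..<n} \<subseteq> Y"
    by (simp add: emb_on_def)
  then have "emb_on {..<n} T S (g \<circ> a)"
    using emb_on_comp'[OF _ e] T by blast
  then obtain b where b: "emb_on {..n} T S ((g \<circ> a)(n := b))"
    using S T unfolding rich_def by blast
  have "emb_on (pts S) S (pull Y g S) (inv_into Y g)"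
    using emb_on_inv[OF e] img by simp
  then have "emb_on {..n} T (pull Y g S) (inv_into Y g \<circ> (g \<circ> a)(n := b))"
    by (rule emb_on_comp'[OF b]) (use b in \<open>simp only: emb_on_def\<close>)
  moreover have "(inv_into Y g \<circ> (g \<circ> a)(n := b)) i = (a(n := inv_into Y g b)) i" if "i \<in> {..n}" for i
  proof (cases "i = n")
    case False
    then have "a i \<in> Y"
      using that a by auto
    with False show ?thesis
      using inv_into_f_f[OF inj] by simp
  qed simp
  ultimately show "\<exists>b. emb_on {..n} T (pull Y g S) (a(n := b))"
    using emb_on_cong by blast
qed

section \<open>Existence of rich extensions in a fixed universe\<close>

text \<open>The extension must live in the same type as the given structure. Codes
  \<open>Inl\<close> will hold the old points, and codes \<open>Inr\<close> reserve a point for each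
  finite tuple with the number of an extension problem.\<close>

lemma infinite_UNIV_coding:
  assumes "infinite (UNIV :: 'u set)"
  obtains J :: "'u + 'u list \<times> nat \<Rightarrow> 'u" where "inj J"
proof -
  obtain p :: "'u \<times> 'u \<Rightarrow> 'u" where "bij_betw p (UNIV \<times> UNIV) UNIV"
    using conjunct1[OF card_of_Times_infinite[OF assms UNIV_not_empty card_of_mono1[OF subset_refl]]]
    unfolding card_of_ordIso[symmetric] by blast
  then have p: "inj p"
    by (simp add: bij_betw_def)
  obtain c :: "nat \<Rightarrow> 'u" where c: "inj c"
    using infinite_countable_subset[OF assms] by blast
  have p_eq [simp]: "p z = p z' \<longleftrightarrow> z = z'" for z z'
    using p by (simp add: inj_eq)
  have c_eq [simp]: "c i = c j \<longleftrightarrow> i = j" for i j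
    using c by (simp add: inj_eq)
  define code where "code xs = foldr (\<lambda>x r. p (x, r)) xs (c 0)" for xs
  have code: "xs = ys" if "length xs = length ys" "code xs = code ys" for xs ys
    using that by (induction xs ys rule: list_induct2) (auto simp: code_def)
  \<comment> \<open>\<open>c 0\<close> and \<open>c 1\<close> are tags for the two summands. The
    length is stored because \<open>code\<close> separates only lists of equal length.\<close>
  define J where "J z = (case z of Inl x \<Rightarrow> p (c 0, x)
    | Inr (xs, k) \<Rightarrow> p (c 1, p (c k, p (c (length xs), code xs))))" for z
  have "inj J"
    by (rule injI) (auto simp: J_def split: sum.splits intro: code)
  then show thesis
    by (rule that)
qed

text \<open>This yields both the enumeration of extension problems and the finiteness of the set of
  colours in the Ramsey argument.\<close>

lemma finite_csb_on:
  assumes Y: "finite Y"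
  shows "finite {T :: 'a csb. csb_typed T \<and> pts T = Y}" (is "finite ?Ts")
proof -
  let ?code = "\<lambda>T :: 'a csb. ({(e, f). lt T e f}, {(x, e). col T x e})"
  have "?code ` ?Ts \<subseteq> Pow (edges Y \<times> edges Y) \<times> Pow (Y \<times> edges Y)"
    by (auto simp: csb_typed_def)
  then have "finite (?code ` ?Ts)"
    by (rule finite_subset) (use Y finite_edges in blast)
  moreover have "inj_on ?code ?Ts"
    by (rule inj_onI) (auto intro!: csb.equality ext simp: set_eq_iff)
  ultimately show ?thesis
    by (rule finite_imageD)
qed

lemma countable_finite_csb: "countable {T :: nat csb. csb_typed T \<and> finite (pts T)}"
proof -
  have "{T :: nat csb. csb_typed T \<and> finite (pts T)} =
      (\<Union>Y\<in>{Y. finite Y}. {T. csb_typed T \<and> pts T = Y})"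
    by auto
  moreover have "countable {Y :: nat set. finite Y}"
    using countable_Collect_finite by (simp add: Collect_mono)
  ultimately show ?thesis
    by (simp only:) (rule countable_UN, assumption, rule countable_finite, simp add: finite_csb_on)
qed

definition sub_csb :: "'a csb \<Rightarrow> 'a csb \<Rightarrow> bool" where
  "sub_csb S S' \<longleftrightarrow> pts S \<subseteq> pts S' \<and> emb_on (pts S) S S' id"

lemma sub_csb_iff:
  "sub_csb S S' \<longleftrightarrow> pts S \<subseteq> pts S' \<and>
     (\<forall>e\<in>edges (pts S). \<forall>f\<in>edges (pts S). lt S' e f \<longleftrightarrow> lt S e f) \<and>
     (\<forall>x\<in>pts S. \<forall>e\<in>edges (pts S). col S' x e \<longleftrightarrow> col S x e)"
  by (auto simp: sub_csb_def emb_on_def)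

lemma sub_csb_refl: "sub_csb S S"
  by (simp add: sub_csb_iff)

lemma sub_csb_trans: "sub_csb S S' \<Longrightarrow> sub_csb S' S'' \<Longrightarrow> sub_csb S S''"
  using emb_on_comp'[of "pts S" S S' id "pts S'" S'' id] by (auto simp: sub_csb_def)

lemma sub_csb_antisym:
  assumes "sub_csb S S'" "sub_csb S' S" "csb_typed S" "csb_typed S'"
  shows "S = (S' :: 'a csb)"
proof -
  have p: "pts S = pts S'"
    using assms(1,2) by (auto simp: sub_csb_iff)
  have "lt S e f \<longleftrightarrow> lt S' e f" for e f
    using assms p unfolding sub_csb_iff csb_typed_def by metis
  moreover have "col S x e \<longleftrightarrow> col S' x e" for x e
    using assms p unfolding sub_csb_iff csb_typed_def by metis
  ultimately show ?thesis
    using p by (intro csb.equality ext) simp_all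
qed

lemma emb_on_sub_csb: "emb_on X T S h \<Longrightarrow> sub_csb S S' \<Longrightarrow> emb_on X T S' h"
  using emb_on_comp'[of X T S h "pts S" S' id] by (simp add: sub_csb_def emb_on_def)

lemma chain_union_csb:
  assumes ne: "\<C> \<noteq> {}" and csb: "\<And>S. S \<in> \<C> \<Longrightarrow> is_csb S"
    and chain: "\<And>S S'. S \<in> \<C> \<Longrightarrow> S' \<in> \<C> \<Longrightarrow> sub_csb S S' \<or> sub_csb S' S"
  defines "U \<equiv> \<lparr>pts = \<Union> (pts ` \<C>), lt = \<lambda>e f. \<exists>S\<in>\<C>. lt S e f, col = \<lambda>x e. \<exists>S\<in>\<C>. col S x e\<rparr>"
  shows "is_csb U" "\<And>S. S \<in> \<C> \<Longrightarrow> sub_csb S U"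
proof -
  have up: "\<exists>R\<in>\<C>. sub_csb S R \<and> sub_csb S' R" if "S \<in> \<C>" "S' \<in> \<C>" for S S'
    using chain[OF that] that sub_csb_refl by blast
  have lt_up: "lt R e f" if "S \<in> \<C>" "sub_csb S R" "lt S e f" for S R e f
    using that is_csbD(1,2)[OF csb] unfolding sub_csb_iff by blast
  have col_up: "col R x e" if "S \<in> \<C>" "sub_csb S R" "col S x e" for S R x e
    using that is_csbD(3,4)[OF csb] unfolding sub_csb_iff by blast
  show sub: "sub_csb S U" if S: "S \<in> \<C>" for S
  proof -
    have "lt S e f" if "S' \<in> \<C>" "lt S' e f" "e \<in> edges (pts S)" "f \<in> edges (pts S)" for S' e f
      using up[OF S that(1)] lt_up[OF that(1) _ that(2)] that(3,4) unfolding sub_csb_iff by blast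
    moreover have "col S x e" if "S' \<in> \<C>" "col S' x e" "x \<in> pts S" "e \<in> edges (pts S)" for S' x e
      using up[OF S that(1)] col_up[OF that(1) _ that(2)] that(3,4) unfolding sub_csb_iff by blast
    ultimately show ?thesis
      using S unfolding sub_csb_iff U_def by auto
  qed
  show "is_csb U"
    unfolding is_csb_def
  proof (intro conjI allI impI)
    show "csb_typed U"
      unfolding csb_typed_def
    proof (intro conjI allI impI)
      fix e f assume "lt U e f"
      then obtain S where S: "S \<in> \<C>" "lt S e f" by (auto simp: U_def)
      then have "pts S \<subseteq> pts U" by (auto simp: U_def)
      from edges_mono[OF this] is_csbD(1,2)[OF csb[OF S(1)] S(2)]
      show "e \<in> edges (pts U)" "f \<in> edges (pts U)" by blast+
    next
      fix x e assume "col U x e"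
      then obtain S where S: "S \<in> \<C>" "col S x e" by (auto simp: U_def)
      then have "pts S \<subseteq> pts U" by (auto simp: U_def)
      from this edges_mono[OF this] is_csbD(3,4)[OF csb[OF S(1)] S(2)]
      show "x \<in> pts U" "e \<in> edges (pts U)" by blast+
    qed
  next
    fix e f g assume "lt U e f" "lt U f g"
    then obtain S S' where S: "S \<in> \<C>" "S' \<in> \<C>" "lt S e f" "lt S' f g" by (auto simp: U_def)
    obtain R where R: "R \<in> \<C>" "sub_csb S R" "sub_csb S' R"
      using up[OF S(1,2)] by blast
    then have "lt R e g"
      using lt_up S is_csbD(5)[OF csb] by blast
    then show "lt U e g"
      using R(1) by (auto simp: U_def)
  next
    fix x e assume "col U x e"
    then show "x \<notin> e"
      using is_csbD(6)[OF csb] by (auto simp: U_def)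
  next
    fix x e f assume ef: "lt U e f" and x: "x \<in> e \<or> col U x e"
    obtain S where S: "S \<in> \<C>" "lt S e f" using ef by (auto simp: U_def)
    have "\<exists>R\<in>\<C>. col R x f"
      using x
    proof
      assume "x \<in> e"
      then show ?thesis using is_csbD(7)[OF csb S(2)] S(1) by blast
    next
      assume "col U x e"
      then obtain S' where S': "S' \<in> \<C>" "col S' x e" by (auto simp: U_def)
      obtain R where R: "R \<in> \<C>" "sub_csb S R" "sub_csb S' R"
        using up[OF S(1) S'(1)] by blast
      then show ?thesis
        using lt_up col_up S S' is_csbD(8)[OF csb] by blast
    qed
    then show "col U x f" by (simp add: U_def)
  qed
qed

text \<open>
  A point is reserved for every one-point extension problem. In a maximal structure in which the
  reserved points that occur solve their problems, every problem over the structure is solved,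
  since otherwise amalgamation would add the reserved point.
\<close>

lemma rich_extension:
  fixes S0 :: "'u csb"
  assumes inf: "infinite (UNIV :: 'u set)" and S0: "is_csb S0"
  obtains S :: "'u csb" and h where "rich S" "emb_on (pts S0) S0 S h"
proof -
  obtain J :: "'u + 'u list \<times> nat \<Rightarrow> 'u" where J: "inj J"
    using infinite_UNIV_coding[OF inf] by blast
  have J_eq [simp]: "J z = J z' \<longleftrightarrow> z = z'" for z z'
    using J by (simp add: inj_eq)
  define i where "i x = J (Inl x)" for x
  have i: "inj_on i (pts S0)"
    by (auto simp: inj_on_def i_def)
  define S1 where "S1 = pull (i ` pts S0) (inv_into (pts S0) i) S0"
  have S1: "is_csb S1"
    unfolding S1_def using i by (intro is_csb_pull[OF S0]) (auto simp: inj_on_inv_into)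
  have pts1: "pts S1 = i ` pts S0"
    by (simp add: S1_def)
  have emb1: "emb_on (pts S0) S0 S1 i"
  proof -
    have "emb_on (i ` pts S0) S1 S0 (inv_into (pts S0) i)"
      unfolding S1_def using i by (intro emb_on_pull) (auto simp: inj_on_inv_into)
    from emb_on_inv[OF this] have "emb_on (pts S0) S0 S1 (inv_into (i ` pts S0) (inv_into (pts S0) i))"
      using pts1 i by simp
    moreover have "inv_into (i ` pts S0) (inv_into (pts S0) i) x = i x" if "x \<in> pts S0" for x
      using that i by (intro inv_into_f_eq) (auto simp: inj_on_inv_into)
    ultimately show ?thesis
      using emb_on_cong by blast
  qed
  \<comment> \<open>A numbering of all finite structures on natural numbers, hence of all coded
    extension problems.\<close>
  obtain tsk :: "nat \<Rightarrow> nat csb" where tsk: "\<And>T. csb_typed T \<Longrightarrow> finite (pts T) \<Longrightarrow> \<exists>k. tsk k = T"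
  proof -
    let ?Ts = "{T :: nat csb. csb_typed T \<and> finite (pts T)}"
    have "\<exists>k. from_nat_into ?Ts k = T" if "csb_typed T" "finite (pts T)" for T
      using from_nat_into_surj[OF countable_finite_csb] that by auto
    then show thesis by (rule that)
  qed
  define slot where "slot as k = J (Inr (as, k))" for as k
  \<comment> \<open>The new point of a problem over \<open>as\<close> has index
    \<open>length as\<close>, which is why the slot is appended at the end of the tuple.\<close>
  define good where "good S \<longleftrightarrow> is_csb S \<and> sub_csb S1 S \<and>
    (\<forall>as k. slot as k \<in> pts S \<longrightarrow> emb_on {..length as} (tsk k) S (\<lambda>j. (as @ [slot as k]) ! j))" for S
  have "\<exists>m \<in> Collect good. \<forall>S \<in> Collect good. sub_csb m S \<longrightarrow> S = m"
  proof (rule predicate_Zorn)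
    show "partial_order_on (Collect good) (relation_of sub_csb (Collect good))"
      unfolding partial_order_on_def preorder_on_def
    proof (intro conjI)
      show "refl_on (Collect good) (relation_of sub_csb (Collect good))"
        by (auto simp: refl_on_def relation_of_def sub_csb_refl)
      show "trans (relation_of sub_csb (Collect good))"
        by (auto simp: trans_def relation_of_def intro: sub_csb_trans)
      show "antisym (relation_of sub_csb (Collect good))"
        using sub_csb_antisym by (auto simp: antisym_def relation_of_def good_def is_csb_def)
    qed (auto simp: relation_of_def)
  next
    fix \<C> assume ch: "\<C> \<in> Chains (relation_of sub_csb (Collect good))"
    have g: "good S" if "S \<in> \<C>" for S
      using ch that by (auto simp: Chains_def relation_of_def)
    have chain: "sub_csb S S' \<or> sub_csb S' S" if "S \<in> \<C>" "S' \<in> \<C>" for S S'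
      using ch that by (auto simp: Chains_def relation_of_def)
    show "\<exists>u \<in> Collect good. \<forall>a \<in> \<C>. sub_csb a u"
    proof (cases "\<C> = {}")
      case True
      \<comment> \<open>The points of \<open>S1\<close> are codes of the form \<open>Inl\<close>, so
        no slot is present and the last condition is vacuous.\<close>
      have "good S1"
        unfolding good_def using S1 sub_csb_refl by (auto simp: slot_def pts1 i_def)
      with True show ?thesis by blast
    next
      case False
      define U where "U = \<lparr>pts = \<Union> (pts ` \<C>), lt = \<lambda>e f. \<exists>S\<in>\<C>. lt S e f, col = \<lambda>x e. \<exists>S\<in>\<C>. col S x e\<rparr>"
      have csb: "is_csb S" if "S \<in> \<C>" for S
        using g[OF that] by (simp add: good_def)
      note U = chain_union_csb[OF False csb chain, folded U_def]
      have "good U"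
        unfolding good_def
      proof (intro conjI allI impI)
        show "is_csb U" using U(1) .
        show "sub_csb S1 U"
          using False g U(2) sub_csb_trans unfolding good_def by (metis ex_in_conv)
        fix as k assume "slot as k \<in> pts U"
        then obtain S where "S \<in> \<C>" "slot as k \<in> pts S" by (auto simp: U_def)
        then show "emb_on {..length as} (tsk k) U (\<lambda>j. (as @ [slot as k]) ! j)"
          using g emb_on_sub_csb U(2) unfolding good_def by blast
      qed
      then show ?thesis using U(2) by blast
    qed
  qed
  then obtain m where m: "good m" and max: "\<And>S. good S \<Longrightarrow> sub_csb m S \<Longrightarrow> S = m"
    by blast
  have csbm: "is_csb m"
    using m by (simp add: good_def)
  have "rich m"
    unfolding rich_def
  proof (intro conjI allI impI)
    show "is_csb m" using csbm .
  next
    fix n and T :: "nat csb" and a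
    assume "is_csb T \<and> pts T = {..n} \<and> emb_on {..<n} T m a"
    then have T: "is_csb T" "pts T = {..n}" and a: "emb_on {..<n} T m a" by simp_all
    obtain k where k: "tsk k = T"
      using tsk[of T] T by (auto simp: is_csb_def)
    define as where "as = map a [0..<n]"
    define z where "z = slot as k"
    have len: "length as = n"
      by (simp add: as_def)
    have a': "(a(n := z)) j = (as @ [z]) ! j" if "j \<in> {..n}" for j
      using that by (cases "j = n") (simp_all add: as_def nth_append)
    have slot_emb: "emb_on {..n} T S (a(n := z)) \<longleftrightarrow> emb_on {..length as} (tsk k) S (\<lambda>j. (as @ [z]) ! j)" for S
      unfolding k len using a' by (rule emb_on_cong)
    have "z \<in> pts m"
    proof (rule ccontr)
      assume z: "z \<notin> pts m"
      let ?A = "a ` {..<n}"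
      note inj = emb_onD(1)[OF a]
      have A: "?A \<subseteq> pts m" "z \<notin> ?A"
        using a z by (auto simp: emb_on_def)
      have injz: "inj_on (a(n := z)) {..n}" and img: "(a(n := z)) ` {..n} = insert z ?A"
        using inj A(2) by (auto simp: inj_on_def image_iff atMost_Suc lessThan_Suc_atMost[symmetric] lessThan_Suc)
      define g where "g = inv_into {..n} (a(n := z))"
      have g: "inj_on g (insert z ?A)" "g ` insert z ?A = {..n}"
        unfolding g_def img[symmetric] using injz by (simp_all only: inj_on_inv_into subset_refl inv_into_image_cancel)
      \<comment> \<open>The problem \<open>T\<close> with its old points renamed to their values
        under \<open>a\<close> and its new point renamed to the slot \<open>z\<close>.\<close>
      define B where "B = pull (insert z ?A) g T"
      have B: "is_csb B" "pts B = insert z ?A" "emb_on (insert z ?A) B T g"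
        unfolding B_def using is_csb_pull[OF T(1) g(1)] emb_on_pull[OF g(1), of T]
        by (simp_all only: g(2) T(2) subset_refl pts_pull)
      have int: "pts m \<inter> pts B = ?A"
        using A z B(2) by auto
      have "emb_on ?A B m (a \<circ> g)"
      proof (rule emb_on_comp'[OF emb_on_subset[OF B(3)] a])
        show "g ` ?A \<subseteq> {..<n}"
        proof
          fix j assume "j \<in> g ` ?A"
          then obtain l where l: "l < n" "j = g (a l)" by blast
          then have "j = l"
            unfolding g_def using inv_into_f_eq[OF injz, of l "a l"] by simp
          with l show "j \<in> {..<n}" by simp
        qed
      qed auto
      moreover have "(a \<circ> g) x = id x" if "x \<in> ?A" for x
      proof -
        obtain l where l: "l < n" "x = a l" using \<open>x \<in> ?A\<close> by blast
        then have "g x = l"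
          unfolding g_def using inv_into_f_eq[OF injz, of l "a l"] by simp
        with l show ?thesis by simp
      qed
      ultimately have Bm: "emb_on ?A B m id"
        using emb_on_cong by blast
      then have "emb_on (pts m \<inter> pts B) m B id"
        unfolding int by (auto simp: emb_on_def B(2))
      note am = amalgamation[OF csbm B(1) this]
      let ?C = "amalg m B"
      have ptsC: "pts ?C = insert z (pts m)"
        using A by (auto simp: amalg_def B(2))
      have sub: "sub_csb m ?C"
        using am(2) ptsC by (auto simp: sub_csb_def)
      have zC: "emb_on {..n} T ?C (a(n := z))"
      proof -
        have "emb_on {..n} T B (a(n := z))"
        proof -
          have "emb_on {..n} T B (inv_into (insert z ?A) g)"
            using emb_on_inv[OF B(3)] g(2) B(2) by simp
          moreover have "inv_into (insert z ?A) g j = (a(n := z)) j" if "j \<in> {..n}" for j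
          proof (rule inv_into_f_eq[OF g(1)])
            show "(a(n := z)) j \<in> insert z ?A"
              using img that by blast
            show "g ((a(n := z)) j) = j"
              unfolding g_def using inv_into_f_f[OF injz that] .
          qed
          ultimately show ?thesis
            using emb_on_cong by blast
        qed
        moreover have "sub_csb B ?C"
          using am(3) by (auto simp: sub_csb_def amalg_def)
        ultimately show ?thesis
          by (rule emb_on_sub_csb)
      qed
      have "good ?C"
        unfolding good_def
      proof (intro conjI allI impI)
        show "is_csb ?C" using am(1) .
        show "sub_csb S1 ?C"
          using m sub sub_csb_trans unfolding good_def by blast
        fix bs l assume "slot bs l \<in> pts ?C"
        then consider "slot bs l \<in> pts m" | "slot bs l = z"
          using ptsC by blast
        then show "emb_on {..length bs} (tsk l) ?C (\<lambda>j. (bs @ [slot bs l]) ! j)"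
        proof cases
          case 1
          then show ?thesis using m sub emb_on_sub_csb unfolding good_def by blast
        next
          case 2
          \<comment> \<open>Since \<open>J\<close> is injective, the added point is the slot of the
            present problem only, and just that condition has to be checked anew.\<close>
          then have "bs = as" "l = k" by (simp_all add: z_def slot_def)
          then show ?thesis using zC slot_emb 2 by simp
        qed
      qed
      then have "?C = m"
        using max sub by blast
      then show False
        using ptsC z by auto
    qed
    then have "emb_on {..n} T m (a(n := z))"
      using m slot_emb unfolding good_def z_def by blast
    then show "\<exists>b. emb_on {..n} T m (a(n := b))"
      by blast
  qed
  moreover have "emb_on (pts S0) S0 m i"
    using emb_on_sub_csb[OF emb1] m by (simp add: good_def)
  ultimately show thesis
    by (rule that)
qed

section \<open>Pairs of points over a finite set\<close>

text \<open>In a rich structure this is equality of complete types over \<open>A\<close>, by the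
  back-and-forth argument \<open>emb_sat\<close>.\<close>

definition tp_eq :: "'a csb \<Rightarrow> 'a set \<Rightarrow> 'a list \<Rightarrow> 'a list \<Rightarrow> bool" where
  "tp_eq S A bs ds \<longleftrightarrow> (\<exists>h. emb_on (A \<union> set bs) S S h \<and> (\<forall>a\<in>A. h a = a) \<and> map h bs = ds)"

lemma tp_eq_sym:
  assumes "tp_eq S A bs ds" "A \<union> set bs \<subseteq> pts S"
  shows "tp_eq S A ds bs"
proof -
  obtain h where h: "emb_on (A \<union> set bs) S S h" "\<forall>a\<in>A. h a = a" "map h bs = ds"
    using assms(1) by (auto simp: tp_eq_def)
  let ?k = "inv_into (A \<union> set bs) h"
  note inj = emb_onD(1)[OF h(1)]
  have "h ` (A \<union> set bs) = A \<union> set ds"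
    using h(2,3) by (auto simp: image_Un image_iff)
  then have "emb_on (A \<union> set ds) S S ?k"
    using emb_on_inv[OF h(1) assms(2)] by simp
  moreover have "\<forall>a\<in>A. ?k a = a"
    using h(2) inv_into_f_f[OF inj] by (metis UnI1)
  moreover have "map ?k ds = bs"
    using inv_into_f_f[OF inj] by (auto simp flip: h(3) intro!: map_idI)
  ultimately show ?thesis
    by (auto simp: tp_eq_def)
qed

lemma tp_eq_trans:
  assumes "tp_eq S A bs cs" "tp_eq S A cs ds"
  shows "tp_eq S A bs ds"
proof -
  obtain h k where h: "emb_on (A \<union> set bs) S S h" "\<forall>a\<in>A. h a = a" "map h bs = cs"
    and k: "emb_on (A \<union> set cs) S S k" "\<forall>a\<in>A. k a = a" "map k cs = ds"
    using assms by (auto simp: tp_eq_def)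
  have "h ` (A \<union> set bs) \<subseteq> A \<union> set cs"
    using h(2,3) by (auto simp: image_Un)
  then have "emb_on (A \<union> set bs) S S (k \<circ> h)"
    using emb_on_comp'[OF h(1) k(1)] by blast
  then show ?thesis
    using h(2,3) k(2,3) unfolding tp_eq_def by (intro exI[of _ "k \<circ> h"]) auto
qed

lemma tp_eq_pairD:
  assumes "tp_eq S A [b, b'] [d, d']"
  shows "tp_eq S A [b] [d]" "tp_eq S A [b'] [d']"
proof -
  obtain h where h: "emb_on (A \<union> {b, b'}) S S h" "\<forall>a\<in>A. h a = a" "h b = d" "h b' = d'"
    using assms by (auto simp: tp_eq_def)
  have "emb_on (A \<union> {b}) S S h" "emb_on (A \<union> {b'}) S S h"
    using emb_on_subset[OF h(1)] by auto
  with h(2-4) show "tp_eq S A [b] [d]" "tp_eq S A [b'] [d']"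
    by (auto simp: tp_eq_def)
qed

lemma tp_eq_lt:
  assumes "tp_eq S A [b, b'] [d, d']" "a \<in> A" "a' \<in> A" "b \<notin> A" "b' \<notin> A"
  shows "lt S {a, b} {a', b'} \<longleftrightarrow> lt S {a, d} {a', d'}" "lt S {a, b'} {a', b} \<longleftrightarrow> lt S {a, d'} {a', d}"
proof -
  obtain h where h: "emb_on (A \<union> {b, b'}) S S h" "\<forall>a\<in>A. h a = a" "h b = d" "h b' = d'"
    using assms(1) by (auto simp: tp_eq_def)
  have "{x, b} \<in> edges (A \<union> {b, b'})" "{x, b'} \<in> edges (A \<union> {b, b'})" if "x \<in> A" for x
    using that assms(4,5) by (auto simp: doubleton_in_edges)
  then show "lt S {a, b} {a', b'} \<longleftrightarrow> lt S {a, d} {a', d'}" "lt S {a, b'} {a', b} \<longleftrightarrow> lt S {a, d'} {a', d}"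
    using emb_onD(3)[OF h(1), of "{a, b}" "{a', b'}"] emb_onD(3)[OF h(1), of "{a, b'}" "{a', b}"]
      assms(2,3) h(2-4) by simp_all
qed

lemma tp_eq_single:
  assumes "tp_eq S A [b] [d]" "a \<in> A" "a' \<in> A" "b \<notin> A" "g \<in> edges A"
  shows "lt S {a, b} g \<longleftrightarrow> lt S {a, d} g" "lt S g {a, b} \<longleftrightarrow> lt S g {a, d}"
    "col S b g \<longleftrightarrow> col S d g" "col S a' {a, b} \<longleftrightarrow> col S a' {a, d}"
proof -
  obtain h where h: "emb_on (insert b A) S S h" "\<forall>a\<in>A. h a = a" "h b = d"
    using assms(1) by (auto simp: tp_eq_def)
  have 1: "{a, b} \<in> edges (insert b A)" "g \<in> edges (insert b A)"
    using assms(2,4,5) edges_mono[of A "insert b A"] by (auto simp: doubleton_in_edges)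
  have "h ` g = g"
    using edges_subset[OF assms(5)] h(2) by (force simp: image_iff)
  then show "lt S {a, b} g \<longleftrightarrow> lt S {a, d} g" "lt S g {a, b} \<longleftrightarrow> lt S g {a, d}"
    "col S b g \<longleftrightarrow> col S d g" "col S a' {a, b} \<longleftrightarrow> col S a' {a, d}"
    using emb_onD(3)[OF h(1) 1] emb_onD(3)[OF h(1) 1(2,1)] emb_onD(4)[OF h(1) _ 1(2), of b]
      emb_onD(4)[OF h(1) _ 1(1), of a'] h(2,3) assms(2,3) by simp_all
qed

lemma edges_insertE:
  assumes "e \<in> edges (insert c A)"
  obtains "e \<in> edges A" | a where "a \<in> A" "e = {a, c}"
proof -
  obtain x y where "e = {x, y}" "x \<in> insert c A" "y \<in> insert c A" "x \<noteq> y"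
    using assms by (rule edgesE)
  then consider "e \<in> edges A" | a where "a \<in> A" "e = {a, c}"
    by (auto simp: doubleton_in_edges insert_commute)
  then show thesis
    using that by cases
qed

text \<open>Counting predecessors gives the rank. It will serve as a counter that every further step
  of a path must raise, and \<open>card A\<close> is where it stops.\<close>

lemma finite_strict_order_rank:
  fixes A :: "'a set"
  assumes fin: "finite A" and irr: "\<And>a. a \<in> A \<Longrightarrow> \<not> r a a"
    and trans: "\<And>a b c. a \<in> A \<Longrightarrow> b \<in> A \<Longrightarrow> c \<in> A \<Longrightarrow> r a b \<Longrightarrow> r b c \<Longrightarrow> r a c"
  obtains d :: "'a \<Rightarrow> nat" where "\<And>a. a \<in> A \<Longrightarrow> d a \<le> card A"
    "\<And>a b. a \<in> A \<Longrightarrow> b \<in> A \<Longrightarrow> r a b \<Longrightarrow> d a < d b"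
proof -
  define d where "d a = card {x \<in> A. r x a}" for a
  have "d a \<le> card A" for a
    unfolding d_def using fin by (auto intro: card_mono)
  moreover have "d a < d b" if ab: "a \<in> A" "b \<in> A" "r a b" for a b
  proof -
    have "{x \<in> A. r x a} \<subset> {x \<in> A. r x b}"
    proof
      show "{x \<in> A. r x a} \<subseteq> {x \<in> A. r x b}"
        using ab trans by blast
      show "{x \<in> A. r x a} \<noteq> {x \<in> A. r x b}"
        using ab irr by blast
    qed
    then show ?thesis
      unfolding d_def using fin by (intro psubset_card_mono) auto
  qed
  ultimately show thesis
    using that by blast
qed

text \<open>
  Along a path \<open>c\<^sub>0, c\<^sub>1, \<dots>\<close> in which consecutive pairs have the type of \<open>(b0, b1)\<close> and every step is
  taken freely, a relation between the edges \<open>{a, c\<^sub>0}\<close> and \<open>{a', c\<^sub>k}\<close> needs a chain of length \<open>k\<close> in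
  a strict order on the finite set \<open>A\<close>. So for large \<open>k\<close> the pair \<open>(c\<^sub>0, c\<^sub>k)\<close> has the same type as
  \<open>(c\<^sub>k, c\<^sub>0)\<close>.
\<close>

lemma no_invariant_strict_order:
  assumes S: "rich S" and A: "finite A" "A \<subseteq> pts S"
    and b: "b0 \<in> pts S - A" "b1 \<in> pts S - A" "b2 \<in> pts S - A" "b0 \<noteq> b1"
    and tp02: "tp_eq S A [b0, b1] [b0, b2]" and tp12: "tp_eq S A [b0, b1] [b1, b2]"
    and Q_trans: "\<And>x y z. Q x y \<Longrightarrow> Q y z \<Longrightarrow> Q x z"
    and Q_irrefl: "\<And>x. \<not> Q x x"
    and Q_inv: "\<And>x y x' y'. {x, y} \<subseteq> pts S \<Longrightarrow> tp_eq S A [x, y] [x', y'] \<Longrightarrow> Q x y \<Longrightarrow> Q x' y'"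
  shows "\<not> Q b0 b1"
proof
  assume Qb: "Q b0 b1"
  note cS = is_csbD[OF rich_csb[OF S]]
  have bA: "b0 \<notin> A" "b1 \<notin> A" "b2 \<notin> A"
    using b by auto
  \<comment> \<open>\<open>r0\<close> and \<open>r1\<close> record the comparisons between an edge
    from \<open>A\<close> to one point of the pair and an edge from \<open>A\<close> to the other,
    in the two directions.\<close>
  define r0 where "r0 a a' \<longleftrightarrow> lt S {a, b0} {a', b1}" for a a'
  define r1 where "r1 a a' \<longleftrightarrow> lt S {a, b1} {a', b0}" for a a'
  have irr: "\<not> r0 a a" "\<not> r1 a a" for a
    using cS(9)[of "{a, b0}" "{a, b1}" a] cS(9)[of "{a, b1}" "{a, b0}" a] by (auto simp: r0_def r1_def)
  have pair: "lt S {a, x} {a', y} \<longleftrightarrow> r0 a a'" "lt S {a, y} {a', x} \<longleftrightarrow> r1 a a'"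
    if "tp_eq S A [b0, b1] [x, y]" "a \<in> A" "a' \<in> A" for a a' x y
    using tp_eq_lt[OF that bA(1,2)] by (simp_all add: r0_def r1_def)
  \<comment> \<open>The third point enters here: the second comparison is moved to the pair
    \<open>b1\<close>, \<open>b2\<close>, the two are composed, and the result is read at
    \<open>b0\<close>, \<open>b2\<close>, which again has the type of \<open>b0\<close>,
    \<open>b1\<close>.\<close>
  have "r0 a a''" if a: "a \<in> A" "a' \<in> A" "a'' \<in> A" "r0 a a'" "r0 a' a''" for a a' a''
  proof -
    have "lt S {a, b0} {a', b1}" "lt S {a', b1} {a'', b2}"
      using a pair(1)[OF tp12] by (simp_all add: r0_def)
    then show ?thesis
      using cS(5) pair(1)[OF tp02 a(1,3)] by blast
  qed
  with irr(1) obtain d0 where d0: "\<And>a. a \<in> A \<Longrightarrow> d0 a \<le> card A"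
    "\<And>a a'. a \<in> A \<Longrightarrow> a' \<in> A \<Longrightarrow> r0 a a' \<Longrightarrow> d0 a < d0 a'"
    using finite_strict_order_rank[OF A(1), of r0] by blast
  have "r1 a a''" if a: "a \<in> A" "a' \<in> A" "a'' \<in> A" "r1 a a'" "r1 a' a''" for a a' a''
  proof -
    have "lt S {a, b2} {a', b1}" "lt S {a', b1} {a'', b0}"
      using a pair(2)[OF tp12] by (simp_all add: r1_def)
    then show ?thesis
      using cS(5) pair(2)[OF tp02 a(1,3)] by blast
  qed
  with irr(2) obtain d1 where d1: "\<And>a. a \<in> A \<Longrightarrow> d1 a \<le> card A"
    "\<And>a a'. a \<in> A \<Longrightarrow> a' \<in> A \<Longrightarrow> r1 a a' \<Longrightarrow> d1 a < d1 a'"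
    using finite_strict_order_rank[OF A(1), of r1] by blast
  \<comment> \<open>\<open>G a\<close> is the part of a colour at an edge from \<open>a\<close> to
    an end of the path that an edge inside \<open>A\<close> forces. It depends only on the type of
    \<open>b0\<close> over \<open>A\<close>, so it treats both ends alike.\<close>
  define G where "G a \<longleftrightarrow> (\<exists>g\<in>edges A. col S b0 g \<and> lt S g {a, b0})" for a
  have tp1: "tp_eq S A [b0] [b1]"
    using tp_eq_pairD(1)[OF tp12] .
  have single: "lt S {a, c} g \<longleftrightarrow> lt S {a, b0} g" "lt S g {a, c} \<longleftrightarrow> lt S g {a, b0}"
    "col S c g \<longleftrightarrow> col S b0 g" if "tp_eq S A [b0] [c]" "a \<in> A" "g \<in> edges A" for a c g
    using tp_eq_single[OF that(1,2,2) bA(1) that(3)] by simp_all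
  \<comment> \<open>All points of the path have the type of \<open>b0\<close>, so a comparison
    passing through an edge of \<open>A\<close> would put one edge through \<open>b0\<close> below
    another, against the Switchboard Axiom.\<close>
  have between: False if "g \<in> edges A" "lt S {a, b0} g" "lt S g {a', b0}" for a a' g
    using that cS(5) cS(9)[of "{a, b0}" "{a', b0}" b0] by blast
  \<comment> \<open>Kept apart from \<open>inv\<close>: the edge between \<open>b0\<close> and
    \<open>b1\<close> may be related to \<open>A\<close>, and it is a free step that isolates the
    edge between the ends.\<close>
  define isol where "isol c c' \<longleftrightarrow>
    (\<forall>g\<in>edges A. \<not> lt S {c, c'} g \<and> \<not> lt S g {c, c'}) \<and> (\<forall>a\<in>A. \<not> col S a {c, c'})" for c c'
  \<comment> \<open>\<open>k\<close> is the number of steps of the path. A comparison across the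
    path must raise the rank by \<open>k\<close>; a colour must come from \<open>A\<close> or from a
    chain of nearly that length. For \<open>k = 1\<close> the \<open>+ 1\<close> makes the colour
    clauses trivial.\<close>
  define inv where "inv k c c' \<longleftrightarrow> c \<in> pts S - A \<and> c' \<in> pts S - A \<and> c \<noteq> c' \<and>
    tp_eq S A [b0] [c] \<and> tp_eq S A [b0] [c'] \<and> Q c c' \<and>
    (\<forall>a\<in>A. \<forall>a'\<in>A. lt S {a, c} {a', c'} \<longrightarrow> d0 a + k \<le> d0 a') \<and>
    (\<forall>a\<in>A. \<forall>a'\<in>A. lt S {a, c'} {a', c} \<longrightarrow> d1 a + k \<le> d1 a') \<and>
    (\<forall>a\<in>A. col S c {a, c'} \<longrightarrow> G a \<or> k \<le> d0 a + 1) \<and>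
    (\<forall>a\<in>A. col S c' {a, c} \<longrightarrow> G a \<or> k \<le> d1 a + 1)" for k c c'
  have refl: "tp_eq S A [b0] [b0]"
    using emb_on_id[of "insert b0 A" S] A b by (auto simp: tp_eq_def)
  have inv1: "inv 1 b0 b1"
    unfolding inv_def using b refl tp1 Qb d0(2) d1(2) by (auto simp: r0_def r1_def Suc_le_eq)
  have step: "\<exists>c''. inv (Suc k) c c'' \<and> isol c c''" if "inv k c c'" for k c c'
  proof -
    have c: "c \<in> pts S" "c \<notin> A" "c' \<in> pts S" "c' \<notin> A" "c \<noteq> c'"
      and tpc: "tp_eq S A [b0] [c]" "tp_eq S A [b0] [c']" and Qc: "Q c c'"
      and I1: "\<And>a a'. a \<in> A \<Longrightarrow> a' \<in> A \<Longrightarrow> lt S {a, c} {a', c'} \<Longrightarrow> d0 a + k \<le> d0 a'"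
      and I2: "\<And>a a'. a \<in> A \<Longrightarrow> a' \<in> A \<Longrightarrow> lt S {a, c'} {a', c} \<Longrightarrow> d1 a + k \<le> d1 a'"
      and I3: "\<And>a. a \<in> A \<Longrightarrow> col S c {a, c'} \<Longrightarrow> G a \<or> k \<le> d0 a + 1"
      using that unfolding inv_def by blast+
    let ?X = "insert c (insert c' A)" and ?Y = "insert c' A"
    have "tp_eq S A [c'] [b0]"
      using tp_eq_sym[OF tpc(2)] A b by auto
    then obtain h where h: "emb_on ?Y S S h" "\<forall>a\<in>A. h a = a" "h c' = b0"
      by (auto simp: tp_eq_def)
    have X: "finite ?X" "?X \<subseteq> pts S" "?Y \<subseteq> ?X"
      using A c by auto
    have "h ` ?Y = insert b0 A"
      using h(2,3) by auto
    then have "b1 \<notin> h ` ?Y"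
      using b by auto
    \<comment> \<open>The path is prolonged: \<open>c''\<close> lies over \<open>c'\<close> as
      \<open>b1\<close> lies over \<open>b0\<close>, and it is free from \<open>c\<close> over
      \<open>A\<close> and \<open>c'\<close>.\<close>
    then obtain c'' where c'': "c'' \<in> pts S" "c'' \<notin> ?X" "emb_on (insert c'' ?Y) S S (h(c'' := b1))"
      and lt_free: "\<And>e f. e \<in> edges (insert c'' ?X) \<Longrightarrow> f \<in> edges (insert c'' ?X) \<Longrightarrow> lt S e f \<Longrightarrow>
         e \<in> edges ?X \<and> f \<in> edges ?X \<or> e \<in> edges (insert c'' ?Y) \<and> f \<in> edges (insert c'' ?Y) \<or>
         (\<exists>g\<in>edges ?Y. lt S e g \<and> lt S g f \<and>
           (e \<in> edges ?X \<and> f \<in> edges (insert c'' ?Y) \<or> e \<in> edges (insert c'' ?Y) \<and> f \<in> edges ?X))"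
      and col_free: "\<And>x e. x \<in> insert c'' ?X \<Longrightarrow> e \<in> edges (insert c'' ?X) \<Longrightarrow> col S x e \<Longrightarrow>
         x \<in> ?X \<and> e \<in> edges ?X \<or> x \<in> insert c'' ?Y \<and> e \<in> edges (insert c'' ?Y) \<or>
         (\<exists>g\<in>edges ?Y. col S x g \<and> lt S g e \<and>
           (x \<in> ?X \<and> e \<in> edges (insert c'' ?Y) \<or> x \<in> insert c'' ?Y \<and> e \<in> edges ?X))"
      using free_ext[OF S X h(1), of b1] b by blast
    have ne: "c'' \<noteq> c" "c'' \<noteq> c'" "c'' \<notin> A"
      using c''(2) by auto
    have "tp_eq S A [c', c''] [b0, b1]"
      unfolding tp_eq_def using c''(3) h(2,3) ne
      by (intro exI[of _ "h(c'' := b1)"]) (auto simp: insert_commute)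
    then have tp: "tp_eq S A [b0, b1] [c', c'']"
      using tp_eq_sym[of S A "[c', c'']"] A c c'' by auto
    then have tpc'': "tp_eq S A [b0] [c'']"
      using tp_eq_trans[OF tp1 tp_eq_pairD(2)] by blast
    have "Q c' c''"
      using Q_inv[OF _ tp Qb] b by auto
    then have Qc'': "Q c c''"
      using Q_trans Qc by blast
    have edge: "{a, c} \<in> edges ?X" "{a, c'} \<in> edges ?X" "{a, c''} \<in> edges (insert c'' ?X)"
      "{a, c} \<in> edges (insert c'' ?X)"
      "{a, c} \<notin> edges (insert c'' ?Y)" "{a, c''} \<notin> edges ?X" if "a \<in> A" for a
      using that c ne by (auto simp: doubleton_in_edges)
    \<comment> \<open>The two edges lie on different sides of the free extension, so an edge of
      \<open>insert c' A\<close> mediates. Inside \<open>A\<close> this is excluded by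
      \<open>between\<close>; through \<open>c'\<close> it adds one step of \<open>r0\<close> to the
      bound already known.\<close>
    have J1: "d0 a + Suc k \<le> d0 a'" if a: "a \<in> A" "a' \<in> A" "lt S {a, c} {a', c''}" for a a'
    proof -
      obtain g where g: "g \<in> edges ?Y" "lt S {a, c} g" "lt S g {a', c''}"
        using lt_free[OF _ _ a(3)] edge a(1,2) by blast
      from g(1) show ?thesis
      proof (cases rule: edges_insertE)
        case 1
        then show ?thesis
          using g(2,3) single[OF tpc(1) a(1)] single[OF tpc'' a(2)] between by blast
      next
        case (2 a1)
        then have "d0 a + k \<le> d0 a1" "r0 a1 a'"
          using g(2,3) I1[OF a(1)] pair(1)[OF tp _ a(2)] by simp_all
        then show ?thesis
          using d0(2)[OF \<open>a1 \<in> A\<close> a(2)] by simp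
      qed
    qed
    have J2: "d1 a + Suc k \<le> d1 a'" if a: "a \<in> A" "a' \<in> A" "lt S {a, c''} {a', c}" for a a'
    proof -
      obtain g where g: "g \<in> edges ?Y" "lt S {a, c''} g" "lt S g {a', c}"
        using lt_free[OF _ _ a(3)] edge a(1,2) by blast
      from g(1) show ?thesis
      proof (cases rule: edges_insertE)
        case 1
        then show ?thesis
          using g(2,3) single[OF tpc'' a(1)] single[OF tpc(1) a(2)] between by blast
      next
        case (2 a1)
        then have "d1 a1 + k \<le> d1 a'" "r1 a a1"
          using g(2,3) I2[OF _ a(2)] pair(2)[OF tp a(1)] by simp_all
        then show ?thesis
          using d1(2)[OF a(1) \<open>a1 \<in> A\<close>] by simp
      qed
    qed
    \<comment> \<open>A mediating edge inside \<open>A\<close> gives \<open>G a\<close>. For a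
      mediating edge \<open>{a1, c'}\<close>, either \<open>G a1\<close> is passed on to
      \<open>a\<close>, or the step from \<open>a1\<close> to \<open>a\<close> raises the
      rank.\<close>
    have J3: "G a \<or> Suc k \<le> d0 a + 1" if a: "a \<in> A" "col S c {a, c''}" for a
    proof -
      obtain g where g: "g \<in> edges ?Y" "col S c g" "lt S g {a, c''}"
        using col_free[OF _ _ a(2)] edge a(1) c ne by blast
      from g(1) show ?thesis
      proof (cases rule: edges_insertE)
        case 1
        then have "G a"
          unfolding G_def using g(2,3) single(3)[OF tpc(1) a(1)] single(2)[OF tpc'' a(1)] by blast
        then show ?thesis ..
      next
        case (2 a1)
        then have r: "r0 a1 a"
          using g(3) pair(1)[OF tp _ a(1)] by simp
        have "G a1 \<or> k \<le> d0 a1 + 1"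
          using I3 2 g(2) by simp
        then show ?thesis
        proof
          assume "G a1"
          then obtain g' where g': "g' \<in> edges A" "col S b0 g'" "lt S g' {a1, b0}"
            by (auto simp: G_def)
          then have "lt S g' {a, c''}"
            using single(2)[OF tpc(2) 2(1)] g(3) 2(2) cS(5) by blast
          then have "G a"
            unfolding G_def using g' single(2)[OF tpc'' a(1)] by blast
          then show ?thesis ..
        next
          assume "k \<le> d0 a1 + 1"
          then show ?thesis
            using d0(2)[OF 2(1) a(1) r] by simp
        qed
      qed
    qed
    have J4: "G a \<or> Suc k \<le> d1 a + 1" if a: "a \<in> A" "col S c'' {a, c}" for a
    proof -
      obtain g where g: "g \<in> edges ?Y" "col S c'' g" "lt S g {a, c}"
        using col_free[OF _ _ a(2)] edge a(1) c''(2) by blast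
      from g(1) show ?thesis
      proof (cases rule: edges_insertE)
        case 1
        then have "G a"
          unfolding G_def using g(2,3) single(3)[OF tpc'' a(1)] single(2)[OF tpc(1) a(1)] by blast
        then show ?thesis ..
      next
        \<comment> \<open>Here \<open>{a1, c'}\<close> is below \<open>{a, c}\<close>, so the order
          bound \<open>I2\<close> already gives \<open>k \<le> d1 a\<close>.\<close>
        case (2 a1)
        then show ?thesis
          using I2[OF 2(1) a(1)] g(3) by simp
      qed
    qed
    have cc: "{c, c''} \<in> edges (insert c'' ?X)" "{c, c''} \<notin> edges ?X" "{c, c''} \<notin> edges (insert c'' ?Y)"
      using c ne by (auto simp: doubleton_in_edges)
    have nlt: "\<not> lt S {c, c''} g \<and> \<not> lt S g {c, c''}" if "g \<in> edges (insert c'' ?X)" for g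
      using lt_free[OF that cc(1)] lt_free[OF cc(1) that] cc(2,3) by blast
    have "\<not> col S a {c, c''}" if "a \<in> A" for a
      using col_free[OF _ cc(1), of a] cc(2,3) that by blast
    moreover have "edges A \<subseteq> edges (insert c'' ?X)"
      by (intro edges_mono) auto
    ultimately have "isol c c''"
      unfolding isol_def using nlt by blast
    moreover have "inv (Suc k) c c''"
      unfolding inv_def using J1 J2 J3 J4 c c''(1) ne tpc(1) tpc'' Qc'' by blast
    ultimately show ?thesis
      by blast
  qed
  have "\<exists>c c'. inv (Suc (Suc k)) c c' \<and> isol c c'" for k
  proof (induction k)
    case 0
    then show ?case using step[OF inv1] by auto
  next
    case (Suc k)
    then show ?case using step by blast
  qed
  \<comment> \<open>Ranks are at most \<open>card A\<close>, so at this value every rank clause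
    fails. The second \<open>Suc\<close> compensates for the \<open>+ 1\<close> in the colour
    clauses.\<close>
  then obtain c c' where inv: "inv (Suc (Suc (card A))) c c'" and isol: "isol c c'"
    by blast
  have c: "c \<in> pts S" "c \<notin> A" "c' \<in> pts S" "c' \<notin> A" "c \<noteq> c'"
    and tpc: "tp_eq S A [b0] [c]" "tp_eq S A [b0] [c']" and Qc: "Q c c'"
    using inv unfolding inv_def by blast+
  have I1: "\<not> lt S {a, c} {a', c'}" "\<not> lt S {a, c'} {a', c}" if "a \<in> A" "a' \<in> A" for a a'
    using inv that d0(1)[OF that(2)] d1(1)[OF that(2)] unfolding inv_def by fastforce+
  have I2: "col S c {a, c'} \<Longrightarrow> G a" "col S c' {a, c} \<Longrightarrow> G a" if "a \<in> A" for a
    using inv that d0(1)[OF that] d1(1)[OF that] unfolding inv_def by fastforce+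
  \<comment> \<open>The converse of \<open>I2\<close>: colours between one end and the edges of the
    other are now governed by \<open>G\<close> alone, which does not distinguish the ends.\<close>
  have I3: "col S c {a, c'}" "col S c' {a, c}" if a: "a \<in> A" "G a" for a
  proof -
    obtain g where g: "g \<in> edges A" "col S b0 g" "lt S g {a, b0}"
      using a(2) by (auto simp: G_def)
    then show "col S c {a, c'}" "col S c' {a, c}"
      using single(2,3)[OF tpc(1) a(1) g(1)] single(2,3)[OF tpc(2) a(1) g(1)] cS(8) by blast+
  qed
  \<comment> \<open>Exchanging the ends preserves everything: relations of one end with
    \<open>A\<close> agree by equality of types, comparisons between edges to different ends are
    absent, colours across are given by \<open>G\<close>, and the edge between the ends is
    isolated.\<close>
  define s where "s x = (if x = c then c' else if x = c' then c else x)" for x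
  let ?X = "insert c (insert c' A)"
  have s_simps [simp]: "s c = c'" "s c' = c" "s (s x) = x" for x
    by (auto simp: s_def)
  have sA: "s a = a" if "a \<in> A" for a
    using that c by (auto simp: s_def)
  have ss: "s ` s ` e = e" for e
    by (simp add: image_image)
  have s_edge: "s ` g = g" if "g \<in> edges A" for g
    using edges_subset[OF that] sA by (force simp: image_iff)
  have inj: "inj_on s X" for X
    by (rule inj_on_inverseI[of _ s]) simp
  have sX: "s ` ?X = ?X"
    using sA by (auto simp: image_iff)
  have s_edges: "s ` e \<in> edges ?X" if "e \<in> edges ?X" for e
    using edges_image[OF inj that] unfolding sX .
  have edge_cases: "e \<in> edges A \<or> (\<exists>a\<in>A. e = {a, c}) \<or> (\<exists>a\<in>A. e = {a, c'}) \<or> e = {c, c'}"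
    if e: "e \<in> edges ?X" for e
    using e
  proof (cases rule: edges_insertE)
    case 1
    then show ?thesis by (cases rule: edges_insertE) auto
  next
    case (2 a)
    then show ?thesis using e by (auto simp: insert_commute)
  qed
  have lt1: "lt S (s ` e) (s ` f)" if ef: "e \<in> edges ?X" "f \<in> edges ?X" "lt S e f" for e f
  proof -
    have disj: "e \<inter> f = {}"
      using cS(9)[OF ef(3)] by blast
    from edge_cases[OF ef(1)] edge_cases[OF ef(2)] show ?thesis
    proof (elim disjE bexE)
      assume "e \<in> edges A" "f \<in> edges A"
      then show ?thesis using ef(3) s_edge by simp
    next
      fix a assume "e \<in> edges A" "a \<in> A" "f = {a, c}"
      then show ?thesis using ef(3) s_edge sA single(2)[OF tpc(1)] single(2)[OF tpc(2)] by simp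
    next
      fix a assume "e \<in> edges A" "a \<in> A" "f = {a, c'}"
      then show ?thesis using ef(3) s_edge sA single(2)[OF tpc(1)] single(2)[OF tpc(2)] by simp
    next
      fix a assume "f \<in> edges A" "a \<in> A" "e = {a, c}"
      then show ?thesis using ef(3) s_edge sA single(1)[OF tpc(1)] single(1)[OF tpc(2)] by simp
    next
      fix a assume "f \<in> edges A" "a \<in> A" "e = {a, c'}"
      then show ?thesis using ef(3) s_edge sA single(1)[OF tpc(1)] single(1)[OF tpc(2)] by simp
    qed (use ef(3) isol I1 disj in \<open>auto simp: isol_def\<close>)
  qed
  have col1: "col S (s x) (s ` e)" if xe: "x \<in> ?X" "e \<in> edges ?X" "col S x e" for x e
  proof -
    have "x \<notin> e"
      using cS(6)[OF xe(3)] .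
    have colA: "col S a {a', c} \<longleftrightarrow> col S a {a', c'}" if "a \<in> A" "a' \<in> A" for a a'
    proof (cases "a = a'")
      case True
      then show ?thesis using cS(6) by blast
    next
      case False
      then have "{a, a'} \<in> edges A"
        using that by (simp add: doubleton_in_edges)
      then show ?thesis
        using tp_eq_single(4)[OF tpc(1) that(2,1) bA(1)] tp_eq_single(4)[OF tpc(2) that(2,1) bA(1)] by simp
    qed
    have colc: "col S c e \<longleftrightarrow> col S c' e" if e: "e \<in> edges A" for e
    proof -
      obtain a where "a \<in> A" using e by (elim edgesE)
      then show ?thesis
        using single(3)[OF tpc(1) _ e] single(3)[OF tpc(2) _ e] by blast
    qed
    consider "x \<in> A" | "x = c" | "x = c'"
      using xe(1) by blast
    then show ?thesis
    proof cases
      case 1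
      with edge_cases[OF xe(2)] show ?thesis
        using xe(3) isol s_edge sA colA by (auto simp: isol_def)
    next
      case 2
      from edge_cases[OF xe(2)] show ?thesis
      proof (elim disjE bexE)
        assume "e \<in> edges A"
        then show ?thesis using xe(3) 2 s_edge colc by simp
      next
        fix a assume a: "a \<in> A" "e = {a, c'}"
        then have "G a" using xe(3) 2 I2(1) by simp
        then show ?thesis using a 2 sA I3(2) by simp
      qed (use \<open>x \<notin> e\<close> 2 in simp_all)
    next
      case 3
      from edge_cases[OF xe(2)] show ?thesis
      proof (elim disjE bexE)
        assume "e \<in> edges A"
        then show ?thesis using xe(3) 3 s_edge colc by simp
      next
        fix a assume a: "a \<in> A" "e = {a, c}"
        then have "G a" using xe(3) 3 I2(2) by simp
        then show ?thesis using a 3 sA I3(1) by simp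
      qed (use \<open>x \<notin> e\<close> 3 in simp_all)
    qed
  qed
  have "emb_on ?X S S s"
    unfolding emb_on_def
  proof (intro conjI ballI)
    show "inj_on s ?X" by (rule inj)
    show "s ` ?X \<subseteq> pts S" unfolding sX using c A(2) by blast
    show "lt S (s ` e) (s ` f) \<longleftrightarrow> lt S e f" if "e \<in> edges ?X" "f \<in> edges ?X" for e f
      using lt1[OF that] lt1[OF s_edges[OF that(1)] s_edges[OF that(2)]] unfolding ss by blast
    show "col S (s x) (s ` e) \<longleftrightarrow> col S x e" if "x \<in> ?X" "e \<in> edges ?X" for x e
      using col1[OF that] col1[OF _ s_edges[OF that(2)], of "s x"] that(1) sX
      unfolding ss s_simps by blast
  qed
  then have "tp_eq S A [c, c'] [c', c]"
    unfolding tp_eq_def using sA by (intro exI[of _ s]) (auto simp: insert_commute)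
  then have "Q c' c"
    using Q_inv Qc c by auto
  then show False
    using Q_trans Q_irrefl Qc by blast
qed

section \<open>Switchboards as first-order structures\<close>

text \<open>The least colouring compatible with the order: a point is coloured at an edge when some
  edge through it lies below, and the undecided pairs stay uncoloured. In a determined structure
  nothing is undecided.\<close>

definition csb_of :: "('c, 'u) struct \<Rightarrow> 'u csb" where
  "csb_of M = (let C = carrier M; l = (\<lambda>e f. e \<in> edges C \<and> f \<in> edges C \<and>
       (\<exists>x y z w. e = {x, y} \<and> f = {z, w} \<and> less_rel M x y z w))
     in \<lparr>pts = C, lt = l, col = \<lambda>x g. x \<in> C \<and> g \<in> edges C \<and> (\<exists>y. l {x, y} g)\<rparr>)"

definition sb_struct :: "('c, 'u) struct \<Rightarrow> bool" where
  "sb_struct M \<longleftrightarrow> is_csb (csb_of M) \<and>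
     (\<forall>x\<in>carrier M. \<forall>y\<in>carrier M. \<forall>z\<in>carrier M. \<forall>w\<in>carrier M.
        less_rel M x y z w \<longleftrightarrow> lt (csb_of M) {x, y} {z, w})"

definition rich_struct :: "('c, 'u) struct \<Rightarrow> bool" where
  "rich_struct M \<longleftrightarrow> sb_struct M \<and> rich (csb_of M)"

lemma pts_csb_of [simp]: "pts (csb_of M) = carrier M"
  by (simp add: csb_of_def Let_def)

lemma col_csb_of: "col (csb_of M) x g \<longleftrightarrow> x \<in> carrier M \<and> g \<in> edges (carrier M) \<and> (\<exists>y. lt (csb_of M) {x, y} g)"
  by (simp add: csb_of_def Let_def)

lemma csb_of_cong:
  "carrier M = carrier N \<Longrightarrow> less_rel M = less_rel N \<Longrightarrow> csb_of M = csb_of N"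
  by (simp add: csb_of_def)

lemma rich_struct_cong:
  assumes "carrier M = carrier N" "less_rel M = less_rel N"
  shows "rich_struct M \<longleftrightarrow> rich_struct N"
  using assms csb_of_cong[OF assms] by (simp add: rich_struct_def sb_struct_def)

lemma sb_structD:
  assumes "sb_struct M"
  shows "is_csb (csb_of M)"
    "x \<in> carrier M \<Longrightarrow> y \<in> carrier M \<Longrightarrow> z \<in> carrier M \<Longrightarrow> w \<in> carrier M \<Longrightarrow>
       less_rel M x y z w \<longleftrightarrow> lt (csb_of M) {x, y} {z, w}"
  using assms by (simp_all add: sb_struct_def)

lemma lt_csb_of_carrier:
  assumes "sb_struct M" "lt (csb_of M) {x, y} {z, w}"
  shows "x \<in> carrier M" "y \<in> carrier M" "z \<in> carrier M" "w \<in> carrier M" "x \<noteq> y" "z \<noteq> w"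
  using is_csbD(1,2)[OF sb_structD(1)[OF assms(1)] assms(2)] by (simp_all add: doubleton_in_edges)

lemma switchboard_struct_of_csb:
  assumes S: "is_csb S" "pts S = carrier M"
    and less: "\<And>x y z w. x \<in> carrier M \<Longrightarrow> y \<in> carrier M \<Longrightarrow> z \<in> carrier M \<Longrightarrow> w \<in> carrier M \<Longrightarrow>
      less_rel M x y z w \<longleftrightarrow> lt S {x, y} {z, w}"
  shows "switchboard_struct M"
proof -
  note cS = is_csbD[OF S(1)]
  have irr: "\<not> lt S e e" if "e \<in> edges (carrier M)" for e
    using that cS(9)[of e e] by (elim edgesE) auto
  have "switchboard (carrier M) (lt S)"
    unfolding switchboard_def
  proof (intro conjI ballI impI)
    show "irreflp_on (edges (carrier M)) (lt S)"
      using irr by (rule irreflp_onI)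
    show "transp_on (edges (carrier M)) (lt S)"
      using cS(5) by (rule transp_onI)
    show "\<not> lt S {x, y} {x, z}" "\<not> lt S {x, z} {x, y}" for x y z
      using cS(9)[of "{x, y}" "{x, z}" x] cS(9)[of "{x, z}" "{x, y}" x] by blast+
  qed
  moreover have "x \<noteq> y \<and> z \<noteq> w" if "lt S {x, y} {z, w}" for x y z w
    using cS(1,2)[OF that] by (simp add: doubleton_in_edges)
  ultimately show ?thesis
    using less unfolding switchboard_struct_def by (intro exI[of _ "lt S"]) blast
qed

text \<open>The canonical colouring satisfies \<open>is_csb\<close> for every switchboard: upward
  propagation is transitivity, and a point coloured at an edge through it would give two comparable
  edges with a common vertex.\<close>

lemma sb_struct_iff_model:
  "is_model {} switchboard_theory M \<longleftrightarrow> carrier M \<noteq> {} \<and> sb_struct M"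
proof
  assume "is_model {} switchboard_theory M"
  then have ne: "carrier M \<noteq> {}" and "switchboard_struct M"
    unfolding models_of_switchboard_theory by simp_all
  let ?C = "carrier M"
  obtain l where sb: "switchboard ?C l" and l: "\<forall>x\<in>?C. \<forall>y\<in>?C. \<forall>z\<in>?C. \<forall>w\<in>?C.
      less_rel M x y z w \<longleftrightarrow> x \<noteq> y \<and> z \<noteq> w \<and> l {x, y} {z, w}"
    using \<open>switchboard_struct M\<close> unfolding switchboard_struct_def by (elim exE conjE)
  have less: "less_rel M x y z w \<longleftrightarrow> x \<noteq> y \<and> z \<noteq> w \<and> l {x, y} {z, w}"
    if "x \<in> ?C" "y \<in> ?C" "z \<in> ?C" "w \<in> ?C" for x y z w
    using l that by simp
  have irr: "irreflp_on (edges ?C) l" and tr: "transp_on (edges ?C) l"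
    and ax: "\<And>x y z. x \<in> ?C \<Longrightarrow> y \<in> ?C \<Longrightarrow> z \<in> ?C \<Longrightarrow> x \<noteq> y \<Longrightarrow> x \<noteq> z \<Longrightarrow> y \<noteq> z \<Longrightarrow> \<not> l {x, y} {x, z}"
    using sb unfolding switchboard_def by simp_all
  have lt_l: "lt (csb_of M) e f \<longleftrightarrow> e \<in> edges ?C \<and> f \<in> edges ?C \<and> l e f" for e f
  proof (cases "e \<in> edges ?C \<and> f \<in> edges ?C")
    case True
    then obtain x y z w where xy: "e = {x, y}" "f = {z, w}" "x \<in> ?C" "y \<in> ?C" "z \<in> ?C" "w \<in> ?C"
      "x \<noteq> y" "z \<noteq> w"
      using edgesE[of e ?C] edgesE[of f ?C] by metis
    have "lt (csb_of M) e f \<longleftrightarrow> (\<exists>x y z w. e = {x, y} \<and> f = {z, w} \<and> less_rel M x y z w)"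
      using True by (simp add: csb_of_def Let_def)
    also have "\<dots> \<longleftrightarrow> l e f"
    proof
      assume "\<exists>x y z w. e = {x, y} \<and> f = {z, w} \<and> less_rel M x y z w"
      then obtain x y z w where "e = {x, y}" "f = {z, w}" "less_rel M x y z w" by blast
      with True show "l e f"
        using less[of x y z w] by (simp add: doubleton_in_edges)
    next
      assume "l e f"
      then show "\<exists>x y z w. e = {x, y} \<and> f = {z, w} \<and> less_rel M x y z w"
        using xy less[of x y z w] by blast
    qed
    finally show ?thesis using True by simp
  qed (auto simp: csb_of_def Let_def)
  have share: False if lt: "lt (csb_of M) e f" and x: "x \<in> e" "x \<in> f" for e f x
  proof -
    have e: "e \<in> edges ?C" "f \<in> edges ?C" "l e f"
      using lt lt_l by blast+
    obtain y where y: "e = {x, y}" "x \<in> ?C" "y \<in> ?C" "x \<noteq> y"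
      using e(1) x(1) by (elim edgesE) (auto simp: insert_commute)
    obtain z where z: "f = {x, z}" "z \<in> ?C" "x \<noteq> z"
      using e(2) x(2) by (elim edgesE) (auto simp: insert_commute)
    show False
    proof (cases "y = z")
      case True
      then show ?thesis using irreflp_onD[OF irr e(1)] e(3) y(1) z(1) by simp
    next
      case False
      then show ?thesis using ax[of x y z] e(3) y z by simp
    qed
  qed
  have trans: "lt (csb_of M) e g" if "lt (csb_of M) e f" "lt (csb_of M) f g" for e f g
    using that transp_onD[OF tr, of e f g] unfolding lt_l by blast
  have "is_csb (csb_of M)"
    unfolding is_csb_def
  proof (intro conjI allI impI)
    show "csb_typed (csb_of M)"
      unfolding csb_typed_def using lt_l by (simp add: col_csb_of)
    show "x \<notin> e" if "col (csb_of M) x e" for x e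
      using that share unfolding col_csb_of by blast
    show "col (csb_of M) x f" if ef: "lt (csb_of M) e f" and "x \<in> e \<or> col (csb_of M) x e" for x e f
      using that(2)
    proof
      assume x: "x \<in> e"
      have e: "e \<in> edges ?C" "f \<in> edges ?C"
        using ef lt_l by blast+
      obtain y where "e = {x, y}" "x \<in> ?C"
        using e(1) x by (elim edgesE) (auto simp: insert_commute)
      with e(2) ef show ?thesis
        unfolding col_csb_of by blast
    next
      assume "col (csb_of M) x e"
      with ef trans lt_l show ?thesis
        unfolding col_csb_of by blast
    qed
  qed (use trans in blast)
  moreover have "less_rel M x y z w \<longleftrightarrow> lt (csb_of M) {x, y} {z, w}"
    if "x \<in> ?C" "y \<in> ?C" "z \<in> ?C" "w \<in> ?C" for x y z w
    using less[OF that] that by (simp add: lt_l doubleton_in_edges)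
  ultimately show "carrier M \<noteq> {} \<and> sb_struct M"
    using ne by (simp add: sb_struct_def)
next
  assume R: "carrier M \<noteq> {} \<and> sb_struct M"
  then show "is_model {} switchboard_theory M"
    unfolding models_of_switchboard_theory
    using switchboard_struct_of_csb[of "csb_of M" M] by (simp add: sb_struct_def)
qed

definition struct_of :: "'u csb \<Rightarrow> ('c, 'u) struct" where
  "struct_of S = \<lparr>carrier = pts S, less_rel = \<lambda>x y z w. lt S {x, y} {z, w}, const_val = undefined\<rparr>"

text \<open>Forgetting the colours loses nothing in a rich structure: each colour has an edge below
  as witness, and such an edge forces the colour.\<close>

lemma csb_of_struct_of:
  assumes S: "rich S"
  shows "csb_of (struct_of S) = S"
proof -
  note cS = is_csbD[OF rich_csb[OF S]]
  have lt: "lt (csb_of (struct_of S)) e f \<longleftrightarrow> lt S e f" for e f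
  proof
    assume "lt S e f"
    moreover from this have "e \<in> edges (pts S)" "f \<in> edges (pts S)"
      using cS(1,2) by blast+
    moreover from this obtain x y z w where "e = {x, y}" "f = {z, w}"
      using edgesE[of e "pts S"] edgesE[of f "pts S"] by metis
    ultimately show "lt (csb_of (struct_of S)) e f"
      by (auto simp: csb_of_def struct_of_def Let_def)
  qed (auto simp: csb_of_def struct_of_def Let_def)
  have "col (csb_of (struct_of S)) x e \<longleftrightarrow> col S x e" for x e
  proof
    assume "col (csb_of (struct_of S)) x e"
    then show "col S x e"
      unfolding col_csb_of lt using cS(7) by blast
  next
    assume c: "col S x e"
    then have "x \<in> pts S" "e \<in> edges (pts S)"
      using cS(3,4) by blast+
    then show "col (csb_of (struct_of S)) x e"
      unfolding col_csb_of lt using rich_edge_below[OF S _ _ c] by (auto simp: struct_of_def)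
  qed
  with lt show ?thesis
    by (intro csb.equality ext) (simp_all add: struct_of_def)
qed

lemma rich_struct_of: "rich S \<Longrightarrow> rich_struct (struct_of S)"
  using rich_csb[of S] by (simp add: rich_struct_def sb_struct_def csb_of_struct_of) (simp add: struct_of_def)

lemma rich_struct_nonempty:
  assumes "rich_struct M"
  shows "carrier M \<noteq> {}"
  using rich_infinite[of "csb_of M"] assms by (auto simp: rich_struct_def)

text \<open>Every colour in \<open>M\<close>, positive or negative, has a witnessing edge. Its image
  is a witness in \<open>N\<close>, where it forces the same colour.\<close>

lemma emb_on_of_embedding:
  assumes sbM: "sb_struct M" and det: "determined (csb_of M)" and N: "sb_struct N" and f: "is_embedding C M N f"
  shows "emb_on (carrier M) (csb_of M) (csb_of N) f"
proof -
  have f_inj: "inj_on f (carrier M)" and fC: "f ` carrier M \<subseteq> carrier N"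
    using f by (simp_all add: is_embedding_def)
  note cN = is_csbD[OF sb_structD(1)[OF N]]
  have lt: "lt (csb_of N) {f x, f y} {f z, f w} \<longleftrightarrow> lt (csb_of M) {x, y} {z, w}"
    if "x \<in> carrier M" "y \<in> carrier M" "z \<in> carrier M" "w \<in> carrier M" for x y z w
  proof -
    have "f x \<in> carrier N" "f y \<in> carrier N" "f z \<in> carrier N" "f w \<in> carrier N"
      using that fC by auto
    from sb_structD(2)[OF N this] sb_structD(2)[OF sbM that] show ?thesis
      using f that unfolding is_embedding_def by simp
  qed
  have lt': "lt (csb_of N) (f ` e) (f ` g) \<longleftrightarrow> lt (csb_of M) e g"
    if e: "e \<in> edges (carrier M)" "g \<in> edges (carrier M)" for e g
  proof -
    obtain x y z w where "e = {x, y}" "g = {z, w}" "x \<in> carrier M" "y \<in> carrier M"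
      "z \<in> carrier M" "w \<in> carrier M"
      using edgesE[OF e(1)] edgesE[OF e(2)] by metis
    then show ?thesis using lt by simp
  qed
  have "col (csb_of N) (f x) (f ` e) \<longleftrightarrow> col (csb_of M) x e" if x: "x \<in> carrier M" and e: "e \<in> edges (carrier M)" for x e
  proof -
    have fe: "f ` e \<in> edges (carrier N)"
      using edges_image[OF f_inj e] edges_mono[OF fC] by blast
    consider "x \<in> e" | "col (csb_of M) x e" | "x \<notin> e" "\<not> col (csb_of M) x e" by blast
    then show ?thesis
    proof cases
      case 1
      then show ?thesis
        using cN(6)[of "f x" "f ` e"] is_csbD(6)[OF sb_structD(1)[OF sbM]] by blast
    next
      case 2
      then have "x \<notin> e"
        using is_csbD(6)[OF sb_structD(1)[OF sbM]] by blast
      then obtain y where y: "y \<in> carrier M" "lt (csb_of M) {x, y} e"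
        using determinedD(1)[OF det _ _ _ 2] x e by auto
      then have "y \<noteq> x"
        using lt_csb_of_carrier(5)[OF sbM, of x y] e by (elim edgesE) auto
      then have "lt (csb_of N) {f x, f y} (f ` e)"
        using lt'[of "{x, y}" e] x e y \<open>y \<noteq> x\<close> by (simp add: doubleton_in_edges)
      then show ?thesis
        using 2 cN(7) by blast
    next
      case 3
      then obtain y where y: "y \<in> carrier M" "lt (csb_of M) e {x, y}"
        using determinedD(2)[OF det _ _ 3] x e by auto
      then have "y \<noteq> x"
        using lt_csb_of_carrier(6)[OF sbM, of _ _ x y] e by (elim edgesE) auto
      then have *: "lt (csb_of N) (f ` e) {f x, f y}"
        using lt'[of e "{x, y}"] x e y \<open>y \<noteq> x\<close> by (simp add: doubleton_in_edges)
      have "\<not> col (csb_of N) (f x) (f ` e)"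
      proof
        assume "col (csb_of N) (f x) (f ` e)"
        then show False
          using cN(8)[OF *] cN(6)[of "f x" "{f x, f y}"] by blast
      qed
      then show ?thesis using 3 by blast
    qed
  qed
  with lt' f_inj fC show ?thesis
    by (simp add: emb_on_def)
qed

section \<open>Back-and-forth for first-order formulas\<close>

lemma tm_val_emb:
  assumes "\<forall>v\<in>tm_vars t. e' v = h (e v)" "\<forall>c\<in>tm_consts t. const_val N c = h (const_val M c)"
  shows "tm_val N e' t = h (tm_val M e t)"
  using assms by (cases t) auto

lemma tm_val_in:
  assumes "\<forall>v\<in>tm_vars t. e v \<in> Y" "\<forall>c\<in>tm_consts t. const_val M c \<in> Y"
  shows "tm_val M e t \<in> Y"
  using assms by (cases t) auto

text \<open>Richness eliminates quantifiers relative to the colours: an existential witness on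
  either side is matched by a forth or a back step. The constants are kept inside \<open>Y\<close>,
  so formulas with parameters are covered as well.\<close>

lemma emb_sat:
  fixes M :: "('c, 'u) struct" and N :: "('c, 'v) struct"
  assumes M: "rich_struct M" and N: "rich_struct N"
    and Y: "finite Y" "Y \<subseteq> carrier M" and h: "emb_on Y (csb_of M) (csb_of N) h"
    and e: "\<forall>v\<in>fv \<phi>. e v \<in> Y \<and> e' v = h (e v)"
    and c: "\<forall>c\<in>fm_consts \<phi>. const_val M c \<in> Y \<and> const_val N c = h (const_val M c)"
  shows "sat M e \<phi> \<longleftrightarrow> sat N e' \<phi>"
  using Y h e c
proof (induction \<phi> arbitrary: Y h e e')
  case (Eq s t)
  have T: "tm_val N e' r = h (tm_val M e r) \<and> tm_val M e r \<in> Y"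
    if "tm_vars r \<subseteq> fv (Eq s t)" "tm_consts r \<subseteq> fm_consts (Eq s t)" for r
    using tm_val_emb[of r e' h e N M] tm_val_in[of r e Y M] Eq.prems(4,5) that by blast
  have "tm_val N e' s = h (tm_val M e s)" "tm_val N e' t = h (tm_val M e t)"
    "tm_val M e s \<in> Y" "tm_val M e t \<in> Y"
    using T[of s] T[of t] by auto
  then show ?case
    using emb_onD(1)[OF Eq.prems(3)] by (auto dest: inj_onD)
next
  case (Less s t u v)
  have T: "tm_val N e' r = h (tm_val M e r) \<and> tm_val M e r \<in> Y"
    if "tm_vars r \<subseteq> fv (Less s t u v)" "tm_consts r \<subseteq> fm_consts (Less s t u v)" for r
    using tm_val_emb[of r e' h e N M] tm_val_in[of r e Y M] Less.prems(4,5) that by blast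
  have N': "tm_val N e' s = h (tm_val M e s)" "tm_val N e' t = h (tm_val M e t)"
    "tm_val N e' u = h (tm_val M e u)" "tm_val N e' v = h (tm_val M e v)"
    and M': "tm_val M e s \<in> Y" "tm_val M e t \<in> Y" "tm_val M e u \<in> Y" "tm_val M e v \<in> Y"
    using T[of s] T[of t] T[of u] T[of v] by (auto simp: le_supI1 le_supI2)
  have *: "less_rel M x y z w \<longleftrightarrow> less_rel N (h x) (h y) (h z) (h w)"
    if xy: "x \<in> Y" "y \<in> Y" "z \<in> Y" "w \<in> Y" for x y z w
  proof -
    have sb: "sb_struct M" "sb_struct N"
      using M N by (simp_all add: rich_struct_def)
    have 1: "less_rel M x y z w \<longleftrightarrow> lt (csb_of M) {x, y} {z, w}"
      using sb_structD(2)[OF sb(1)] Less.prems(2) xy by blast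
    have "h x \<in> carrier N" "h y \<in> carrier N" "h z \<in> carrier N" "h w \<in> carrier N"
      using emb_onD(2)[OF Less.prems(3)] xy by auto
    then have 2: "less_rel N (h x) (h y) (h z) (h w) \<longleftrightarrow> lt (csb_of N) {h x, h y} {h z, h w}"
      using sb_structD(2)[OF sb(2)] by blast
    show ?thesis
    proof (cases "x \<noteq> y \<and> z \<noteq> w")
      case True
      then show ?thesis
        unfolding 1 2 using emb_onD(3)[OF Less.prems(3), of "{x, y}" "{z, w}"] xy
        by (simp add: doubleton_in_edges)
    next
      case False
      then show ?thesis
        unfolding 1 2 using lt_csb_of_carrier(5,6)[OF sb(1)] lt_csb_of_carrier(5,6)[OF sb(2)] by blast
    qed
  qed
  show ?case
    using *[OF M'] N' by simp
next
  case (Neg \<phi>)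
  then show ?case by simp
next
  case (And \<phi>1 \<phi>2)
  have "sat M e \<phi>1 \<longleftrightarrow> sat N e' \<phi>1"
    using And.prems by (intro And.IH(1)[of Y h]) auto
  moreover have "sat M e \<phi>2 \<longleftrightarrow> sat N e' \<phi>2"
    using And.prems by (intro And.IH(2)[of Y h]) auto
  ultimately show ?case by simp
next
  case (Ex v \<phi>)
  have richM: "rich (csb_of M)" and richN: "rich (csb_of N)"
    using M N by (simp_all add: rich_struct_def)
  have step: "sat M (e(v := d)) \<phi> \<longleftrightarrow> sat N (e'(v := d')) \<phi>"
    if d: "d \<in> carrier M" "emb_on (insert d Y) (csb_of M) (csb_of N) (h(d := d'))" "d \<in> Y \<Longrightarrow> d' = h d"
    for d d'
  proof (rule Ex.IH[of "insert d Y" "h(d := d')"])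
    show "finite (insert d Y)" "insert d Y \<subseteq> carrier M"
      using Ex.prems(1,2) d(1) by auto
    show "emb_on (insert d Y) (csb_of M) (csb_of N) (h(d := d'))"
      using d(2) .
    show "\<forall>w\<in>fv \<phi>. (e(v := d)) w \<in> insert d Y \<and> (e'(v := d')) w = (h(d := d')) ((e(v := d)) w)"
      using Ex.prems(4) d(3) by auto
    show "\<forall>c\<in>fm_consts \<phi>. const_val M c \<in> insert d Y \<and> const_val N c = (h(d := d')) (const_val M c)"
      using Ex.prems(5) d(3) by auto
  qed
  show ?case
  proof
    assume "sat M e (Ex v \<phi>)"
    then obtain d where d: "d \<in> carrier M" "sat M (e(v := d)) \<phi>" by auto
    obtain d' where d': "emb_on (insert d Y) (csb_of M) (csb_of N) (h(d := d'))" "d \<in> Y \<Longrightarrow> d' = h d"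
      using forth_point[OF richN rich_csb[OF richM] Ex.prems(1) _ Ex.prems(3), of d] Ex.prems(2) d(1) by auto
    then have "sat N (e'(v := d')) \<phi>"
      using step d by blast
    moreover have "d' \<in> carrier N"
      using emb_onD(2)[OF d'(1), of d] by simp
    ultimately show "sat N e' (Ex v \<phi>)" by auto
  next
    assume "sat N e' (Ex v \<phi>)"
    then obtain d' where d': "d' \<in> carrier N" "sat N (e'(v := d')) \<phi>" by auto
    obtain d where d: "d \<in> carrier M" "emb_on (insert d Y) (csb_of M) (csb_of N) (h(d := d'))" "d \<in> Y \<Longrightarrow> d' = h d"
      using back_point[OF richM rich_csb[OF richN] Ex.prems(1) _ Ex.prems(3), of d'] Ex.prems(2) d'(1) by auto
    then have "sat M (e(v := d)) \<phi>"
      using step d' by blast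
    with d(1) show "sat M e (Ex v \<phi>)" by auto
  qed
qed

section \<open>Axioms for rich switchboards\<close>

lemma finite_fv: "finite (fv \<phi>)"
proof (induction \<phi>)
  case (Eq s t)
  then show ?case by (cases s; cases t) auto
next
  case (Less s t u v)
  then show ?case by (cases s; cases t; cases u; cases v) auto
qed auto

lemma finite_fm_consts: "finite (fm_consts \<phi>)"
proof (induction \<phi>)
  case (Eq s t)
  then show ?case by (cases s; cases t) auto
next
  case (Less s t u v)
  then show ?case by (cases s; cases t; cases u; cases v) auto
qed auto

lemma tm_val_transfer:
  "(\<And>v. v \<in> tm_vars t \<Longrightarrow> e' v = e v) \<Longrightarrow> tm_consts t = {} \<Longrightarrow>
    tm_val N e' (map_tm g t) = tm_val M e t"
  by (cases t) auto

text \<open>A bridge between languages whose constants have different types; the axioms of the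
  companion will be recognised in an elementary diagram through it.\<close>

lemma sat_transfer:
  assumes "carrier M = carrier N" "less_rel M = less_rel N"
  shows "(\<And>v. v \<in> fv \<phi> \<Longrightarrow> e' v = e v) \<Longrightarrow> fm_consts \<phi> = {} \<Longrightarrow>
    sat N e' (map_fm g \<phi>) \<longleftrightarrow> sat M e \<phi>"
proof (induction \<phi> arbitrary: e e')
  case (Eq s t)
  then show ?case
    using tm_val_transfer[of s e' e N g M] tm_val_transfer[of t e' e N g M] by simp
next
  case (Less s t u v)
  then show ?case
    using tm_val_transfer[of s e' e N g M] tm_val_transfer[of t e' e N g M]
      tm_val_transfer[of u e' e N g M] tm_val_transfer[of v e' e N g M] assms(2) by simp
next
  case (Neg \<phi>)
  then show ?case using Neg.IH[of e' e] by simp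
next
  case (And \<phi> \<psi>)
  then show ?case using And.IH(1)[of e' e] And.IH(2)[of e' e] by simp
next
  case (Ex v \<phi>)
  have "sat N (e'(v := a)) (map_fm g \<phi>) \<longleftrightarrow> sat M (e(v := a)) \<phi>" for a
    using Ex.prems by (intro Ex.IH) auto
  then show ?case using assms(1) by simp
qed

lemma sat_cong:
  assumes "\<And>v. v \<in> fv \<phi> \<Longrightarrow> e' v = e v" "fm_consts \<phi> = {}"
  shows "sat M e' \<phi> \<longleftrightarrow> sat M e \<phi>"
  using sat_transfer[of M M \<phi> e' e id] assms by (simp add: fm.map_id)

lemma fv_map_fm: "fv (map_fm g \<phi>) = fv \<phi>"
proof -
  have "tm_vars (map_tm g t) = tm_vars t" for t
    by (cases t) auto
  then show ?thesis
    by (induction \<phi>) auto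
qed

lemma sentencesD: "\<phi> \<in> sentences {} \<Longrightarrow> fm_consts \<phi> = {}" "\<phi> \<in> sentences {} \<Longrightarrow> fv \<phi> = {}"
  by (auto simp: sentences_def formulas_def)

lemma is_model_sentences:
  assumes "T \<subseteq> sentences {}" "carrier M \<noteq> {}"
  shows "is_model {} T M \<longleftrightarrow> (\<forall>\<phi>\<in>T. \<forall>e. sat M e \<phi>)"
proof -
  obtain a where "a \<in> carrier M"
    using assms(2) by blast
  then have a: "range (\<lambda>_ :: nat. a) \<subseteq> carrier M"
    by auto
  have "sat M e \<phi> \<longleftrightarrow> sat M (\<lambda>_. a) \<phi>" if "\<phi> \<in> T" for e \<phi>
    using that assms(1) sentencesD by (intro sat_cong) blast+
  with a show ?thesis
    unfolding is_model_def is_struct_def using assms(2) by blast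
qed

lemma sat_Alls:
  "(\<forall>e. range e \<subseteq> carrier M \<longrightarrow> sat M e (Alls vs \<phi>)) \<longleftrightarrow> (\<forall>e. range e \<subseteq> carrier M \<longrightarrow> sat M e \<phi>)"
proof (induction vs)
  case (Cons v vs)
  have "(\<forall>e. range e \<subseteq> carrier M \<longrightarrow> sat M e (All v \<psi>)) \<longleftrightarrow> (\<forall>e. range e \<subseteq> carrier M \<longrightarrow> sat M e \<psi>)" for \<psi>
  proof (intro iffI allI impI)
    fix e :: "nat \<Rightarrow> 'a" assume "\<forall>e. range e \<subseteq> carrier M \<longrightarrow> sat M e (All v \<psi>)" "range e \<subseteq> carrier M"
    then have "sat M (e(v := e v)) \<psi>"
      unfolding sat.simps by blast
    then show "sat M e \<psi>" by simp
  next
    fix e :: "nat \<Rightarrow> 'a" assume *: "\<forall>e. range e \<subseteq> carrier M \<longrightarrow> sat M e \<psi>" "range e \<subseteq> carrier M"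
    have "range (e(v := a)) \<subseteq> carrier M" if "a \<in> carrier M" for a
      using *(2) that by auto
    with * show "sat M e (All v \<psi>)" by simp
  qed
  with Cons show ?case by simp
qed simp

lemma fv_Alls: "fv (Alls vs \<phi>) = fv \<phi> - set vs"
  by (induction vs) auto

lemma fm_consts_Alls: "fm_consts (Alls vs \<phi>) = fm_consts \<phi>"
  by (induction vs) auto

text \<open>The empty conjunction is a closed tautology, so that it contributes no free
  variable.\<close>

definition Ands :: "'c fm list \<Rightarrow> 'c fm" where
  "Ands fs = foldr And fs (All 0 (Eq (Var 0) (Var 0)))"

lemma sat_Ands: "sat M e (Ands fs) \<longleftrightarrow> (\<forall>\<phi>\<in>set fs. sat M e \<phi>)"
  by (induction fs) (auto simp: Ands_def)

lemma fv_Ands: "fv (Ands fs) = (\<Union>\<phi>\<in>set fs. fv \<phi>)"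
  by (induction fs) (auto simp: Ands_def)

lemma fm_consts_Ands: "fm_consts (Ands fs) = (\<Union>\<phi>\<in>set fs. fm_consts \<phi>)"
  by (induction fs) (auto simp: Ands_def)

text \<open>
  Both colours are expressed by existential formulas, so \<open>diagram\<close> formulas are preserved by
  embeddings.
\<close>

definition diagram :: "nat csb \<Rightarrow> nat \<Rightarrow> 'c fm" where
  "diagram T n = (let ns = [0..<n] in Ands
     (map (\<lambda>(i, j). Neg (Eq (Var i) (Var j)))
        (filter (\<lambda>(i, j). i \<noteq> j) (List.product ns ns)) @
      map (\<lambda>(i, j, k, l). if lt T {i, j} {k, l} then Less (Var i) (Var j) (Var k) (Var l)
         else Neg (Less (Var i) (Var j) (Var k) (Var l)))
        (List.product ns (List.product ns (List.product ns ns))) @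
      map (\<lambda>(i, j, k). if col T i {j, k} then Ex n (Less (Var i) (Var n) (Var j) (Var k))
         else Ex n (Less (Var j) (Var k) (Var i) (Var n)))
        (filter (\<lambda>(i, j, k). i \<noteq> j \<and> i \<noteq> k \<and> j \<noteq> k) (List.product ns (List.product ns ns)))))"

lemma sat_diagram:
  "sat M e (diagram T n) \<longleftrightarrow>
     (\<forall>i<n. \<forall>j<n. i \<noteq> j \<longrightarrow> e i \<noteq> e j) \<and>
     (\<forall>i<n. \<forall>j<n. \<forall>k<n. \<forall>l<n. less_rel M (e i) (e j) (e k) (e l) \<longleftrightarrow> lt T {i, j} {k, l}) \<and>
     (\<forall>i<n. \<forall>j<n. \<forall>k<n. i \<noteq> j \<and> i \<noteq> k \<and> j \<noteq> k \<longrightarrow>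
        (\<exists>y\<in>carrier M. if col T i {j, k} then less_rel M (e i) y (e j) (e k)
           else less_rel M (e j) (e k) (e i) y))"
proof -
  have 1: "(\<forall>\<phi>\<in>set (map (\<lambda>(i, j). Neg (Eq (Var i) (Var j)))
        (filter (\<lambda>(i, j). i \<noteq> j) (List.product [0..<n] [0..<n]))). sat M e \<phi>) \<longleftrightarrow>
      (\<forall>i<n. \<forall>j<n. i \<noteq> j \<longrightarrow> e i \<noteq> e j)"
    by auto
  have lit: "sat M e (if b then \<phi> else Neg \<phi>) \<longleftrightarrow> (sat M e \<phi> \<longleftrightarrow> b)" for b \<phi>
    by simp
  have 2: "(\<forall>\<phi>\<in>set (map (\<lambda>(i, j, k, l). if lt T {i, j} {k, l} then Less (Var i) (Var j) (Var k) (Var l)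
         else Neg (Less (Var i) (Var j) (Var k) (Var l)))
        (List.product [0..<n] (List.product [0..<n] (List.product [0..<n] [0..<n])))). sat M e \<phi>) \<longleftrightarrow>
      (\<forall>i<n. \<forall>j<n. \<forall>k<n. \<forall>l<n. less_rel M (e i) (e j) (e k) (e l) \<longleftrightarrow> lt T {i, j} {k, l})"
    by (simp add: lit) (simp add: Ball_def)
  have gen: "(\<forall>\<phi>\<in>set (map (\<lambda>(i, j, k). F i j k)
        (filter (\<lambda>(i, j, k). i \<noteq> j \<and> i \<noteq> k \<and> j \<noteq> k) (List.product [0..<n] (List.product [0..<n] [0..<n])))).
          sat M e \<phi>) \<longleftrightarrow>
      (\<forall>i<n. \<forall>j<n. \<forall>k<n. i \<noteq> j \<and> i \<noteq> k \<and> j \<noteq> k \<longrightarrow> sat M e (F i j k))" for F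
    by auto
  \<comment> \<open>The points use the variables below \<open>n\<close>; binding \<open>n\<close>
    for the witness therefore leaves their values alone.\<close>
  have ex: "sat M e (if b then Ex n (Less (Var i) (Var n) (Var j) (Var k))
         else Ex n (Less (Var j) (Var k) (Var i) (Var n))) \<longleftrightarrow>
      (\<exists>y\<in>carrier M. if b then less_rel M (e i) y (e j) (e k) else less_rel M (e j) (e k) (e i) y)"
    if "i < n" "j < n" "k < n" for b i j k
    using that by (cases b) auto
  have 3: "(\<forall>\<phi>\<in>set (map (\<lambda>(i, j, k). if col T i {j, k} then Ex n (Less (Var i) (Var n) (Var j) (Var k))
         else Ex n (Less (Var j) (Var k) (Var i) (Var n)))
        (filter (\<lambda>(i, j, k). i \<noteq> j \<and> i \<noteq> k \<and> j \<noteq> k) (List.product [0..<n] (List.product [0..<n] [0..<n])))).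
          sat M e \<phi>) \<longleftrightarrow>
      (\<forall>i<n. \<forall>j<n. \<forall>k<n. i \<noteq> j \<and> i \<noteq> k \<and> j \<noteq> k \<longrightarrow>
        (\<exists>y\<in>carrier M. if col T i {j, k} then less_rel M (e i) y (e j) (e k)
           else less_rel M (e j) (e k) (e i) y))"
    unfolding gen by (simp only: ex cong: imp_cong)
  show ?thesis
    unfolding diagram_def Let_def sat_Ands set_append ball_Un 1 2 3 ..
qed

lemma fv_diagram: "fv (diagram T n) \<subseteq> {..<n}"
  unfolding diagram_def Let_def fv_Ands by (auto split: if_splits)

lemma fm_consts_diagram: "fm_consts (diagram T n) = {}"
  unfolding diagram_def Let_def fm_consts_Ands by (auto split: if_splits)

lemma emb_on_of_diagram:
  assumes M: "sb_struct M" and T: "is_csb T" and e: "e ` {..<n} \<subseteq> carrier M"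
    and sat: "sat M e (diagram T n)"
  shows "emb_on {..<n} T (csb_of M) e"
proof -
  note cM = is_csbD[OF sb_structD(1)[OF M]] and cT = is_csbD[OF T]
  have d1: "\<forall>i<n. \<forall>j<n. i \<noteq> j \<longrightarrow> e i \<noteq> e j"
    and d2: "\<forall>i<n. \<forall>j<n. \<forall>k<n. \<forall>l<n. less_rel M (e i) (e j) (e k) (e l) \<longleftrightarrow> lt T {i, j} {k, l}"
    and d3: "\<forall>i<n. \<forall>j<n. \<forall>k<n. i \<noteq> j \<and> i \<noteq> k \<and> j \<noteq> k \<longrightarrow>
        (\<exists>y\<in>carrier M. if col T i {j, k} then less_rel M (e i) y (e j) (e k)
           else less_rel M (e j) (e k) (e i) y)"
    using sat unfolding sat_diagram by simp_all
  have inj: "inj_on e {..<n}"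
    using d1 by (auto simp: inj_on_def)
  have eC: "e i \<in> carrier M" if "i < n" for i
    using e that by auto
  show ?thesis
    unfolding emb_on_def
  proof (intro conjI ballI)
    fix f g assume fg: "f \<in> edges {..<n}" "g \<in> edges {..<n}"
    obtain i j where f: "f = {i, j}" "i < n" "j < n"
      using edgesE[OF fg(1)] by (metis lessThan_iff)
    obtain k l where g: "g = {k, l}" "k < n" "l < n"
      using edgesE[OF fg(2)] by (metis lessThan_iff)
    show "lt (csb_of M) (e ` f) (e ` g) \<longleftrightarrow> lt T f g"
      using d2 f g sb_structD(2)[OF M] eC by auto
  next
    fix i g assume i: "i \<in> {..<n}" and g: "g \<in> edges {..<n}"
    obtain j k where jk: "g = {j, k}" "j < n" "k < n" "j \<noteq> k"
      using edgesE[OF g] by (metis lessThan_iff)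
    show "col (csb_of M) (e i) (e ` g) \<longleftrightarrow> col T i g"
    proof (cases "i \<in> g")
      case True
      then show ?thesis
        using cM(6)[of "e i" "e ` g"] cT(6)[of i g] by blast
    next
      case False
      then have "\<exists>y\<in>carrier M. if col T i {j, k} then less_rel M (e i) y (e j) (e k)
          else less_rel M (e j) (e k) (e i) y"
        using d3 i jk by simp
      then obtain y where y: "y \<in> carrier M"
        "if col T i {j, k} then less_rel M (e i) y (e j) (e k) else less_rel M (e j) (e k) (e i) y"
        by blast
      show ?thesis
      proof (cases "col T i g")
        case True
        then have "lt (csb_of M) {e i, y} (e ` g)"
          using y jk i sb_structD(2)[OF M eC[of i] y(1) eC[of j] eC[of k]] by simp
        then show ?thesis
          using True cM(7) by blast
      next
        case False
        then have *: "lt (csb_of M) (e ` g) {e i, y}"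
          using y jk i sb_structD(2)[OF M eC[of j] eC[of k] eC[of i] y(1)] by simp
        have "\<not> col (csb_of M) (e i) (e ` g)"
        proof
          assume "col (csb_of M) (e i) (e ` g)"
          then show False
            using cM(8)[OF *] cM(6)[of "e i" "{e i, y}"] by blast
        qed
        then show ?thesis
          using False by blast
      qed
    qed
  qed (use inj e in auto)
qed

text \<open>A diagram asserts a witness for each colour and each absence of one;
  \<open>determined\<close> supplies them.\<close>

lemma diagram_of_emb_on:
  assumes M: "sb_struct M" and det: "determined (csb_of M)" and T: "is_csb T"
    and e: "emb_on {..<n} T (csb_of M) e"
  shows "sat M e (diagram T n)"
proof -
  have eC: "e i \<in> carrier M" if "i < n" for i
    using emb_onD(2)[OF e] that by simp
  note inj = emb_onD(1)[OF e]
  have 1: "\<forall>i<n. \<forall>j<n. i \<noteq> j \<longrightarrow> e i \<noteq> e j"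
    using inj by (auto simp: inj_on_def)
  have edge: "{i, j} \<in> edges {..<n}" if "i < n" "j < n" "i \<noteq> j" for i j
    using that by (simp add: doubleton_in_edges)
  have 2: "less_rel M (e i) (e j) (e k) (e l) \<longleftrightarrow> lt T {i, j} {k, l}"
    if ij: "i < n" "j < n" "k < n" "l < n" for i j k l
  proof (cases "i \<noteq> j \<and> k \<noteq> l")
    case True
    then show ?thesis
      using emb_onD(3)[OF e edge[of i j] edge[of k l]] ij sb_structD(2)[OF M eC eC eC eC] by simp
  next
    case False
    then have "\<not> lt T {i, j} {k, l}"
      using is_csbD(1,2)[OF T, of "{i, j}" "{k, l}"] by (auto simp: doubleton_in_edges)
    moreover have "\<not> lt (csb_of M) {e i, e j} {e k, e l}"
      using False lt_csb_of_carrier(5,6)[OF M, of "e i" "e j" "e k" "e l"] by blast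
    ultimately show ?thesis
      using ij sb_structD(2)[OF M eC eC eC eC] by simp
  qed
  have 3: "\<exists>y\<in>carrier M. if col T i {j, k} then less_rel M (e i) y (e j) (e k)
           else less_rel M (e j) (e k) (e i) y"
    if i: "i < n" "j < n" "k < n" and ne: "i \<noteq> j \<and> i \<noteq> k \<and> j \<noteq> k" for i j k
  proof -
    have "e i \<notin> {e j, e k}" "{e j, e k} \<in> edges (carrier M)"
      using 1 i ne eC by (auto simp: doubleton_in_edges)
    then obtain y where y: "y \<in> carrier M"
      "if col (csb_of M) (e i) {e j, e k} then lt (csb_of M) {e i, y} {e j, e k}
       else lt (csb_of M) {e j, e k} {e i, y}"
      using det eC[OF i(1)] unfolding determined_def by fastforce
    moreover have "col (csb_of M) (e i) {e j, e k} \<longleftrightarrow> col T i {j, k}"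
      using emb_onD(4)[OF e, of i "{j, k}"] edge[of j k] i ne by simp
    ultimately show ?thesis
      using sb_structD(2)[OF M eC y(1) eC eC] sb_structD(2)[OF M eC eC eC y(1)] i
      by (intro bexI[OF _ y(1)]) (simp split: if_splits)
  qed
  show ?thesis
    unfolding sat_diagram using 1 2 3 by blast
qed

text \<open>Mere comparability is enough, since by \<open>determinedI\<close> the direction of the
  comparison settles the colour.\<close>

definition determined_axiom :: "unit fm" where
  "determined_axiom = Alls [0, 1, 2]
     (Imp (And (Neg (Eq (Var 0) (Var 1))) (And (Neg (Eq (Var 0) (Var 2))) (Neg (Eq (Var 1) (Var 2)))))
          (Neg (And (Neg (Ex 3 (Less (Var 0) (Var 3) (Var 1) (Var 2))))
                    (Neg (Ex 3 (Less (Var 1) (Var 2) (Var 0) (Var 3)))))))"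

text \<open>The variable \<open>n\<close> has two roles: in \<open>diagram T n\<close> it is bound
  by the witnesses for colours, and in \<open>diagram T (Suc n)\<close> it is the new point.\<close>

definition extension_axiom :: "nat csb \<Rightarrow> nat \<Rightarrow> unit fm" where
  "extension_axiom T n = Alls [0..<n] (Imp (diagram T n) (Ex n (diagram T (Suc n))))"

definition rich_theory :: "unit fm set" where
  "rich_theory = switchboard_theory \<union> {determined_axiom} \<union>
     {extension_axiom T n |T n. is_csb T \<and> pts T = {..n}}"

lemma rich_theory_sentences: "rich_theory \<subseteq> sentences {}"
proof -
  have "determined_axiom \<in> sentences {}"
    by (auto simp: determined_axiom_def sentences_def formulas_def)
  moreover have "extension_axiom T n \<in> sentences {}" for T n
    using fv_diagram[of T n] fv_diagram[of T "Suc n"]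
    by (auto simp: extension_axiom_def sentences_def formulas_def fv_Alls fm_consts_Alls fm_consts_diagram)
  ultimately show ?thesis
    using switchboard_theory_sentences by (auto simp: rich_theory_def)
qed

lemma sat_determined_axiom:
  assumes M: "sb_struct M" and ne: "carrier M \<noteq> {}"
  shows "(\<forall>e. range e \<subseteq> carrier M \<longrightarrow> sat M e determined_axiom) \<longleftrightarrow> determined (csb_of M)"
proof -
  let ?C = "carrier M"
  let ?P = "\<lambda>x y z. x \<noteq> y \<and> x \<noteq> z \<and> y \<noteq> z \<longrightarrow>
      (\<exists>w\<in>?C. less_rel M x w y z) \<or> (\<exists>w\<in>?C. less_rel M y z x w)"
  obtain x0 where "x0 \<in> ?C"
    using ne by blast
  then have "range (\<lambda>_ :: nat. x0) \<subseteq> ?C"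
    by auto
  moreover have "sat M e determined_axiom \<longleftrightarrow> (\<forall>x\<in>?C. \<forall>y\<in>?C. \<forall>z\<in>?C. ?P x y z)" for e
    unfolding determined_axiom_def by simp blast
  ultimately have "(\<forall>e. range e \<subseteq> ?C \<longrightarrow> sat M e determined_axiom) \<longleftrightarrow> (\<forall>x\<in>?C. \<forall>y\<in>?C. \<forall>z\<in>?C. ?P x y z)"
    by blast
  also have "\<dots> \<longleftrightarrow> determined (csb_of M)"
  proof
    assume *: "\<forall>x\<in>?C. \<forall>y\<in>?C. \<forall>z\<in>?C. ?P x y z"
    show "determined (csb_of M)"
    proof (rule determinedI[OF sb_structD(1)[OF M]], unfold pts_csb_of)
      fix x e assume x: "x \<in> ?C" and e: "e \<in> edges ?C" "x \<notin> e"
      obtain y z where yz: "e = {y, z}" "y \<in> ?C" "z \<in> ?C" "y \<noteq> z"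
        using edgesE[OF e(1)] by auto
      have "(\<exists>w\<in>?C. less_rel M x w y z) \<or> (\<exists>w\<in>?C. less_rel M y z x w)"
        using * x yz e(2) by auto
      then show "(\<exists>w\<in>?C. lt (csb_of M) {x, w} e) \<or> (\<exists>w\<in>?C. lt (csb_of M) e {x, w})"
        using sb_structD(2)[OF M x _ yz(2,3)] sb_structD(2)[OF M yz(2,3) x] yz(1) by auto
    qed
  next
    assume det: "determined (csb_of M)"
    show "\<forall>x\<in>?C. \<forall>y\<in>?C. \<forall>z\<in>?C. ?P x y z"
    proof (intro ballI impI)
      fix x y z assume x: "x \<in> ?C" "y \<in> ?C" "z \<in> ?C" "x \<noteq> y \<and> x \<noteq> z \<and> y \<noteq> z"
      then obtain w where w: "w \<in> ?C" "if col (csb_of M) x {y, z} then lt (csb_of M) {x, w} {y, z}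
          else lt (csb_of M) {y, z} {x, w}"
        using bspec[OF bspec[OF det[unfolded determined_def pts_csb_of] x(1)], of "{y, z}"]
        by (auto simp: doubleton_in_edges)
      then show "(\<exists>w\<in>?C. less_rel M x w y z) \<or> (\<exists>w\<in>?C. less_rel M y z x w)"
        using sb_structD(2)[OF M x(1) w(1) x(2,3)] sb_structD(2)[OF M x(2,3,1) w(1)]
        by (auto split: if_splits)
    qed
  qed
  finally show ?thesis .
qed

text \<open>\<open>determined\<close> has to be available before the extension property: given it,
  partial embeddings and satisfied diagrams are the same, and the axioms translate
  \<open>rich\<close> literally.\<close>

lemma models_of_rich_theory: "is_model {} rich_theory M \<longleftrightarrow> rich_struct M"
proof
  assume L: "is_model {} rich_theory M"
  then have "is_model {} switchboard_theory M"
    by (auto simp: is_model_def rich_theory_def)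
  then have M: "sb_struct M" and ne: "carrier M \<noteq> {}"
    by (simp_all add: sb_struct_iff_model)
  have det: "determined (csb_of M)"
    using L sat_determined_axiom[OF M ne] by (auto simp: is_model_def rich_theory_def)
  obtain x0 where x0: "x0 \<in> carrier M"
    using ne by blast
  have "rich (csb_of M)"
    unfolding rich_def
  proof (intro conjI allI impI)
    show "is_csb (csb_of M)" using sb_structD(1)[OF M] .
    fix n and T :: "nat csb" and a
    assume T: "is_csb T \<and> pts T = {..n} \<and> emb_on {..<n} T (csb_of M) a"
    \<comment> \<open>\<open>a\<close> is controlled only below \<open>n\<close>; the padding by
      \<open>x0\<close> makes it an assignment into the carrier.\<close>
    define e where "e i = (if i < n then a i else x0)" for i
    have emb: "emb_on {..<n} T (csb_of M) e"
      using T emb_on_cong[of "{..<n}" e a] by (auto simp: e_def)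
    have e: "range e \<subseteq> carrier M"
      using emb_onD(2)[OF emb] x0 by (auto simp: e_def)
    have "extension_axiom T n \<in> rich_theory"
      using T by (auto simp: rich_theory_def)
    then have "\<forall>e. range e \<subseteq> carrier M \<longrightarrow> sat M e (extension_axiom T n)"
      using L by (simp add: is_model_def)
    then have "sat M e (Imp (diagram T n) (Ex n (diagram T (Suc n))))"
      unfolding extension_axiom_def sat_Alls using e by blast
    moreover have "sat M e (diagram T n)"
      using diagram_of_emb_on[OF M det _ emb] T by blast
    ultimately obtain b where b: "b \<in> carrier M" "sat M (e(n := b)) (diagram T (Suc n))"
      by auto
    then have "emb_on {..<Suc n} T (csb_of M) (e(n := b))"
      using e T by (intro emb_on_of_diagram[OF M]) auto
    then have "emb_on {..n} T (csb_of M) (a(n := b))"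
      unfolding lessThan_Suc_atMost using emb_on_cong[of "{..n}" "e(n := b)" "a(n := b)"]
      by (auto simp: e_def)
    then show "\<exists>b. emb_on {..n} T (csb_of M) (a(n := b))" ..
  qed
  with M show "rich_struct M"
    by (simp add: rich_struct_def)
next
  assume R: "rich_struct M"
  then have M: "sb_struct M" and rich: "rich (csb_of M)"
    by (simp_all add: rich_struct_def)
  have det: "determined (csb_of M)"
    using rich_determined[OF rich] .
  have sb: "is_model {} switchboard_theory M"
    using M rich_struct_nonempty[OF R] by (simp add: sb_struct_iff_model)
  have ext: "\<forall>e. range e \<subseteq> carrier M \<longrightarrow> sat M e (extension_axiom T n)"
    if T: "is_csb T" "pts T = {..n}" for T n
    unfolding extension_axiom_def sat_Alls
  proof (intro allI impI)
    fix e :: "nat \<Rightarrow> 'a" assume e: "range e \<subseteq> carrier M"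
    have "\<exists>b\<in>carrier M. sat M (e(n := b)) (diagram T (Suc n))" if d: "sat M e (diagram T n)"
    proof -
      have "emb_on {..<n} T (csb_of M) e"
        using e T by (intro emb_on_of_diagram[OF M _ _ d]) auto
      then obtain b where b: "emb_on {..n} T (csb_of M) (e(n := b))"
        using rich T unfolding rich_def by blast
      then have "sat M (e(n := b)) (diagram T (Suc n))"
        using T by (intro diagram_of_emb_on[OF M det]) (simp_all add: lessThan_Suc_atMost)
      moreover have "b \<in> carrier M"
        using emb_onD(2)[OF b, of n] by simp
      ultimately show ?thesis by blast
    qed
    then show "sat M e (Imp (diagram T n) (Ex n (diagram T (Suc n))))" by simp
  qed
  have "\<forall>e. range e \<subseteq> carrier M \<longrightarrow> sat M e \<phi>" if "\<phi> \<in> rich_theory" for \<phi>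
    using that[unfolded rich_theory_def]
  proof (elim UnE)
    assume "\<phi> \<in> switchboard_theory"
    then show ?thesis using sb unfolding is_model_def by blast
  next
    assume "\<phi> \<in> {determined_axiom}"
    then show ?thesis using det sat_determined_axiom[OF M rich_struct_nonempty[OF R]] by simp
  next
    assume "\<phi> \<in> {extension_axiom T n |T n. is_csb T \<and> pts T = {..n}}"
    then show ?thesis using ext by auto
  qed
  then show "is_model {} rich_theory M"
    using sb by (simp add: is_model_def)
qed

section \<open>Model companions\<close>

lemma is_embedding_comp:
  assumes f: "is_embedding C M N f" and g: "is_embedding C N L g"
  shows "is_embedding C M L (g \<circ> f)"
proof -
  have fC: "f x \<in> carrier N" if "x \<in> carrier M" for x
    using f that by (auto simp: is_embedding_def)
  have "inj_on (g \<circ> f) (carrier M)"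
  proof (rule comp_inj_on)
    show "inj_on f (carrier M)" using f by (simp add: is_embedding_def)
    show "inj_on g (f ` carrier M)"
      by (rule inj_on_subset[of g "carrier N"]) (use f g in \<open>simp_all add: is_embedding_def\<close>)
  qed
  moreover have "(g \<circ> f) ` carrier M \<subseteq> carrier L"
    using g fC by (auto simp: is_embedding_def)
  moreover have "less_rel L (g (f x)) (g (f y)) (g (f z)) (g (f w)) \<longleftrightarrow> less_rel M x y z w"
    if "x \<in> carrier M" "y \<in> carrier M" "z \<in> carrier M" "w \<in> carrier M" for x y z w
    using f g fC that by (simp add: is_embedding_def)
  moreover have "g (f (const_val M c)) = const_val L c" if "c \<in> C" for c
    using f g that by (simp add: is_embedding_def)
  ultimately show ?thesis
    by (simp add: is_embedding_def)
qed

lemma is_embedding_of_emb_on: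
  fixes M :: "(unit, 'u) struct" and N :: "(unit, 'v) struct"
  assumes M: "sb_struct M" and N: "sb_struct N" and h: "emb_on (carrier M) (csb_of M) (csb_of N) h"
  shows "is_embedding {} M N h"
  unfolding is_embedding_def
proof (intro conjI ballI)
  show hC: "h ` carrier M \<subseteq> carrier N"
    using h by (simp add: emb_on_def)
  show inj: "inj_on h (carrier M)"
    using emb_onD(1)[OF h] .
  fix x y z w assume m: "x \<in> carrier M" "y \<in> carrier M" "z \<in> carrier M" "w \<in> carrier M"
  have hm: "h x \<in> carrier N" "h y \<in> carrier N" "h z \<in> carrier N" "h w \<in> carrier N"
    using hC m by auto
  show "less_rel N (h x) (h y) (h z) (h w) \<longleftrightarrow> less_rel M x y z w"
  proof (cases "x \<noteq> y \<and> z \<noteq> w")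
    case True
    then show ?thesis
      unfolding sb_structD(2)[OF M m] sb_structD(2)[OF N hm]
      using emb_onD(3)[OF h, of "{x, y}" "{z, w}"] m by (simp add: doubleton_in_edges)
  next
    case False
    then show ?thesis
      unfolding sb_structD(2)[OF M m] sb_structD(2)[OF N hm]
      using lt_csb_of_carrier(5,6)[OF M, of x y z w] lt_csb_of_carrier(5,6)[OF N, of "h x" "h y" "h z" "h w"]
      by blast
  qed
qed simp

text \<open>Switchboard axioms are universal and so descend to substructures; concretely, the
  colouring of \<open>N\<close> is pulled back along \<open>f\<close>.\<close>

lemma sb_struct_substructure:
  fixes M :: "(unit, 'u) struct" and N :: "(unit, 'v) struct"
  assumes N: "is_model {} switchboard_theory N" and f: "is_embedding {} M N f" and ne: "carrier M \<noteq> {}"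
  shows "sb_struct M"
proof -
  have sbN: "sb_struct N"
    using N by (simp add: sb_struct_iff_model)
  have fC: "f ` carrier M \<subseteq> carrier N" and f_inj: "inj_on f (carrier M)"
    using f by (simp_all add: is_embedding_def)
  let ?S = "pull (carrier M) f (csb_of N)"
  have "less_rel M x y z w \<longleftrightarrow> lt ?S {x, y} {z, w}"
    if m: "x \<in> carrier M" "y \<in> carrier M" "z \<in> carrier M" "w \<in> carrier M" for x y z w
  proof -
    have "less_rel M x y z w \<longleftrightarrow> less_rel N (f x) (f y) (f z) (f w)"
      using f m by (simp add: is_embedding_def)
    also have "\<dots> \<longleftrightarrow> lt (csb_of N) {f x, f y} {f z, f w}"
      using fC m by (intro sb_structD(2)[OF sbN]) auto
    also have "\<dots> \<longleftrightarrow> lt ?S {x, y} {z, w}"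
      using lt_csb_of_carrier(5,6)[OF sbN, of "f x" "f y" "f z" "f w"] m
      by (auto simp: pull_def doubleton_in_edges)
    finally show ?thesis .
  qed
  moreover have "is_csb ?S"
    using is_csb_pull[OF sb_structD(1)[OF sbN] f_inj] fC by simp
  ultimately have "switchboard_struct M"
    using switchboard_struct_of_csb[of ?S M] by simp
  then show ?thesis
    using ne models_of_switchboard_theory[of M] by (simp add: sb_struct_iff_model)
qed

lemma rich_struct_embedding:
  fixes M :: "(unit, 'u) struct"
  assumes inf: "infinite (UNIV :: 'u set)" and M: "is_model {} switchboard_theory M"
  obtains N :: "(unit, 'u) struct" and h where "rich_struct N" "is_embedding {} M N h"
proof -
  have sb: "sb_struct M"
    using M by (simp add: sb_struct_iff_model)
  obtain S :: "'u csb" and h where S: "rich S" and h: "emb_on (carrier M) (csb_of M) S h"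
    using rich_extension[OF inf sb_structD(1)[OF sb]] by auto
  have N: "rich_struct (struct_of S :: (unit, 'u) struct)"
    using rich_struct_of[OF S] .
  moreover have "is_embedding {} M (struct_of S) h"
    using N h by (intro is_embedding_of_emb_on[OF sb]) (simp_all add: rich_struct_def csb_of_struct_of[OF S])
  ultimately show thesis
    by (rule that)
qed

lemma rich_struct_exists:
  assumes inf: "infinite (UNIV :: 'u set)"
  obtains N :: "(unit, 'u) struct" where "rich_struct N"
  using rich_extension[OF inf trivial_csb[of "{}"]] rich_struct_of by blast

lemma rich_struct_model: "rich_struct M \<Longrightarrow> is_model {} switchboard_theory M"
  using rich_struct_nonempty by (auto simp: sb_struct_iff_model rich_struct_def)

text \<open>An embedding preserves the witnesses of colours, hence the colours, and a formula sees
  only finitely many values of the assignment, so back-and-forth applies.\<close>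

lemma rich_embedding_elementary:
  fixes M :: "(unit, 'u) struct" and N :: "(unit, 'v) struct"
  assumes M: "rich_struct M" and N: "rich_struct N" and f: "is_embedding {} M N f"
  shows "is_elementary {} M N f"
  unfolding is_elementary_def
proof (intro conjI ballI allI impI)
  show "f ` carrier M \<subseteq> carrier N"
    using f by (simp add: is_embedding_def)
  fix \<phi> :: "unit fm" and e :: "nat \<Rightarrow> 'u" assume \<phi>: "\<phi> \<in> formulas {}" and e: "range e \<subseteq> carrier M"
  have emb: "emb_on (carrier M) (csb_of M) (csb_of N) f"
    using emb_on_of_embedding[OF _ rich_determined _ f] M N by (simp add: rich_struct_def)
  have "sat M e \<phi> \<longleftrightarrow> sat N (f \<circ> e) \<phi>"
  proof (rule emb_sat[OF M N])
    show "finite (e ` fv \<phi>)" using finite_fv by blast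
    show "e ` fv \<phi> \<subseteq> carrier M" using e by auto
    then show "emb_on (e ` fv \<phi>) (csb_of M) (csb_of N) f"
      using emb_on_subset[OF emb] by blast
  qed (use \<phi> in \<open>auto simp: formulas_def\<close>)
  then show "sat N (f \<circ> e) \<phi> \<longleftrightarrow> sat M e \<phi>" by simp
qed

text \<open>The empty map is a partial embedding, so back-and-forth yields completeness.\<close>

lemma rich_elementarily_equivalent:
  fixes M :: "(unit, 'u) struct" and N :: "(unit, 'v) struct"
  assumes "rich_struct M" "rich_struct N" "\<phi> \<in> sentences {}"
  shows "sat M e \<phi> \<longleftrightarrow> sat N e' \<phi>"
  using emb_sat[OF assms(1,2) finite.emptyI _ emb_on_empty] sentencesD[OF assms(3)] by blast

lemma diagram_embedding:
  assumes f: "is_embedding {} M N f" and e: "e ` {..<n} \<subseteq> carrier M" and sat: "sat M e (diagram T n)"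
  shows "sat N (f \<circ> e) (diagram T n)"
proof -
  have eC: "e i \<in> carrier M" if "i < n" for i
    using e that by auto
  have f_eq: "f x = f y \<longleftrightarrow> x = y" if "x \<in> carrier M" "y \<in> carrier M" for x y
    using f that by (auto simp: is_embedding_def inj_on_eq_iff)
  have less: "less_rel N (f x) (f y) (f z) (f w) \<longleftrightarrow> less_rel M x y z w"
    if "x \<in> carrier M" "y \<in> carrier M" "z \<in> carrier M" "w \<in> carrier M" for x y z w
    using f that by (simp add: is_embedding_def)
  have fC: "f x \<in> carrier N" if "x \<in> carrier M" for x
    using f that by (auto simp: is_embedding_def)
  have "\<exists>y\<in>carrier N. if col T i {j, k} then less_rel N (f (e i)) y (f (e j)) (f (e k))
           else less_rel N (f (e j)) (f (e k)) (f (e i)) y"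
    if i: "i < n" "j < n" "k < n" "i \<noteq> j \<and> i \<noteq> k \<and> j \<noteq> k" for i j k
  proof -
    have "\<exists>y\<in>carrier M. if col T i {j, k} then less_rel M (e i) y (e j) (e k)
           else less_rel M (e j) (e k) (e i) y"
      using sat i unfolding sat_diagram by simp
    then obtain y where "y \<in> carrier M" "if col T i {j, k} then less_rel M (e i) y (e j) (e k)
           else less_rel M (e j) (e k) (e i) y"
      by blast
    then show ?thesis
      using fC less eC i by (intro bexI[of _ "f y"]) (auto split: if_splits)
  qed
  note 3 = this
  note d = sat[unfolded sat_diagram]
  show ?thesis
    unfolding sat_diagram comp_apply
  proof (intro conjI allI impI)
    show "f (e i) \<noteq> f (e j)" if "i < n" "j < n" "i \<noteq> j" for i j
      using d f_eq eC that by simp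
    show "less_rel N (f (e i)) (f (e j)) (f (e k)) (f (e l)) \<longleftrightarrow> lt T {i, j} {k, l}"
      if "i < n" "j < n" "k < n" "l < n" for i j k l
      using d less eC that by simp
  qed (rule 3)
qed

text \<open>
  A model \<open>M\<close> of a model companion embeds into a rich switchboard \<open>N\<close>, and \<open>N\<close> into a model \<open>L\<close> of
  the companion over which \<open>M\<close> is elementary. Thus \<open>M\<close> is existentially closed in \<open>N\<close> and inherits
  the extension property, as diagrams are existential.
\<close>

lemma companion_model_rich:
  fixes M :: "(unit, 'u) struct"
  assumes inf: "infinite (UNIV :: 'u set)"
    and comp: "model_companion TYPE('u) {} switchboard_theory T" and M: "is_model {} T M"
  shows "rich_struct M"
proof -
  obtain N0 :: "(unit, 'u) struct" and f where N0: "is_model {} switchboard_theory N0" "is_embedding {} M N0 f"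
    using comp M unfolding model_companion_def by blast
  obtain N :: "(unit, 'u) struct" and h where N: "rich_struct N" and h: "is_embedding {} N0 N h"
    using rich_struct_embedding[OF inf N0(1)] by blast
  obtain L :: "(unit, 'u) struct" and g where L: "is_model {} T L" "is_embedding {} N L g"
    using comp rich_struct_model[OF N] unfolding model_companion_def by blast
  define k where "k = h \<circ> f"
  have k: "is_embedding {} M N k"
    unfolding k_def using is_embedding_comp[OF N0(2) h] .
  have "is_elementary {} M L (g \<circ> k)"
    using comp M L(1) is_embedding_comp[OF k L(2)] unfolding model_companion_def model_complete_def by blast
  then have elem: "sat L ((g \<circ> k) \<circ> e) \<phi> \<longleftrightarrow> sat M e \<phi>"
    if "fm_consts \<phi> = {}" "range e \<subseteq> carrier M" for \<phi> :: "unit fm" and e :: "nat \<Rightarrow> 'u"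
    using that unfolding is_elementary_def formulas_def by blast
  have ne: "carrier M \<noteq> {}"
    using M by (simp add: is_model_def is_struct_def)
  then obtain x0 where x0: "x0 \<in> carrier M" by blast
  have sb: "sb_struct M"
    using sb_struct_substructure[OF N0 ne] .
  have sbN: "sb_struct N" and richN: "rich (csb_of N)"
    using N by (simp_all add: rich_struct_def)
  note cN = is_csbD[OF sb_structD(1)[OF sbN]]
  have kC: "k x \<in> carrier N" if "x \<in> carrier M" for x
    using k that by (auto simp: is_embedding_def)
  have k_inj: "inj_on k (carrier M)"
    using k by (simp add: is_embedding_def)
  \<comment> \<open>Existential closedness of \<open>M\<close> in \<open>N\<close>: the witness is
    sent on from \<open>N\<close> into \<open>L\<close>, and elementarity of \<open>M\<close> in
    \<open>L\<close> brings the existential statement back.\<close>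
  have pull_back: "\<exists>b\<in>carrier M. sat M (e(n := b)) (diagram T' m)"
    if e: "range e \<subseteq> carrier M" and b: "b \<in> carrier N" "sat N ((k \<circ> e)(n := b)) (diagram T' m)"
    for e :: "nat \<Rightarrow> 'u" and n b T' m
  proof -
    have "((k \<circ> e)(n := b)) ` {..<m} \<subseteq> carrier N"
      using e kC b(1) by auto
    from diagram_embedding[OF L(2) this b(2)]
    have "sat L (((g \<circ> k) \<circ> e)(n := g b)) (diagram T' m)"
      by (simp add: fun_upd_comp comp_assoc)
    moreover have "g b \<in> carrier L"
      using L(2) b(1) by (auto simp: is_embedding_def)
    ultimately have "sat L ((g \<circ> k) \<circ> e) (Ex n (diagram T' m))"
      by auto
    then have "sat M e (Ex n (diagram T' m))"
      using elem[OF _ e, of "Ex n (diagram T' m)"] by (simp add: fm_consts_diagram)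
    then show ?thesis by simp
  qed
  have less: "less_rel N (k x) (k y) (k z) (k w) \<longleftrightarrow> less_rel M x y z w"
    if "x \<in> carrier M" "y \<in> carrier M" "z \<in> carrier M" "w \<in> carrier M" for x y z w
    using k that by (simp add: is_embedding_def)
  have elem_less: "(\<exists>b\<in>carrier L. less_rel L (g (k x)) b (g (k u)) (g (k v))) \<longleftrightarrow> (\<exists>y\<in>carrier M. less_rel M x y u v)"
    "(\<exists>b\<in>carrier L. less_rel L (g (k u)) (g (k v)) (g (k x)) b) \<longleftrightarrow> (\<exists>y\<in>carrier M. less_rel M u v x y)"
    if x: "x \<in> carrier M" "u \<in> carrier M" "v \<in> carrier M" for x u v
  proof -
    define e where "e i = (if i = 0 then x else if i = 1 then u else v)" for i :: nat
    have "range e \<subseteq> carrier M"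
      using x by (auto simp: e_def)
    from elem[OF _ this, of "Ex 3 (Less (Var 0) (Var 3) (Var 1) (Var 2))"]
      elem[OF _ this, of "Ex 3 (Less (Var 1) (Var 2) (Var 0) (Var 3))"]
    show "(\<exists>b\<in>carrier L. less_rel L (g (k x)) b (g (k u)) (g (k v))) \<longleftrightarrow> (\<exists>y\<in>carrier M. less_rel M x y u v)"
      "(\<exists>b\<in>carrier L. less_rel L (g (k u)) (g (k v)) (g (k x)) b) \<longleftrightarrow> (\<exists>y\<in>carrier M. less_rel M u v x y)"
      by (simp_all add: e_def)
  qed
  have up: "less_rel L (g x) (g y) (g z) (g w)" "g y \<in> carrier L"
    if "less_rel N x y z w" "x \<in> carrier N" "y \<in> carrier N" "z \<in> carrier N" "w \<in> carrier N" for x y z w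
    using L(2) that by (auto simp: is_embedding_def)
  have lt_cases: "(\<exists>y\<in>carrier M. lt (csb_of M) {x, y} e) \<or> (\<exists>y\<in>carrier M. lt (csb_of M) e {x, y})"
    if x: "x \<in> carrier M" "e \<in> edges (carrier M)" "x \<notin> e" for x e
  proof -
    obtain u v where uv: "e = {u, v}" "u \<in> carrier M" "v \<in> carrier M" "u \<noteq> v"
      using edgesE[OF x(2)] by blast
    have "k x \<notin> {k u, k v}" "{k u, k v} \<in> edges (carrier N)"
      using uv x kC k_inj by (auto simp: doubleton_in_edges inj_on_eq_iff)
    then obtain b where b: "b \<in> carrier N" "lt (csb_of N) {k x, b} {k u, k v} \<or> lt (csb_of N) {k u, k v} {k x, b}"
      using determinedD[OF rich_determined[OF richN], of "k x" "{k u, k v}"] kC[OF x(1)]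
      unfolding pts_csb_of by blast
    note kuv = kC[OF uv(2)] kC[OF uv(3)] kC[OF x(1)]
    from b(2) show ?thesis
    proof
      assume "lt (csb_of N) {k x, b} {k u, k v}"
      then have "less_rel N (k x) b (k u) (k v)"
        using sb_structD(2)[OF sbN kuv(3) b(1) kuv(1,2)] by simp
      then obtain y where "y \<in> carrier M" "less_rel M x y u v"
        using up[OF _ kuv(3) b(1) kuv(1,2)] elem_less(1)[OF x(1) uv(2,3)] by blast
      then show ?thesis
        using sb_structD(2)[OF sb x(1) _ uv(2,3)] uv(1) by blast
    next
      assume "lt (csb_of N) {k u, k v} {k x, b}"
      then have "less_rel N (k u) (k v) (k x) b"
        using sb_structD(2)[OF sbN kuv(1-3) b(1)] by simp
      moreover have "g b \<in> carrier L"
        using L(2) b(1) by (auto simp: is_embedding_def)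
      ultimately obtain y where "y \<in> carrier M" "less_rel M u v x y"
        using up(1)[OF _ kuv(1-3) b(1)] elem_less(2)[OF x(1) uv(2,3)] by blast
      then show ?thesis
        using sb_structD(2)[OF sb uv(2,3) x(1)] uv(1) by blast
    qed
  qed
  \<comment> \<open>So far \<open>k\<close> is only known to preserve the order. It respects the
    colours once each colour of \<open>M\<close> has a witness.\<close>
  have detM: "determined (csb_of M)"
    by (rule determinedI[OF sb_structD(1)[OF sb]]) (use lt_cases in simp)
  have emb: "emb_on (carrier M) (csb_of M) (csb_of N) k"
    using emb_on_of_embedding[OF sb detM sbN k] .
  have "rich (csb_of M)"
    unfolding rich_def
  proof (intro conjI allI impI)
    show "is_csb (csb_of M)" using sb_structD(1)[OF sb] .
    fix n and T' :: "nat csb" and a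
    assume T': "is_csb T' \<and> pts T' = {..n} \<and> emb_on {..<n} T' (csb_of M) a"
    define e where "e i = (if i < n then a i else x0)" for i
    have ea: "emb_on {..<n} T' (csb_of M) e"
      using T' emb_on_cong[of "{..<n}" e a] by (auto simp: e_def)
    then have e: "range e \<subseteq> carrier M"
      using emb_onD(2)[OF ea] x0 by (auto simp: e_def)
    have "emb_on {..<n} T' (csb_of N) (k \<circ> e)"
      using emb_on_comp'[OF ea emb] e by auto
    then obtain b where b: "emb_on {..n} T' (csb_of N) ((k \<circ> e)(n := b))"
      using richN T' unfolding rich_def by blast
    then have "sat N ((k \<circ> e)(n := b)) (diagram T' (Suc n))"
      using T' by (intro diagram_of_emb_on[OF sbN rich_determined[OF richN]]) (simp_all add: lessThan_Suc_atMost)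
    moreover have "b \<in> carrier N"
      using emb_onD(2)[OF b, of n] by simp
    ultimately obtain b' where b': "b' \<in> carrier M" "sat M (e(n := b')) (diagram T' (Suc n))"
      using pull_back[OF e] by blast
    have "emb_on {..<Suc n} T' (csb_of M) (e(n := b'))"
      using e b' T' by (intro emb_on_of_diagram[OF sb]) auto
    then have "emb_on {..n} T' (csb_of M) (a(n := b'))"
      unfolding lessThan_Suc_atMost using emb_on_cong[of "{..n}" "e(n := b')" "a(n := b')"]
      by (auto simp: e_def)
    then show "\<exists>b. emb_on {..n} T' (csb_of M) (a(n := b))" ..
  qed
  with sb show ?thesis
    by (simp add: rich_struct_def)
qed

lemma rich_theory_companion:
  assumes inf: "infinite (UNIV :: 'u set)"
  shows "model_companion TYPE('u) {} switchboard_theory rich_theory"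
  unfolding model_companion_def model_complete_def models_of_rich_theory
proof (intro conjI allI impI)
  show "rich_theory \<subseteq> sentences {}" by (rule rich_theory_sentences)
  show "is_elementary {} M N f" if "rich_struct M \<and> rich_struct N \<and> is_embedding {} M N f"
    for M N :: "(unit, 'u) struct" and f
    using that rich_embedding_elementary by blast
  show "\<exists>(N :: (unit, 'u) struct) f. rich_struct N \<and> is_embedding {} M N f"
    if "is_model {} switchboard_theory M" for M :: "(unit, 'u) struct"
    using rich_struct_embedding[OF inf that] by blast
  show "\<exists>(N :: (unit, 'u) struct) f. is_model {} switchboard_theory N \<and> is_embedding {} M N f"
    if "rich_struct M" for M :: "(unit, 'u) struct"
    using rich_struct_model[OF that] by (intro exI[of _ M] exI[of _ id]) (auto simp: is_embedding_def)
qed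

section \<open>Downward Loewenheim-Skolem and change of universe\<close>

instance tm :: (countable) countable
  by countable_datatype

instance fm :: (countable) countable
  by countable_datatype

lemma sat_isomorphism:
  fixes M :: "('c, 'u) struct" and N :: "('c, 'v) struct"
  assumes bij: "bij_betw f (carrier M) (carrier N)"
    and less: "\<And>x y z w. x \<in> carrier M \<Longrightarrow> y \<in> carrier M \<Longrightarrow> z \<in> carrier M \<Longrightarrow> w \<in> carrier M \<Longrightarrow>
      less_rel N (f x) (f y) (f z) (f w) \<longleftrightarrow> less_rel M x y z w"
  shows "fm_consts \<phi> = {} \<Longrightarrow> range e \<subseteq> carrier M \<Longrightarrow> sat N (f \<circ> e) \<phi> \<longleftrightarrow> sat M e \<phi>"
proof (induction \<phi> arbitrary: e)
  case (Eq s t)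
  have tm: "tm_val N (f \<circ> e) r = f (tm_val M e r) \<and> tm_val M e r \<in> carrier M" if "tm_consts r = {}" for r
    using that Eq.prems(2) by (cases r) auto
  have s: "tm_val N (f \<circ> e) s = f (tm_val M e s)" "tm_val M e s \<in> carrier M"
    and t: "tm_val N (f \<circ> e) t = f (tm_val M e t)" "tm_val M e t \<in> carrier M"
    using tm[of s] tm[of t] Eq.prems(1) by simp_all
  show ?case
    by (simp only: sat.simps s(1) t(1) inj_on_eq_iff[OF bij_betw_imp_inj_on[OF bij] s(2) t(2)])
next
  case (Less s t u v)
  have tm: "tm_val N (f \<circ> e) r = f (tm_val M e r) \<and> tm_val M e r \<in> carrier M" if "tm_consts r = {}" for r
    using that Less.prems(2) by (cases r) auto
  have r: "tm_consts s = {}" "tm_consts t = {}" "tm_consts u = {}" "tm_consts v = {}"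
    using Less.prems(1) by simp_all
  note tms = tm[OF r(1)] tm[OF r(2)] tm[OF r(3)] tm[OF r(4)]
  show ?case
    by (simp only: sat.simps tms less)
next
  case (Ex v \<phi>)
  have step: "sat N ((f \<circ> e)(v := f a)) \<phi> \<longleftrightarrow> sat M (e(v := a)) \<phi>" if "a \<in> carrier M" for a
  proof -
    have "range (e(v := a)) \<subseteq> carrier M"
      using Ex.prems(2) that by auto
    then have "sat N (f \<circ> e(v := a)) \<phi> \<longleftrightarrow> sat M (e(v := a)) \<phi>"
      by (rule Ex.IH[rotated]) (use Ex.prems(1) in simp)
    then show ?thesis
      unfolding fun_upd_comp .
  qed
  have img: "carrier N = f ` carrier M"
    using bij by (simp add: bij_betw_def)
  show ?case
    unfolding sat.simps img bex_simps(7) by (rule bex_cong[OF refl step])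
qed auto

text \<open>The Skolem hull of one point, built in countably many rounds. Assignments are replaced
  by finite lists, as a formula sees only finitely many variables, and this keeps each round
  countable.\<close>

lemma downward_Loewenheim_Skolem:
  fixes M :: "('c :: countable, 'u) struct"
  assumes ne: "carrier M \<noteq> {}"
  obtains D where "D \<subseteq> carrier M" "D \<noteq> {}" "countable D"
    "\<And>\<phi> e. fm_consts \<phi> = {} \<Longrightarrow> range e \<subseteq> D \<Longrightarrow> sat (M\<lparr>carrier := D\<rparr>) e \<phi> \<longleftrightarrow> sat M e \<phi>"
proof -
  obtain c0 where c0: "c0 \<in> carrier M"
    using ne by blast
  define env where "env l i = (if i < length l then l ! i else c0)" for l :: "'u list" and i
  define wit where "wit = (\<lambda>(\<phi> :: 'c fm, v, l). SOME a. a \<in> carrier M \<and> sat M ((env l)(v := a)) \<phi>)"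
  \<comment> \<open>Where no witness exists, \<open>wit\<close> is an arbitrary value; hence the
    intersection with the carrier.\<close>
  define step where "step X = X \<union> (wit ` (UNIV \<times> UNIV \<times> lists X) \<inter> carrier M)" for X
  define D where "D = (\<Union>n. (step ^^ n) {c0})"
  have mono: "(step ^^ m) {c0} \<subseteq> (step ^^ n) {c0}" if "m \<le> n" for m n
    using that by (rule lift_Suc_mono_le[rotated]) (auto simp: step_def)
  have sub: "(step ^^ n) {c0} \<subseteq> carrier M" for n
    using c0 by (induction n) (auto simp: step_def)
  have count: "countable ((step ^^ n) {c0})" for n
    by (induction n) (auto simp: step_def)
  have D: "D \<subseteq> carrier M" "c0 \<in> D" "countable D"
    using sub count unfolding D_def by (auto intro: exI[of _ 0])
  have closed: "wit (\<phi>, v, l) \<in> D" if l: "set l \<subseteq> D" and w: "wit (\<phi>, v, l) \<in> carrier M" for \<phi> v l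
  proof -
    have "\<exists>n. set l \<subseteq> (step ^^ n) {c0}"
      using l
    proof (induction l)
      case (Cons x l)
      then obtain m n where "set l \<subseteq> (step ^^ m) {c0}" "x \<in> (step ^^ n) {c0}"
        by (auto simp: D_def)
      then have "set (x # l) \<subseteq> (step ^^ max m n) {c0}"
        using mono[of m "max m n"] mono[of n "max m n"] by auto
      then show ?case ..
    qed simp
    then obtain n where "set l \<subseteq> (step ^^ n) {c0}" ..
    then have "wit (\<phi>, v, l) \<in> (step ^^ Suc n) {c0}"
      using w by (auto simp: step_def)
    then show ?thesis
      unfolding D_def by blast
  qed
  have "sat (M\<lparr>carrier := D\<rparr>) e \<phi> \<longleftrightarrow> sat M e \<phi>" if "fm_consts \<phi> = {}" "range e \<subseteq> D" for \<phi> e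
    using that
  proof (induction \<phi> arbitrary: e)
    case (Eq s t)
    have "tm_val (M\<lparr>carrier := D\<rparr>) e r = tm_val M e r" for r
      by (cases r) auto
    then show ?case by simp
  next
    case (Less s t u v)
    have "tm_val (M\<lparr>carrier := D\<rparr>) e r = tm_val M e r" for r
      by (cases r) auto
    then show ?case by simp
  next
    case (Ex v \<phi>)
    have eD: "range (e(v := a)) \<subseteq> D" if "a \<in> D" for a
      using Ex.prems(2) that by auto
    have IH: "sat (M\<lparr>carrier := D\<rparr>) (e(v := a)) \<phi> \<longleftrightarrow> sat M (e(v := a)) \<phi>" if "a \<in> D" for a
      by (rule Ex.IH[OF _ eD[OF that]]) (use Ex.prems(1) in simp)
    have "\<exists>a\<in>D. sat M (e(v := a)) \<phi>" if "a \<in> carrier M" "sat M (e(v := a)) \<phi>" for a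
    proof -
      obtain N where N: "\<forall>w\<in>fv \<phi>. w < N"
        using finite_fv[of \<phi>] finite_nat_set_iff_bounded by blast
      define l where "l = map e [0..<N]"
      have cong: "sat M ((env l)(v := b)) \<phi> \<longleftrightarrow> sat M (e(v := b)) \<phi>" for b
        using N Ex.prems(1) by (intro sat_cong) (auto simp: env_def l_def)
      have wl: "wit (\<phi>, v, l) \<in> carrier M \<and> sat M ((env l)(v := wit (\<phi>, v, l))) \<phi>"
        unfolding wit_def prod.case
        by (rule someI[of "\<lambda>a. a \<in> carrier M \<and> sat M ((env l)(v := a)) \<phi>" a]) (use that cong in simp)
      moreover have "set l \<subseteq> D"
        using Ex.prems(2) by (auto simp: l_def)
      ultimately show ?thesis
        using closed cong by blast
    qed
    then show ?case
      using IH D(1) by auto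
  qed auto
  with D that show thesis by blast
qed

text \<open>The companion is given over \<open>nat\<close> only; this brings the complete theory of
  a structure from any universe to that type.\<close>

lemma countable_elementary_substructure:
  fixes M :: "(unit, 'u) struct"
  assumes ne: "carrier M \<noteq> {}"
  obtains N :: "(unit, nat) struct" where "carrier N \<noteq> {}"
    "\<And>\<phi> e e'. \<phi> \<in> sentences {} \<Longrightarrow> sat N e \<phi> \<longleftrightarrow> sat M e' \<phi>"
proof -
  obtain D where D: "D \<subseteq> carrier M" "D \<noteq> {}" "countable D"
    and elem: "\<And>\<phi> e. fm_consts \<phi> = {} \<Longrightarrow> range e \<subseteq> D \<Longrightarrow> sat (M\<lparr>carrier := D\<rparr>) e \<phi> \<longleftrightarrow> sat M e \<phi>"
    using downward_Loewenheim_Skolem[OF ne] by metis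
  define f where "f = to_nat_on D"
  have inj: "inj_on f D"
    unfolding f_def using D(3) by (rule inj_on_to_nat_on)
  define N :: "(unit, nat) struct" where "N = \<lparr>carrier = f ` D,
    less_rel = \<lambda>x y z w. less_rel M (inv_into D f x) (inv_into D f y) (inv_into D f z) (inv_into D f w),
    const_val = undefined\<rparr>"
  have iso: "sat N (f \<circ> e) \<phi> \<longleftrightarrow> sat (M\<lparr>carrier := D\<rparr>) e \<phi>" if "fm_consts \<phi> = {}" "range e \<subseteq> D" for \<phi> e
    by (rule sat_isomorphism) (use that inj in \<open>auto simp: N_def bij_betw_def\<close>)
  obtain d where d: "d \<in> D"
    using D(2) by blast
  have "sat N e \<phi> \<longleftrightarrow> sat M e' \<phi>" if \<phi>: "\<phi> \<in> sentences {}" for \<phi> e e'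
  proof -
    have c: "fm_consts \<phi> = {}" "fv \<phi> = {}"
      using sentencesD[OF \<phi>] by simp_all
    have r: "range (\<lambda>_ :: nat. d) \<subseteq> D"
      using d by auto
    have "sat N e \<phi> \<longleftrightarrow> sat N (f \<circ> (\<lambda>_. d)) \<phi>"
      using c by (intro sat_cong) auto
    also have "\<dots> \<longleftrightarrow> sat M (\<lambda>_. d) \<phi>"
      using iso[OF c(1) r] elem[OF c(1) r] by simp
    also have "\<dots> \<longleftrightarrow> sat M e' \<phi>"
      using c by (intro sat_cong) auto
    finally show ?thesis .
  qed
  moreover have "carrier N \<noteq> {}"
    using D(2) by (simp add: N_def)
  ultimately show thesis
    using that by blast
qed

text \<open>A model of \<open>T\<close> has an elementarily equivalent copy over \<open>nat\<close>,
  which is rich, and the axioms of \<open>rich_theory\<close> return along the equivalence.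
  Conversely, a rich structure is elementarily equivalent to a model of \<open>T\<close> over
  \<open>nat\<close>, because that model is rich too.\<close>

lemma companion_models:
  fixes M :: "(unit, 'u) struct"
  assumes comp: "model_companion TYPE(nat) {} switchboard_theory T"
  shows "is_model {} T M \<longleftrightarrow> rich_struct M"
proof -
  have T: "T \<subseteq> sentences {}"
    using comp by (simp add: model_companion_def)
  have nat: "infinite (UNIV :: nat set)"
    by simp
  show ?thesis
  proof
    assume M: "is_model {} T M"
    then have ne: "carrier M \<noteq> {}"
      by (simp add: is_model_def is_struct_def)
    obtain N :: "(unit, nat) struct" where N: "carrier N \<noteq> {}"
      and eq: "\<And>\<phi> e e'. \<phi> \<in> sentences {} \<Longrightarrow> sat N e \<phi> \<longleftrightarrow> sat M e' \<phi>"
      using countable_elementary_substructure[OF ne] by metis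
    have "is_model {} T N"
      using M eq T unfolding is_model_sentences[OF T ne] is_model_sentences[OF T N] by blast
    then have "is_model {} rich_theory N"
      using companion_model_rich[OF nat comp] by (simp add: models_of_rich_theory)
    then have "is_model {} rich_theory M"
      using eq rich_theory_sentences
      unfolding is_model_sentences[OF rich_theory_sentences ne] is_model_sentences[OF rich_theory_sentences N]
      by blast
    then show "rich_struct M"
      by (simp add: models_of_rich_theory)
  next
    assume M: "rich_struct M"
    obtain R :: "(unit, nat) struct" where R: "rich_struct R"
      using rich_struct_exists[OF nat] by blast
    then obtain N :: "(unit, nat) struct" where N: "is_model {} T N"
      using comp rich_struct_model unfolding model_companion_def by blast
    then have "rich_struct N"
      by (rule companion_model_rich[OF nat comp])
    then have "sat M e \<phi>" if "\<phi> \<in> T" for \<phi> e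
      using rich_elementarily_equivalent[OF M, of N \<phi> e] that T N is_model_sentences[OF T rich_struct_nonempty[of N]]
      by blast
    then show "is_model {} T M"
      by (simp add: is_model_sentences[OF T rich_struct_nonempty[OF M]])
  qed
qed

lemma companion_universe:
  assumes inf: "infinite (UNIV :: 'u set)"
    and comp: "model_companion TYPE(nat) {} switchboard_theory T"
  shows "model_companion TYPE('u) {} switchboard_theory T"
proof -
  have "is_model {} T M \<longleftrightarrow> is_model {} rich_theory M" for M :: "(unit, 'u) struct"
    by (simp add: companion_models[OF comp] models_of_rich_theory)
  moreover have "T \<subseteq> sentences {}"
    using comp by (simp add: model_companion_def)
  ultimately show ?thesis
    using rich_theory_companion[OF inf] by (simp add: model_companion_def model_complete_def)
qed

section \<open>Categoricity\<close>

lemma rich_countable_isomorphic: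
  assumes S: "rich S" "countable (pts S)" and S': "rich S'" "countable (pts S')"
  obtains f where "bij_betw f (pts S) (pts S')" "emb_on (pts S) S S' f"
proof -
  have ne: "pts S \<noteq> {}" "pts S' \<noteq> {}"
    using rich_infinite[OF S(1)] rich_infinite[OF S'(1)] by auto
  define m where "m = from_nat_into (pts S)"
  define m' where "m' = from_nat_into (pts S')"
  have m: "range m = pts S" "range m' = pts S'"
    unfolding m_def m'_def using ne S(2) S'(2) by (simp_all add: range_from_nat_into)
  note csb = rich_csb[OF S(1)] rich_csb[OF S'(1)]
  let ?P = "\<lambda>(_ :: nat) (Y, h). finite Y \<and> Y \<subseteq> pts S \<and> emb_on Y S S' h"
  \<comment> \<open>Stage \<open>n\<close> puts the \<open>n\<close>-th point of each side into the
    map, by one forth and one back step.\<close>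
  let ?Q = "\<lambda>n (Y, h) (Y', h'). Y \<subseteq> Y' \<and> (\<forall>y\<in>Y. h' y = h y) \<and> m n \<in> Y' \<and> m' n \<in> h' ` Y'"
  have "\<exists>F. \<forall>n. ?P n (F n) \<and> ?Q n (F n) (F (Suc n))"
  proof (rule dependent_nat_choice)
    show "\<exists>x. ?P 0 x"
      using emb_on_empty[of S S'] by (intro exI[of _ "({}, undefined)"]) simp
  next
    fix x n assume "?P n x"
    then obtain Y h where x: "x = (Y, h)" and Y: "finite Y" "Y \<subseteq> pts S" and h: "emb_on Y S S' h"
      by (cases x) auto
    have mn: "m n \<in> pts S" "m' n \<in> pts S'"
      using m by auto
    obtain d' where d': "emb_on (insert (m n) Y) S S' (h(m n := d'))" "m n \<in> Y \<Longrightarrow> d' = h (m n)"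
      using forth_point[OF S'(1) csb(1) Y h mn(1)] by blast
    let ?Y1 = "insert (m n) Y" and ?h1 = "h(m n := d')"
    have Y1: "finite ?Y1" "?Y1 \<subseteq> pts S"
      using Y mn by auto
    obtain d where d: "d \<in> pts S" "emb_on (insert d ?Y1) S S' (?h1(d := m' n))" "d \<in> ?Y1 \<Longrightarrow> m' n = ?h1 d"
      using back_point[OF S(1) csb(2) Y1 d'(1) mn(2)] by blast
    have "\<forall>y\<in>?Y1. (?h1(d := m' n)) y = ?h1 y"
      using d(3) by auto
    then have "\<forall>y\<in>Y. (?h1(d := m' n)) y = h y"
      using d'(2) by auto
    moreover have "m' n \<in> (?h1(d := m' n)) ` insert d ?Y1"
      by (metis fun_upd_same image_insert insertI1)
    ultimately have "?Q n x (insert d ?Y1, ?h1(d := m' n))"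
      unfolding x by auto
    moreover have "?P (Suc n) (insert d ?Y1, ?h1(d := m' n))"
      using d(1,2) Y1 by simp
    ultimately show "\<exists>y. ?P (Suc n) y \<and> ?Q n x y"
      by (intro exI[of _ "(insert d ?Y1, ?h1(d := m' n))"] conjI)
  qed
  then obtain F where F: "\<forall>n. ?P n (F n) \<and> ?Q n (F n) (F (Suc n))" ..
  define Y where "Y n = fst (F n)" for n
  define h where "h n = snd (F n)" for n
  have Y: "Y n \<subseteq> pts S" "emb_on (Y n) S S' (h n)" "Y n \<subseteq> Y (Suc n)"
    "\<forall>y\<in>Y n. h (Suc n) y = h n y" "m n \<in> Y (Suc n)" "m' n \<in> h (Suc n) ` Y (Suc n)" for n
    using spec[OF F, of n] unfolding Y_def h_def by (simp_all add: case_prod_beta)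
  have Y_mono: "Y i \<subseteq> Y j" if "i \<le> j" for i j
    using that Y(3) by (rule lift_Suc_mono_le[rotated])
  have h_eq: "h j y = h i y" if "i \<le> j" "y \<in> Y i" for i j y
    using that(1)
  proof (induction j rule: dec_induct)
    case (step j)
    then show ?case using Y(4)[of j] Y_mono[of i j] that(2) by auto
  qed simp
  have cover: "\<exists>n. x \<in> Y n" if x: "x \<in> pts S" for x
  proof -
    obtain n where "x = m n"
      using x m(1) by blast
    then show ?thesis using Y(5) by blast
  qed
  \<comment> \<open>Later stages agree with earlier ones, so the first stage containing
    \<open>x\<close> may decide its value.\<close>
  define f where "f x = h (LEAST n. x \<in> Y n) x" for x
  have f: "f x = h n x" if "x \<in> Y n" for x n
    unfolding f_def using h_eq[of "LEAST n. x \<in> Y n" n x] that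
    by (metis (mono_tags) LeastI_ex Least_le)
  have emb: "emb_on (Y n) S S' f" for n
    using Y(2)[of n] f emb_on_cong[of "Y n" f "h n"] by blast
  have up: "\<exists>n. X \<subseteq> Y n" if "finite X" "X \<subseteq> pts S" for X
    using that
  proof (induction X rule: finite_induct)
    case (insert x X)
    then obtain i j where "X \<subseteq> Y i" "x \<in> Y j"
      using cover by (meson insert_subset)
    then have "insert x X \<subseteq> Y (max i j)"
      using Y_mono[of i "max i j"] Y_mono[of j "max i j"] by auto
    then show ?case ..
  qed simp
  have two: "\<exists>n. e \<union> g \<subseteq> Y n" if "e \<in> edges (pts S)" "g \<in> edges (pts S)" for e g
  proof (rule up)
    show "finite (e \<union> g)"
      using that finite_edge by blast
    show "e \<union> g \<subseteq> pts S"
      using that edges_subset by blast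
  qed
  have inY: "e \<in> edges (Y n)" if "e \<in> edges (pts S)" "e \<subseteq> Y n" for e n
    using that by (simp add: edges_def)
  have inj: "inj_on f (pts S)"
  proof (rule inj_onI)
    fix x y assume xy: "x \<in> pts S" "y \<in> pts S" "f x = f y"
    obtain n where "{x, y} \<subseteq> Y n"
      using up[of "{x, y}"] xy by auto
    then show "x = y"
      using emb_onD(1)[OF emb] xy(3) by (auto dest: inj_onD)
  qed
  have img: "f ` pts S = pts S'"
  proof
    show "f ` pts S \<subseteq> pts S'"
      using cover emb_onD(2)[OF emb] by blast
    show "pts S' \<subseteq> f ` pts S"
    proof
      fix z assume "z \<in> pts S'"
      then obtain n where "z = m' n"
        using m(2) by blast
      then obtain x where "x \<in> Y (Suc n)" "z = h (Suc n) x"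
        using Y(6)[of n] by blast
      then have "z = f x" "x \<in> pts S"
        using f[of x "Suc n"] Y(1)[of "Suc n"] by auto
      then show "z \<in> f ` pts S"
        by simp
    qed
  qed
  have "emb_on (pts S) S S' f"
    unfolding emb_on_def
  proof (intro conjI ballI)
    show "lt S' (f ` e) (f ` g) \<longleftrightarrow> lt S e g" if eg: "e \<in> edges (pts S)" "g \<in> edges (pts S)" for e g
    proof -
      obtain n where n: "e \<union> g \<subseteq> Y n"
        using two[OF eg] by blast
      show ?thesis
        using emb_onD(3)[OF emb inY[OF eg(1)] inY[OF eg(2)]] n by blast
    qed
    show "col S' (f x) (f ` e) \<longleftrightarrow> col S x e" if xe: "x \<in> pts S" "e \<in> edges (pts S)" for x e
    proof -
      obtain n where n: "insert x e \<subseteq> Y n"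
        using up[of "insert x e"] xe(1) edges_subset[OF xe(2)] finite_edge[OF xe(2)] by auto
      show ?thesis
        using emb_onD(4)[OF emb _ inY[OF xe(2)]] n by blast
    qed
  qed (use inj img in auto)
  with inj img that show thesis
    by (auto simp: bij_betw_def)
qed

lemma rich_aleph0_categorical:
  assumes inf: "infinite (UNIV :: 'u set)"
    and T: "\<And>M :: (unit, 'u) struct. is_model {} T M \<longleftrightarrow> rich_struct M"
  shows "aleph0_categorical TYPE('u) {} T"
  unfolding aleph0_categorical_def T
proof (intro conjI allI impI)
  \<comment> \<open>Over \<open>nat\<close> every rich structure is countable; an injection moves
    one into the given universe.\<close>
  obtain S :: "nat csb" where S: "rich S"
    using rich_extension[OF infinite_UNIV_nat trivial_csb[of "{}"]] by blast
  obtain j :: "nat \<Rightarrow> 'u" where j: "inj j"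
    using infinite_countable_subset[OF inf] by blast
  define S' where "S' = pull (j ` pts S) (inv j) S"
  have "bij_betw (inv j) (j ` pts S) (pts S)"
    using j by (auto simp: bij_betw_def inj_on_def)
  then have S': "rich S'"
    unfolding S'_def by (rule rich_pull[OF S])
  have "countable (pts S')"
    by (simp add: S'_def)
  with S' show "\<exists>M :: (unit, 'u) struct. rich_struct M \<and> countable (carrier M) \<and> infinite (carrier M)"
    using rich_struct_of[OF S'] rich_infinite[OF S']
    by (intro exI[of _ "struct_of S'"]) (simp add: struct_of_def)
next
  fix M N :: "(unit, 'u) struct"
  assume "rich_struct M \<and> countable (carrier M) \<and> infinite (carrier M) \<and>
    rich_struct N \<and> countable (carrier N) \<and> infinite (carrier N)"
  then have R: "sb_struct M" "sb_struct N" "rich (csb_of M)" "rich (csb_of N)"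
    "countable (carrier M)" "countable (carrier N)"
    by (simp_all add: rich_struct_def)
  obtain f where f: "bij_betw f (carrier M) (carrier N)" "emb_on (carrier M) (csb_of M) (csb_of N) f"
    using rich_countable_isomorphic[OF R(3) _ R(4)] R(5,6) by auto
  then show "\<exists>f. is_isomorphism {} M N f"
    using is_embedding_of_emb_on[OF R(1,2)] by (auto simp: is_isomorphism_def bij_betw_def)
qed

section \<open>The strict order property\<close>

text \<open>Two parameters name an edge, and the edges below it form a definable set. Along an
  increasing sequence these sets grow strictly, as each edge lies below the next but not below
  itself.\<close>

lemma rich_theory_SOP:
  assumes inf: "infinite (UNIV :: 'u set)"
    and T: "\<And>M :: (unit, 'u) struct. is_model {} T M \<longleftrightarrow> rich_struct M"
  shows "theory_SOP TYPE('u) {} T"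
proof -
  obtain N :: "(unit, 'u) struct" where N: "rich_struct N"
    using rich_struct_exists[OF inf] by blast
  then have sb: "sb_struct N" and rich: "rich (csb_of N)"
    by (simp_all add: rich_struct_def)
  note cN = is_csbD[OF rich_csb[OF rich]]
  obtain g where g: "\<And>i :: nat. g i \<in> edges (carrier N)" "\<And>i. lt (csb_of N) (g i) (g (Suc i))"
    using rich_increasing_edges[OF rich] by auto
  have "\<exists>u v. g i = {u, v}" for i
    using edgesE[OF g(1)[of i]] by metis
  then obtain u v where uv: "\<And>i. g i = {u i, v i}"
    by metis
  have C: "u i \<in> carrier N" "v i \<in> carrier N" for i
    using g(1)[of i] uv by (auto dest: edges_subset)
  define \<phi> :: "unit fm" where "\<phi> = Less (Var 0) (Var 1) (Var 2) (Var 3)"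
  have sol: "solutions N \<phi> [0, 1] [2, 3] [u i, v i] =
      {[x, y] |x y. x \<in> carrier N \<and> y \<in> carrier N \<and> lt (csb_of N) {x, y} (g i)}" for i
  proof -
    have "a \<in> solutions N \<phi> [0, 1] [2, 3] [u i, v i] \<longleftrightarrow>
        (\<exists>x y. a = [x, y] \<and> x \<in> carrier N \<and> y \<in> carrier N \<and> less_rel N x y (u i) (v i))" for a
      by (auto simp: solutions_def tuples_def \<phi>_def length_Suc_conv)
    then show ?thesis
      using sb_structD(2)[OF sb _ _ C] uv by auto
  qed
  have "solutions N \<phi> [0, 1] [2, 3] [u i, v i] \<subset> solutions N \<phi> [0, 1] [2, 3] [u (Suc i), v (Suc i)]" for i
  proof
    show "solutions N \<phi> [0, 1] [2, 3] [u i, v i] \<subseteq> solutions N \<phi> [0, 1] [2, 3] [u (Suc i), v (Suc i)]"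
      unfolding sol using cN(5)[OF _ g(2)] by auto
    have "[u i, v i] \<in> solutions N \<phi> [0, 1] [2, 3] [u (Suc i), v (Suc i)]"
      unfolding sol using C g(2) uv by auto
    moreover have "[u i, v i] \<notin> solutions N \<phi> [0, 1] [2, 3] [u i, v i]"
      unfolding sol using cN(9)[of "g i" "g i" "u i"] uv by auto
    ultimately show "solutions N \<phi> [0, 1] [2, 3] [u i, v i] \<noteq> solutions N \<phi> [0, 1] [2, 3] [u (Suc i), v (Suc i)]"
      by blast
  qed
  then have "formula_SOP TYPE('u) {} T \<phi> [0, 1] [2, 3]"
    unfolding formula_SOP_def using N C T
    by (intro exI[of _ N] exI[of _ "\<lambda>i. [u i, v i]"]) (simp add: tuples_def)
  moreover have "partitioned {} \<phi> [0, 1] [2, 3]"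
    by (auto simp: partitioned_def formulas_def \<phi>_def)
  ultimately show ?thesis
    unfolding theory_SOP_def by blast
qed

section \<open>NSOP for single parameters\<close>

text \<open>The rich axioms are constant-free sentences true in \<open>M\<close>, so their copies in
  the language with names for \<open>M\<close> belong to the elementary diagram.\<close>

lemma elementary_diagram_model_rich:
  fixes M :: "(unit, 'u) struct" and N :: "('u, 'u) struct"
  assumes M: "rich_struct M" and N: "is_model (carrier M) (elementary_diagram M) N"
  shows "rich_struct N"
proof -
  define N' :: "(unit, 'u) struct" where
    "N' = \<lparr>carrier = carrier N, less_rel = less_rel N, const_val = undefined\<rparr>"
  have N': "carrier N' = carrier N" "less_rel N' = less_rel N"
    by (simp_all add: N'_def)
  have M': "carrier M = carrier (name_elements M)" "less_rel M = less_rel (name_elements M)"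
    by (simp_all add: name_elements_def)
  have "sat N' e \<phi>" if \<phi>: "\<phi> \<in> rich_theory" and e: "range e \<subseteq> carrier N" for \<phi> e
  proof -
    let ?\<phi> = "map_fm (\<lambda>_. undefined :: 'u) \<phi>"
    have c: "fm_consts \<phi> = {}" "fv \<phi> = {}"
      using sentencesD rich_theory_sentences \<phi> by blast+
    have "sat (name_elements M) e ?\<phi>" if "range e \<subseteq> carrier M" for e
      using sat_transfer[OF M', of \<phi> e e] c(1) that M \<phi> models_of_rich_theory[of M]
      unfolding is_model_def by blast
    moreover have "?\<phi> \<in> sentences (carrier M)"
      using c by (simp add: sentences_def formulas_def fv_map_fm fm.set_map)
    ultimately have "?\<phi> \<in> elementary_diagram M"
      by (simp add: elementary_diagram_def)
    then have "sat N e ?\<phi>"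
      using N e by (simp add: is_model_def)
    then show ?thesis
      using sat_transfer[OF N', of \<phi> e e] c(1) by blast
  qed
  moreover have "carrier N \<noteq> {}"
    using N by (simp add: is_model_def is_struct_def)
  ultimately have "is_model {} rich_theory N'"
    by (simp add: is_model_def is_struct_def N'_def)
  then show ?thesis
    using rich_struct_cong[OF N'] by (simp add: models_of_rich_theory)
qed

text \<open>The map behind the type equality is extended to \<open>t\<close> by forth steps, and its
  value on \<open>t\<close> is \<open>t'\<close>. The same \<open>t'\<close> serves both parameters,
  so inclusions between their solution sets can be compared; \<open>A\<close> holds the constants of
  \<open>\<phi>\<close>, which stay fixed.\<close>

lemma solutions_transfer:
  fixes N :: "('c, 'u) struct"
  assumes N: "rich_struct N" and part: "fv \<phi> \<subseteq> set (xs @ ys)"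
    and A: "finite A" "A \<subseteq> carrier N" "const_val N ` fm_consts \<phi> \<subseteq> A"
    and tp: "tp_eq (csb_of N) A [b, b'] [d, d']" and b: "b \<in> carrier N" "b' \<in> carrier N"
    and ys: "ys = [y]" and t: "t \<in> tuples N xs"
  obtains t' where "t' \<in> tuples N xs"
    "t \<in> solutions N \<phi> xs ys [b] \<longleftrightarrow> t' \<in> solutions N \<phi> xs ys [d]"
    "t \<in> solutions N \<phi> xs ys [b'] \<longleftrightarrow> t' \<in> solutions N \<phi> xs ys [d']"
proof -
  let ?S = "csb_of N"
  have rich: "rich ?S"
    using N by (simp add: rich_struct_def)
  obtain h where h: "emb_on (A \<union> {b, b'}) ?S ?S h" "\<forall>a\<in>A. h a = a" "h b = d" "h b' = d'"
    using tp by (auto simp: tp_eq_def)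
  have t': "length t = length xs" "set t \<subseteq> carrier N"
    using t by (simp_all add: tuples_def)
  let ?Y = "A \<union> {b, b'} \<union> set t"
  obtain k where k: "emb_on ?Y ?S ?S k" "\<And>z. z \<in> A \<union> {b, b'} \<Longrightarrow> k z = h z"
    using forth_finite[OF rich rich_csb[OF rich] _ _ h(1), of "set t"] A(1,2) b t'(2) by auto
  have Y: "finite ?Y" "?Y \<subseteq> carrier N"
    using A(1,2) b t'(2) by auto
  have mem: "map k t \<in> tuples N xs"
    using t' emb_onD(2)[OF k(1)] by (auto simp: tuples_def)
  have sol: "t \<in> solutions N \<phi> xs ys [c] \<longleftrightarrow> map k t \<in> solutions N \<phi> xs ys [k c]" if c: "c \<in> {b, b'}" for c
  proof -
    let ?e = "\<lambda>v. the (map_of (zip (xs @ ys) (t @ [c])) v)"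
    let ?e' = "\<lambda>v. the (map_of (zip (xs @ ys) (map k t @ [k c])) v)"
    have len: "length (xs @ ys) = length (t @ [c])"
      using t'(1) ys by simp
    have "?e v \<in> ?Y \<and> ?e' v = k (?e v)" if v: "v \<in> fv \<phi>" for v
    proof -
      have "v \<in> set (xs @ ys)"
        using v part by blast
      then obtain z where z: "map_of (zip (xs @ ys) (t @ [c])) v = Some z"
        using map_of_zip_is_Some[OF len] by blast
      then have "z \<in> set (t @ [c])"
        by (auto dest!: map_of_SomeD set_zip_rightD)
      moreover have "map_of (zip (xs @ ys) (map k t @ [k c])) v = Some (k z)"
      proof -
        have "zip (xs @ ys) (map k t @ [k c]) = map (\<lambda>(i, z). (i, k z)) (zip (xs @ ys) (t @ [c]))"
          using zip_map2[of "xs @ ys" k "t @ [c]"] by simp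
        then show ?thesis
          using z by (simp add: map_of_map)
      qed
      ultimately show ?thesis
        using z c by auto
    qed
    moreover have "const_val N a \<in> ?Y \<and> const_val N a = k (const_val N a)" if "a \<in> fm_consts \<phi>" for a
      using that A(3) k(2) h(2) by auto
    ultimately have "sat N ?e \<phi> \<longleftrightarrow> sat N ?e' \<phi>"
      by (intro emb_sat[OF N N Y k(1)]) blast+
    then show ?thesis
      using t mem by (simp add: solutions_def)
  qed
  have "k b = d" "k b' = d'"
    using k(2) h(3,4) by auto
  with sol[of b] sol[of b'] mem that show thesis
    by simp
qed

text \<open>Injectivity leaves finitely many terms of the sequence in \<open>A\<close>, and over a
  finite set there are finitely many types of pairs. So Ramsey's theorem gives an infinite set of
  indices on which the type is constant.\<close>

lemma homogeneous_triple:
  fixes S :: "'a csb" and \<beta> :: "nat \<Rightarrow> 'a"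
  assumes S: "is_csb S" and A: "finite A" "A \<subseteq> pts S" and \<beta>: "inj \<beta>" "range \<beta> \<subseteq> pts S"
  obtains i j k where "i < j" "j < k" "\<beta> i \<notin> A" "\<beta> j \<notin> A" "\<beta> k \<notin> A"
    "tp_eq S A [\<beta> i, \<beta> j] [\<beta> i, \<beta> k]" "tp_eq S A [\<beta> i, \<beta> j] [\<beta> j, \<beta> k]"
proof -
  define Z where "Z = {i. \<beta> i \<notin> A}"
  have "finite (- Z)"
    using finite_vimageI[OF A(1) \<beta>(1)] by (simp add: Z_def vimage_def Collect_neg_eq[symmetric])
  then have Z: "infinite Z"
    by (metis Compl_eq_Diff_UNIV Diff_infinite_finite double_compl infinite_UNIV_nat)
  \<comment> \<open>A common index set for all pairs: the structures \<open>T i j\<close> then have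
    the same points, and their equality is equality of types over \<open>A\<close>.\<close>
  let ?Y = "Inl ` A \<union> {Inr False, Inr True}"
  define g where "g i j z = (case z of Inl a \<Rightarrow> a | Inr c \<Rightarrow> if c then \<beta> j else \<beta> i)" for i j and z :: "'a + bool"
  define T where "T i j = pull ?Y (g i j) S" for i j
  let ?F = "{T :: ('a + bool) csb. csb_typed T \<and> pts T = ?Y}"
  have fin: "finite ?F"
    using A(1) by (intro finite_csb_on) simp
  define code where "code = to_nat_on ?F"
  have code_inj: "inj_on code ?F"
    unfolding code_def using fin by (intro inj_on_to_nat_on countable_finite)
  have TF: "T i j \<in> ?F" for i j
    by (simp add: T_def csb_typed_pull)
  \<comment> \<open>Presenting the set in increasing order makes homogeneity a statement about types
    of ordered pairs.\<close>
  define colour where "colour K = code (T (Min K) (Max K))" for K :: "nat set"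
  obtain s where s: "code ` ?F \<subseteq> {..<s}"
    using finite_imageI[OF fin, of code] finite_nat_iff_bounded by blast
  have "\<exists>W t. W \<subseteq> Z \<and> infinite W \<and> t < s \<and> (\<forall>x\<in>W. \<forall>y\<in>W. x \<noteq> y \<longrightarrow> colour {x, y} = t)"
  proof (rule Ramsey2[OF Z], intro ballI impI)
    show "colour {x, y} < s" for x y
      unfolding colour_def using s TF by blast
  qed
  then obtain W t where W: "W \<subseteq> Z" "infinite W" "\<forall>x\<in>W. \<forall>y\<in>W. x \<noteq> y \<longrightarrow> colour {x, y} = t"
    by blast
  obtain i where i: "i \<in> W"
    using infinite_imp_nonempty[OF W(2)] by blast
  obtain j where j: "j \<in> W" "i < j"
    using W(2) infinite_nat_iff_unbounded by blast
  obtain k where k: "k \<in> W" "j < k"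
    using W(2) infinite_nat_iff_unbounded by blast
  have code_eq: "code (T x y) = t" if "x \<in> W" "y \<in> W" "x < y" for x y
  proof -
    have "colour {x, y} = t"
      using W(3) that by auto
    then show ?thesis
      using that(3) by (simp add: colour_def)
  qed
  have tp: "tp_eq S A [\<beta> x, \<beta> y] [\<beta> x', \<beta> y']"
    if x: "x \<in> W" "y \<in> W" "x < y" and x': "x' \<in> W" "y' \<in> W" "x' < y'" for x y x' y'
  proof -
    have "T x y = T x' y'"
      using inj_onD[OF code_inj _ TF TF] code_eq[OF x] code_eq[OF x'] by simp
    have g: "inj_on (g p q) ?Y" "g p q ` ?Y \<subseteq> pts S" "g p q ` ?Y = A \<union> {\<beta> p, \<beta> q}"
      if pq: "p \<in> W" "q \<in> W" "p < q" for p q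
    proof -
      have "\<beta> p \<notin> A" "\<beta> q \<notin> A" "\<beta> p \<noteq> \<beta> q"
        using pq W(1) \<beta>(1) by (auto simp: Z_def inj_eq)
      then show "inj_on (g p q) ?Y"
        by (auto simp: inj_on_def g_def)
      show "g p q ` ?Y = A \<union> {\<beta> p, \<beta> q}"
        by (auto simp: g_def image_iff)
      then show "g p q ` ?Y \<subseteq> pts S"
        using A(2) \<beta>(2) by auto
    qed
    note gx = g[OF x] and gx' = g[OF x']
    have "emb_on (g x y ` ?Y) S (T x y) (inv_into ?Y (g x y))"
      using emb_on_inv[OF emb_on_pull[OF gx(1,2)]] by (simp add: T_def)
    moreover have "emb_on ?Y (T x y) S (g x' y')"
      using emb_on_pull[OF gx'(1,2)] \<open>T x y = T x' y'\<close> by (simp add: T_def)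
    ultimately have "emb_on (A \<union> {\<beta> x, \<beta> y}) S S (g x' y' \<circ> inv_into ?Y (g x y))"
      unfolding gx(3)[symmetric] by (rule emb_on_comp') (rule image_subsetI, rule inv_into_into)
    moreover have inv: "inv_into ?Y (g x y) (g x y z) = z" if "z \<in> ?Y" for z
      using inv_into_f_f[OF gx(1) that] .
    have "(g x' y' \<circ> inv_into ?Y (g x y)) a = a" if "a \<in> A" for a
      using inv[of "Inl a"] that by (simp add: g_def)
    moreover have "(g x' y' \<circ> inv_into ?Y (g x y)) (\<beta> x) = \<beta> x'"
      using inv[of "Inr False"] by (simp add: g_def)
    moreover have "(g x' y' \<circ> inv_into ?Y (g x y)) (\<beta> y) = \<beta> y'"
      using inv[of "Inr True"] by (simp add: g_def)
    ultimately show ?thesis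
      unfolding tp_eq_def by (intro exI[of _ "g x' y' \<circ> inv_into ?Y (g x y)"]) simp
  qed
  have "\<beta> i \<notin> A" "\<beta> j \<notin> A" "\<beta> k \<notin> A"
    using W(1) i j k by (auto simp: Z_def)
  moreover have "tp_eq S A [\<beta> i, \<beta> j] [\<beta> i, \<beta> k]" "tp_eq S A [\<beta> i, \<beta> j] [\<beta> j, \<beta> k]"
    using tp i j k less_trans by blast+
  ultimately show thesis
    using that j(2) k(2) by blast
qed

text \<open>Strict inclusion of solution sets is a strict order on single points that is invariant
  under equality of types over the constants of \<open>\<phi>\<close>; an SOP sequence would make it
  hold between the first two points of a homogeneous triple.\<close>

lemma elementary_diagram_NSOP:
  fixes M :: "(unit, 'u) struct"
  assumes M: "rich_struct M" and part: "partitioned (carrier M) \<phi> xs [y]"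
  shows "\<not> formula_SOP TYPE('u) (carrier M) (elementary_diagram M) \<phi> xs [y]"
proof
  assume "formula_SOP TYPE('u) (carrier M) (elementary_diagram M) \<phi> xs [y]"
  then obtain N :: "('u, 'u) struct" and b where mod: "is_model (carrier M) (elementary_diagram M) N"
    and bN: "\<And>i :: nat. b i \<in> tuples N [y]"
    and chain: "\<And>i. solutions N \<phi> xs [y] (b i) \<subset> solutions N \<phi> xs [y] (b (Suc i))"
    unfolding formula_SOP_def by blast
  have N: "rich_struct N"
    using elementary_diagram_model_rich[OF M mod] .
  then have rich: "rich (csb_of N)"
    by (simp add: rich_struct_def)
  define \<beta> where "\<beta> i = hd (b i)" for i
  have \<beta>: "b i = [\<beta> i]" "\<beta> i \<in> carrier N" for i
    using bN[of i] by (cases "b i"; simp add: tuples_def \<beta>_def)+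
  let ?Sol = "\<lambda>c. solutions N \<phi> xs [y] [c]"
  have less: "?Sol (\<beta> i) \<subset> ?Sol (\<beta> j)" if "i < j" for i j
    using that by (rule less_Suc_induct) (use chain \<beta>(1) in auto)
  have inj: "inj \<beta>"
    using less by (metis injI linorder_neqE_nat psubset_eq)
  define A where "A = const_val N ` fm_consts \<phi>"
  have "fm_consts \<phi> \<subseteq> carrier M"
    using part by (simp add: partitioned_def formulas_def)
  then have A: "finite A" "A \<subseteq> carrier N"
    using mod finite_fm_consts[of \<phi>] unfolding A_def is_model_def is_struct_def by blast+
  have fv: "fv \<phi> \<subseteq> set (xs @ [y])"
    using part by (simp add: partitioned_def)
  obtain i j k where ijk: "i < j" "j < k" "\<beta> i \<notin> A" "\<beta> j \<notin> A" "\<beta> k \<notin> A"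
    "tp_eq (csb_of N) A [\<beta> i, \<beta> j] [\<beta> i, \<beta> k]" "tp_eq (csb_of N) A [\<beta> i, \<beta> j] [\<beta> j, \<beta> k]"
    using homogeneous_triple[OF rich_csb[OF rich] A(1) _ inj] A(2) \<beta>(2) by (metis image_subsetI pts_csb_of)
  \<comment> \<open>The inclusion is transferred along the reversed type equality, and a tuple that
    makes it strict along the given one.\<close>
  have inv: "?Sol c' \<subset> ?Sol d'"
    if cd: "{c, d} \<subseteq> pts (csb_of N)" and tp: "tp_eq (csb_of N) A [c, d] [c', d']" and sub: "?Sol c \<subset> ?Sol d"
    for c d c' d'
  proof -
    have C: "c \<in> carrier N" "d \<in> carrier N"
      using cd by simp_all
    have C': "c' \<in> carrier N" "d' \<in> carrier N"
      using tp by (auto simp: tp_eq_def dest: emb_onD(2))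
    have tp': "tp_eq (csb_of N) A [c', d'] [c, d]"
      using tp_eq_sym[OF tp] A(2) C by simp
    have tuple: "a \<in> tuples N xs" if "a \<in> ?Sol z" for a z
      using that by (simp add: solutions_def)
    have "a \<in> ?Sol d'" if a: "a \<in> ?Sol c'" for a
    proof -
      obtain a' where "a' \<in> tuples N xs" "a \<in> ?Sol c' \<longleftrightarrow> a' \<in> ?Sol c" "a \<in> ?Sol d' \<longleftrightarrow> a' \<in> ?Sol d"
        using solutions_transfer[OF N fv A _ tp' C' refl tuple[OF a]] A_def by blast
      with a sub show ?thesis by blast
    qed
    moreover obtain a where a: "a \<in> ?Sol d" "a \<notin> ?Sol c"
      using sub by blast
    obtain a' where "a' \<in> tuples N xs" "a \<in> ?Sol c \<longleftrightarrow> a' \<in> ?Sol c'" "a \<in> ?Sol d \<longleftrightarrow> a' \<in> ?Sol d'"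
      using solutions_transfer[OF N fv A _ tp C refl tuple[OF a(1)]] A_def by blast
    with a have "a' \<in> ?Sol d'" "a' \<notin> ?Sol c'"
      by blast+
    ultimately show ?thesis
      by blast
  qed
  have "\<not> ?Sol (\<beta> i) \<subset> ?Sol (\<beta> j)"
  proof (rule no_invariant_strict_order[OF rich A(1), where Q = "\<lambda>c d. ?Sol c \<subset> ?Sol d"])
    show "A \<subseteq> pts (csb_of N)" using A(2) by simp
    show "\<beta> i \<in> pts (csb_of N) - A" "\<beta> j \<in> pts (csb_of N) - A" "\<beta> k \<in> pts (csb_of N) - A"
      using \<beta>(2) ijk by simp_all
    show "\<beta> i \<noteq> \<beta> j"
      using inj ijk(1) by (auto simp: inj_eq)
    show "tp_eq (csb_of N) A [\<beta> i, \<beta> j] [\<beta> i, \<beta> k]" "tp_eq (csb_of N) A [\<beta> i, \<beta> j] [\<beta> j, \<beta> k]"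
      using ijk by simp_all
    show "?Sol c \<subset> ?Sol c''" if "?Sol c \<subset> ?Sol c'" "?Sol c' \<subset> ?Sol c''" for c c' c''
      using that by (rule psubset_trans)
    show "\<not> ?Sol c \<subset> ?Sol c" for c
      by simp
  qed (rule inv)
  then show False
    using less[OF ijk(1)] by blast
qed

theorem theorem4p3:
  fixes U :: "'u itself"
  assumes "infinite (UNIV :: 'u set)"
  shows
    "(\<exists>T. model_companion TYPE(nat) {} switchboard_theory T) \<and>
     (\<forall>T. model_companion TYPE(nat) {} switchboard_theory T \<longrightarrow>
        model_companion U {} switchboard_theory T \<and>
        aleph0_categorical U {} T \<and>
        theory_SOP U {} T \<and>
        (\<forall>(M :: (unit, 'u) struct) \<phi> xs y.
           is_model {} T M \<and> partitioned (carrier M) \<phi> xs [y] \<longrightarrow>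
           \<not> formula_SOP U (carrier M) (elementary_diagram M) \<phi> xs [y]))"
proof -
  have "model_companion TYPE(nat) {} switchboard_theory rich_theory"
    by (rule rich_theory_companion) simp
  moreover have "model_companion U {} switchboard_theory T \<and> aleph0_categorical U {} T \<and> theory_SOP U {} T \<and>
      (\<forall>(M :: (unit, 'u) struct) \<phi> xs y.
         is_model {} T M \<and> partitioned (carrier M) \<phi> xs [y] \<longrightarrow>
         \<not> formula_SOP U (carrier M) (elementary_diagram M) \<phi> xs [y])"
    if T: "model_companion TYPE(nat) {} switchboard_theory T" for T
  proof -
    have models: "is_model {} T M \<longleftrightarrow> rich_struct M" for M :: "(unit, 'u) struct"
      using companion_models[OF T] .
    \<comment> \<open>\<open>U\<close> and \<open>TYPE('u)\<close> only carry a type, and unfolding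
      the definitions makes them disappear.\<close>
    have "model_companion U {} switchboard_theory T"
      using companion_universe[OF assms T] by (simp add: model_companion_def model_complete_def)
    moreover have "aleph0_categorical U {} T"
      using rich_aleph0_categorical[OF assms models] by (simp add: aleph0_categorical_def)
    moreover have "theory_SOP U {} T"
      using rich_theory_SOP[OF assms models] by (simp add: theory_SOP_def formula_SOP_def)
    moreover have "\<not> formula_SOP U (carrier M) (elementary_diagram M) \<phi> xs [y]"
      if "is_model {} T M" "partitioned (carrier M) \<phi> xs [y]" for M :: "(unit, 'u) struct" and \<phi> xs y
      using elementary_diagram_NSOP[of M \<phi> xs y] that models by (simp add: formula_SOP_def)
    ultimately show ?thesis
      by blast
  qed
  ultimately show ?thesis
    by blast
qed

end
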